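(* Let $(M^3,g,f)$ be a three-dimensional complete gradient Ricci soliton whose Bach tensor $B$ is divergence-free, i.e. $\operatorname{div} B=0$. Then $(M^3,g)$ is either Einstein or locally conformally flat.
   Context: A complete gradient Ricci soliton $(M^n,g,f)$ is a complete Riemannian manifold $(M^n,g)$ together with a smooth function $f$ on $M$ such that $R_{ij}+\nabla_i\nabla_j f=\rho\, g_{ij}$ for some constant $\rho\in\mathbb{R}$, where $R_{ij}$ is the Ricci tensor; $R$ denotes the scalar curvature. Cotton tensor in dimension $n=3$: $C_{ijk}=\nabla_i R_{jk}-\nabla_j R_{ik}-\frac{1}{4}(g_{jk}\nabla_i R-g_{ik}\nabla_j R)$. Bach tensor in dimension $3$ is defined as $B_{ij}=\nabla^k C_{kij}$ (a symmetric 2-tensor), and $(\operatorname{div}B)_i=\nabla^j B_{ij}$. *)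

theory Defs
  imports "HOL-Analysis.Analysis"
begin

section \<open>Partial derivatives and smoothness on open subsets of Euclidean space\<close>

definition partial :: "'n::finite \<Rightarrow> (real ^ 'n \<Rightarrow> real) \<Rightarrow> real ^ 'n \<Rightarrow> real" where
  "partial i h x = frechet_derivative h (at x) (axis i 1)"

text \<open>
  Only meant for open \<open>S\<close>, because \<^const>\<open>partial\<close> is taken in the ambient space.  On an open
  set it depends only on the values of the function there, so these may be junk outside \<open>S\<close>.
\<close>

fun Ck_on :: "nat \<Rightarrow> (real ^ 'n::finite) set \<Rightarrow> (real ^ 'n \<Rightarrow> real) \<Rightarrow> bool" where
  "Ck_on 0 S h \<longleftrightarrow> continuous_on S h"
| "Ck_on (Suc k) S h \<longleftrightarrow> h differentiable_on S \<and> (\<forall>i. Ck_on k S (partial i h))"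

definition smooth_on :: "(real ^ 'n::finite) set \<Rightarrow> (real ^ 'n \<Rightarrow> real) \<Rightarrow> bool" where
  "smooth_on S h \<longleftrightarrow> (\<forall>k. Ck_on k S h)"


section \<open>Smooth manifolds\<close>

text \<open>
  A chart is a pair of a domain \<open>U\<close> and a coordinate map; the values of the coordinate map
  outside \<open>U\<close> are irrelevant.
\<close>

type_synonym ('a, 'n) chart = "'a set \<times> ('a \<Rightarrow> real ^ 'n)"

definition chart_image :: "('a, 'n) chart \<Rightarrow> (real ^ 'n) set" where
  "chart_image c = snd c ` fst c"

definition chart_inv :: "('a, 'n) chart \<Rightarrow> real ^ 'n \<Rightarrow> 'a" where
  "chart_inv c = inv_into (fst c) (snd c)"

definition is_chart :: "'a topology \<Rightarrow> ('a, 'n::finite) chart \<Rightarrow> bool" where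
  "is_chart X c \<longleftrightarrow>
     openin X (fst c) \<and> open (chart_image c) \<and>
     homeomorphic_map (subtopology X (fst c)) (top_of_set (chart_image c)) (snd c)"

definition transition :: "('a, 'n) chart \<Rightarrow> ('a, 'n) chart \<Rightarrow> real ^ 'n \<Rightarrow> real ^ 'n" where
  "transition c d = snd d \<circ> chart_inv c"

definition overlap :: "('a, 'n) chart \<Rightarrow> ('a, 'n) chart \<Rightarrow> (real ^ 'n) set" where
  "overlap c d = snd c ` (fst c \<inter> fst d)"

text \<open>The atlas need not be maximal.\<close>

definition smooth_manifold :: "'a topology \<Rightarrow> ('a, 'n::finite) chart set \<Rightarrow> bool" where
  "smooth_manifold X A \<longleftrightarrow>
     Hausdorff_space X \<and> second_countable X \<and>
     (\<forall>c\<in>A. is_chart X c) \<and> topspace X = (\<Union>c\<in>A. fst c) \<and>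
     (\<forall>c\<in>A. \<forall>d\<in>A. \<forall>k. smooth_on (overlap c d) (\<lambda>x. transition c d x $ k))"

definition smooth_function :: "('a, 'n::finite) chart set \<Rightarrow> ('a \<Rightarrow> real) \<Rightarrow> bool" where
  "smooth_function A f \<longleftrightarrow> (\<forall>c\<in>A. smooth_on (chart_image c) (f \<circ> chart_inv c))"


section \<open>Riemannian metrics\<close>

text \<open>
  A metric is given by its matrices of components, one matrix-valued function for each chart,
  related by the transformation law of covariant 2-tensors.
\<close>

type_synonym 'n metric_components = "real ^ 'n \<Rightarrow> real ^ 'n ^ 'n"

definition riemannian_metric ::
  "('a, 'n::finite) chart set \<Rightarrow> (('a, 'n) chart \<Rightarrow> 'n metric_components) \<Rightarrow> bool" where
  "riemannian_metric A g \<longleftrightarrow>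
     (\<forall>c\<in>A. (\<forall>i j. smooth_on (chart_image c) (\<lambda>x. g c x $ i $ j)) \<and>
            (\<forall>x\<in>chart_image c. transpose (g c x) = g c x \<and>
               (\<forall>v. v \<noteq> 0 \<longrightarrow> v \<bullet> (g c x *v v) > 0))) \<and>
     (\<forall>c\<in>A. \<forall>d\<in>A. \<forall>x\<in>overlap c d. \<forall>i j.
        g c x $ i $ j =
          (\<Sum>k\<in>UNIV. \<Sum>l\<in>UNIV. partial i (\<lambda>y. transition c d y $ k) x *
             partial j (\<lambda>y. transition c d y $ l) x * g d (transition c d x) $ k $ l))"

definition riemannian_manifold ::
  "'a topology \<Rightarrow> ('a, 'n::finite) chart set \<Rightarrow> (('a, 'n) chart \<Rightarrow> 'n metric_components) \<Rightarrow> bool" where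
  "riemannian_manifold X A g \<longleftrightarrow> smooth_manifold X A \<and> riemannian_metric A g"


section \<open>Tensor calculus in coordinates\<close>

definition inverse_metric :: "'n::finite metric_components \<Rightarrow> 'n \<Rightarrow> 'n \<Rightarrow> real ^ 'n \<Rightarrow> real" where
  "inverse_metric G i j x = matrix_inv (G x) $ i $ j"

text \<open>\<open>christoffel G k i j\<close> is the symbol with upper index \<open>k\<close> and lower indices \<open>i\<close>, \<open>j\<close>.\<close>

definition christoffel :: "'n::finite metric_components \<Rightarrow> 'n \<Rightarrow> 'n \<Rightarrow> 'n \<Rightarrow> real ^ 'n \<Rightarrow> real" where
  "christoffel G k i j x =
     (\<Sum>l\<in>UNIV. inverse_metric G k l x *
        (partial i (\<lambda>y. G y $ j $ l) x + partial j (\<lambda>y. G y $ i $ l) x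
           - partial l (\<lambda>y. G y $ i $ j) x)) / 2"

text \<open>
  \<open>riemann G l k i j\<close> is the coefficient of the \<open>l\<close>-th coordinate field in
  \<open>R(\<partial>\<^sub>i, \<partial>\<^sub>j) \<partial>\<^sub>k\<close>, where \<open>R(Y, Z) = [\<nabla>\<^sub>Y, \<nabla>\<^sub>Z] - \<nabla>\<^bsub>[Y, Z]\<^esub>\<close>;
  the Ricci tensor contracts \<open>l\<close> with \<open>i\<close>, so that round spheres have positive Ricci curvature.
\<close>

definition riemann ::
  "'n::finite metric_components \<Rightarrow> 'n \<Rightarrow> 'n \<Rightarrow> 'n \<Rightarrow> 'n \<Rightarrow> real ^ 'n \<Rightarrow> real" where
  "riemann G l k i j x =
     partial i (christoffel G l j k) x - partial j (christoffel G l i k) x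
     + (\<Sum>m\<in>UNIV. christoffel G l i m x * christoffel G m j k x
                 - christoffel G l j m x * christoffel G m i k x)"

definition ricci :: "'n::finite metric_components \<Rightarrow> 'n \<Rightarrow> 'n \<Rightarrow> real ^ 'n \<Rightarrow> real" where
  "ricci G j k x = (\<Sum>i\<in>UNIV. riemann G i k i j x)"

definition scalar_curvature :: "'n::finite metric_components \<Rightarrow> real ^ 'n \<Rightarrow> real" where
  "scalar_curvature G x = (\<Sum>j\<in>UNIV. \<Sum>k\<in>UNIV. inverse_metric G j k x * ricci G j k x)"

text \<open>
  Covariant derivatives of covariant tensors of rank 1, 2 and 3.  The first index is the
  direction of differentiation: \<open>nabla2 G T i j k\<close> is \<open>\<nabla>\<^sub>i T\<^sub>j\<^sub>k\<close>.
\<close>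

definition nabla1 ::
  "'n::finite metric_components \<Rightarrow> ('n \<Rightarrow> real ^ 'n \<Rightarrow> real) \<Rightarrow> 'n \<Rightarrow> 'n \<Rightarrow> real ^ 'n \<Rightarrow> real" where
  "nabla1 G T i j x = partial i (T j) x - (\<Sum>m\<in>UNIV. christoffel G m i j x * T m x)"

definition nabla2 ::
  "'n::finite metric_components \<Rightarrow> ('n \<Rightarrow> 'n \<Rightarrow> real ^ 'n \<Rightarrow> real) \<Rightarrow>
     'n \<Rightarrow> 'n \<Rightarrow> 'n \<Rightarrow> real ^ 'n \<Rightarrow> real" where
  "nabla2 G T i j k x =
     partial i (T j k) x
     - (\<Sum>m\<in>UNIV. christoffel G m i j x * T m k x)
     - (\<Sum>m\<in>UNIV. christoffel G m i k x * T j m x)"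

definition nabla3 ::
  "'n::finite metric_components \<Rightarrow> ('n \<Rightarrow> 'n \<Rightarrow> 'n \<Rightarrow> real ^ 'n \<Rightarrow> real) \<Rightarrow>
     'n \<Rightarrow> 'n \<Rightarrow> 'n \<Rightarrow> 'n \<Rightarrow> real ^ 'n \<Rightarrow> real" where
  "nabla3 G T i j k l x =
     partial i (T j k l) x
     - (\<Sum>m\<in>UNIV. christoffel G m i j x * T m k l x)
     - (\<Sum>m\<in>UNIV. christoffel G m i k x * T j m l x)
     - (\<Sum>m\<in>UNIV. christoffel G m i l x * T j k m x)"

definition hessian ::
  "'n::finite metric_components \<Rightarrow> (real ^ 'n \<Rightarrow> real) \<Rightarrow> 'n \<Rightarrow> 'n \<Rightarrow> real ^ 'n \<Rightarrow> real" where
  "hessian G h = nabla1 G (\<lambda>j. partial j h)"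

definition cotton :: "3 metric_components \<Rightarrow> 3 \<Rightarrow> 3 \<Rightarrow> 3 \<Rightarrow> real ^ 3 \<Rightarrow> real" where
  "cotton G i j k x =
     nabla2 G (ricci G) i j k x - nabla2 G (ricci G) j i k x
     - 1 / 4 * (G x $ j $ k * partial i (scalar_curvature G) x
                - G x $ i $ k * partial j (scalar_curvature G) x)"

definition bach :: "3 metric_components \<Rightarrow> 3 \<Rightarrow> 3 \<Rightarrow> real ^ 3 \<Rightarrow> real" where
  "bach G i j x =
     (\<Sum>k\<in>UNIV. \<Sum>l\<in>UNIV. inverse_metric G k l x * nabla3 G (cotton G) l k i j x)"

definition div_bach :: "3 metric_components \<Rightarrow> 3 \<Rightarrow> real ^ 3 \<Rightarrow> real" where
  "div_bach G i x =
     (\<Sum>j\<in>UNIV. \<Sum>k\<in>UNIV. inverse_metric G j k x * nabla2 G (bach G) k i j x)"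

definition divergence_free_bach ::
  "('a, 3) chart set \<Rightarrow> (('a, 3) chart \<Rightarrow> 3 metric_components) \<Rightarrow> bool" where
  "divergence_free_bach A g \<longleftrightarrow> (\<forall>c\<in>A. \<forall>x\<in>chart_image c. \<forall>i. div_bach (g c) i x = 0)"


section \<open>Completeness\<close>

text \<open>In each chart, \<open>v\<close> is the coordinate velocity of the curve.\<close>

definition geodesic ::
  "'a topology \<Rightarrow> ('a, 'n::finite) chart set \<Rightarrow> (('a, 'n) chart \<Rightarrow> 'n metric_components) \<Rightarrow>
     (real \<Rightarrow> 'a) \<Rightarrow> bool" where
  "geodesic X A g \<gamma> \<longleftrightarrow>
     continuous_map euclideanreal X \<gamma> \<and>
     (\<forall>c\<in>A. \<exists>v :: real \<Rightarrow> real ^ 'n. \<forall>t. \<gamma> t \<in> fst c \<longrightarrow>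
        ((snd c \<circ> \<gamma>) has_vector_derivative v t) (at t) \<and>
        (v has_vector_derivative
           (\<chi> k. - (\<Sum>i\<in>UNIV. \<Sum>j\<in>UNIV.
                     christoffel (g c) k i j (snd c (\<gamma> t)) * v t $ i * v t $ j))) (at t))"

text \<open>
  Every tangent vector is the initial velocity of a geodesic defined for all times; by Hopf and
  Rinow this amounts to completeness of the Riemannian distance when \<open>X\<close> is connected.
\<close>

definition complete_metric ::
  "'a topology \<Rightarrow> ('a, 'n::finite) chart set \<Rightarrow> (('a, 'n) chart \<Rightarrow> 'n metric_components) \<Rightarrow> bool" where
  "complete_metric X A g \<longleftrightarrow>
     (\<forall>c\<in>A. \<forall>p\<in>fst c. \<forall>w. \<exists>\<gamma>.
        geodesic X A g \<gamma> \<and> \<gamma> 0 = p \<and> ((snd c \<circ> \<gamma>) has_vector_derivative w) (at 0))"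


section \<open>Solitons, Einstein metrics and conformal flatness\<close>

definition complete_gradient_ricci_soliton ::
  "'a topology \<Rightarrow> ('a, 'n::finite) chart set \<Rightarrow> (('a, 'n) chart \<Rightarrow> 'n metric_components) \<Rightarrow>
     ('a \<Rightarrow> real) \<Rightarrow> bool" where
  "complete_gradient_ricci_soliton X A g f \<longleftrightarrow>
     riemannian_manifold X A g \<and> complete_metric X A g \<and> smooth_function A f \<and>
     (\<exists>\<rho>. \<forall>c\<in>A. \<forall>x\<in>chart_image c. \<forall>i j.
        ricci (g c) i j x + hessian (g c) (f \<circ> chart_inv c) i j x = \<rho> * g c x $ i $ j)"

definition einstein ::
  "('a, 'n::finite) chart set \<Rightarrow> (('a, 'n) chart \<Rightarrow> 'n metric_components) \<Rightarrow> bool" where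
  "einstein A g \<longleftrightarrow>
     (\<exists>r. \<forall>c\<in>A. \<forall>x\<in>chart_image c. \<forall>i j. ricci (g c) i j x = r * g c x $ i $ j)"

definition flat_on :: "(real ^ 'n::finite) set \<Rightarrow> 'n metric_components \<Rightarrow> bool" where
  "flat_on V G \<longleftrightarrow> (\<forall>x\<in>V. \<forall>l k i j. riemann G l k i j x = 0)"

text \<open>
  Every point has a neighbourhood carrying a smooth function \<open>u\<close> such that the curvature of
  \<open>exp (2 u) g\<close> vanishes there.  The neighbourhood is taken inside the domain of a chart and
  described by its coordinate image \<open>V\<close>.
\<close>

definition locally_conformally_flat ::
  "('a, 'n::finite) chart set \<Rightarrow> (('a, 'n) chart \<Rightarrow> 'n metric_components) \<Rightarrow> bool" where
  "locally_conformally_flat A g \<longleftrightarrow>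
     (\<forall>c\<in>A. \<forall>x\<in>chart_image c. \<exists>V u.
        open V \<and> x \<in> V \<and> V \<subseteq> chart_image c \<and> smooth_on V u \<and>
        flat_on V (\<lambda>y. exp (2 * u y) *\<^sub>R g c y))"

end

(*
Everything is local. Write C for the Cotton tensor and S = Ric - R/4 g for the Schouten tensor.
The contracted Bianchi identity makes C trace free, and commuting derivatives gives
div C = 0 in the first index and then div B_i = - C_ijk R^jk. The soliton equation and the vanishing of the Weyl
tensor give C_ijk = f_i R_jk - f_j R_ik + (trace terms), so |C|^2 = 2 C^ijk f_i R_jk = - 2 <div B, df> = 0.

If C = 0, then the tractor connection on triples (sigma, mu, rho) is flat. A parallel section with sigma = 1 at
a given point and 2 sigma rho + |mu|^2 = 0 yields a flat metric sigma^(-2) g near that point. Thus the metric is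
always locally conformally flat.
*)

theory Submission
  imports Defs
begin

section \<open>Partial derivatives and smooth functions\<close>

text \<open>The divergence of C that vanishes is the one in the last index; in the first index it is
  B itself. To use it, the two derivatives in nabla^j nabla^k C_kij have to be exchanged, and
  dimension three enters there: with the curvature written through S, the three terms of the
  exchange contract to -X, X and X, where X_i = S^jk C_ijk = R^jk C_ijk. The formula for C on a
  soliton comes from nabla_i R_jk = - nabla_i nabla_j f_k, whose skew part in i and j is the
  curvature applied to df. Any parallel section with positive sigma makes sigma^(-2) g a metric of
  constant curvature -(2 sigma rho + |mu|^2), which explains the normalization to zero. Two
  obstacles shape the text. The parallel section must come from an existence theorem for linear
  total differential equations, built up from a contraction argument along rays. And index
  contractions over three pairs are too large to expand, so the tensor algebra is done at one point
  with nested abstract traces; only small identities are expanded into components.\<close>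

lemma partial_eqI: "(h has_derivative h') (at x) \<Longrightarrow> partial i h x = h' (axis i 1)"
  unfolding partial_def using frechet_derivative_at by metis

lemma has_derivative_partial:
  "h differentiable at x \<Longrightarrow> (h has_derivative (\<lambda>v. \<Sum>k\<in>UNIV. v $ k * partial k h x)) (at x)"
proof -
  assume "h differentiable at x"
  then have D: "(h has_derivative frechet_derivative h (at x)) (at x)"
    using frechet_derivative_works by blast
  then interpret linear "frechet_derivative h (at x)" by (rule has_derivative_linear)
  have "frechet_derivative h (at x) = (\<lambda>v. \<Sum>k\<in>UNIV. v $ k * partial k h x)"
  proof
    fix v :: "real^'a"
    have "frechet_derivative h (at x) v = frechet_derivative h (at x) (\<Sum>k\<in>UNIV. v $ k *\<^sub>R axis k 1)"
      using basis_expansion[of v] by (simp add: scalar_mult_eq_scaleR)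
    then show "frechet_derivative h (at x) v = (\<Sum>k\<in>UNIV. v $ k * partial k h x)"
      by (simp add: sum scale partial_def)
  qed
  with D show ?thesis by simp
qed

lemma partial_const [simp]: "partial i (\<lambda>x. c) x = 0"
  by (simp add: partial_def)

context
  fixes h k :: "real^'n::finite \<Rightarrow> real" and x
  assumes h: "h differentiable at x" and k: "k differentiable at x"
begin

lemmas hk_D = h[unfolded frechet_derivative_works] k[unfolded frechet_derivative_works]

lemma partial_add: "partial i (\<lambda>y. h y + k y) x = partial i h x + partial i k x"
  by (rule partial_eqI[THEN trans], rule has_derivative_add[OF hk_D]) (simp add: partial_def)

lemma partial_diff: "partial i (\<lambda>y. h y - k y) x = partial i h x - partial i k x"
  by (rule partial_eqI[THEN trans], rule has_derivative_diff[OF hk_D]) (simp add: partial_def)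

lemma partial_mult: "partial i (\<lambda>y. h y * k y) x = partial i h x * k x + h x * partial i k x"
  by (rule partial_eqI[THEN trans], rule has_derivative_mult[OF hk_D]) (simp add: partial_def)

end

lemma partial_DERIV_compose:
  assumes "h differentiable at x" "(\<phi> has_real_derivative d) (at (h x))"
  shows "partial i (\<lambda>y. \<phi> (h y)) x = d * partial i h x"
    and "(\<lambda>y. \<phi> (h y)) differentiable at x"
proof -
  have D: "((\<lambda>y. \<phi> (h y)) has_derivative (\<lambda>v. d * frechet_derivative h (at x) v)) (at x)"
    using has_derivative_compose[OF assms(1)[unfolded frechet_derivative_works]] assms(2)
    unfolding has_field_derivative_def by blast
  from partial_eqI[OF D] show "partial i (\<lambda>y. \<phi> (h y)) x = d * partial i h x"
    by (simp add: partial_def)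
  from D show "(\<lambda>y. \<phi> (h y)) differentiable at x" by (auto simp: differentiable_def)
qed

lemma partial_minus: "h differentiable at x \<Longrightarrow> partial i (\<lambda>y. - h y) x = - partial i h x"
  by (rule partial_eqI[THEN trans], rule has_derivative_minus, simp add: frechet_derivative_works)
    (simp add: partial_def)

lemma partial_sum:
  assumes "finite I" "\<And>a. a \<in> I \<Longrightarrow> h a differentiable at x"
  shows "partial i (\<lambda>y. \<Sum>a\<in>I. h a y) x = (\<Sum>a\<in>I. partial i (h a) x)"
proof -
  have "((\<lambda>y. \<Sum>a\<in>I. h a y) has_derivative (\<lambda>v. \<Sum>a\<in>I. frechet_derivative (h a) (at x) v)) (at x)"
    using assms by (intro has_derivative_sum) (simp add: frechet_derivative_works)
  from partial_eqI[OF this] show ?thesis by (simp add: partial_def)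
qed

text \<open>No differentiability is required: \<open>frechet_derivative\<close> chooses among all
  derivatives at \<open>x\<close>, and both functions have the same ones, so the choices coincide
  even when there are none.\<close>

lemma partial_cong:
  assumes "open S" "x \<in> S" "\<And>y. y \<in> S \<Longrightarrow> h y = k y"
  shows "partial i h x = partial i k x"
proof -
  have "(h has_derivative D) (at x) \<longleftrightarrow> (k has_derivative D) (at x)" for D
    using assms has_derivative_transform_within_open[of h D x UNIV S k]
      has_derivative_transform_within_open[of k D x UNIV S h] by auto
  then show ?thesis by (simp add: partial_def frechet_derivative_def)
qed

lemma differentiable_at_cong:
  assumes "open S" "x \<in> S" "\<And>y. y \<in> S \<Longrightarrow> h y = k y" "h differentiable at x"
  shows "k differentiable at x"
  using assms has_derivative_transform_within_open[of h _ x UNIV S k] unfolding differentiable_def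
  by blast

section \<open>Closure properties of C^k and smooth functions\<close>

lemma Ck_on_cong:
  assumes "open S" "\<And>y. y \<in> S \<Longrightarrow> h y = k y" "Ck_on n S h"
  shows "Ck_on n S k"
  using assms(2,3)
proof (induction n arbitrary: h k)
  case 0
  then show ?case using continuous_on_cong[OF refl, of S h k] by simp
next
  case (Suc n)
  have "k differentiable_on S"
    using Suc.prems assms(1) differentiable_at_cong[OF assms(1) _ Suc.prems(1)]
    by (simp add: differentiable_on_eq_differentiable_at)
  moreover have "Ck_on n S (partial i k)" for i
    using Suc.IH[of "partial i h" "partial i k"] Suc.prems partial_cong[OF assms(1) _ Suc.prems(1)]
    by simp
  ultimately show ?case by simp
qed

lemma smooth_on_cong:
  "open S \<Longrightarrow> (\<And>y. y \<in> S \<Longrightarrow> h y = k y) \<Longrightarrow> smooth_on S h \<Longrightarrow> smooth_on S k"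
  unfolding smooth_on_def using Ck_on_cong by blast

lemma smooth_on_differentiable:
  assumes "smooth_on S h" "open S" "x \<in> S"
  shows "h differentiable at x"
proof -
  have "Ck_on (Suc 0) S h" using assms(1) unfolding smooth_on_def by blast
  then show ?thesis using assms(2,3) by (simp add: differentiable_on_eq_differentiable_at)
qed

lemma smooth_on_partial:
  assumes "smooth_on S h"
  shows "smooth_on S (partial i h)"
  unfolding smooth_on_def
proof
  fix n
  have "Ck_on (Suc n) S h" using assms unfolding smooth_on_def by blast
  then show "Ck_on n S (partial i h)" by simp
qed

lemma smooth_on_continuous: "smooth_on S h \<Longrightarrow> continuous_on S h"
  using Ck_on.simps(1)[of S h] unfolding smooth_on_def by metis

lemma Ck_on_subset: "Ck_on n S h \<Longrightarrow> T \<subseteq> S \<Longrightarrow> Ck_on n T h"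
  by (induction n arbitrary: h) (auto intro: continuous_on_subset differentiable_on_subset)

lemma smooth_on_subset: "smooth_on S h \<Longrightarrow> T \<subseteq> S \<Longrightarrow> smooth_on T h"
  unfolding smooth_on_def using Ck_on_subset by blast

lemma Ck_on_const: "Ck_on n S (\<lambda>x. c)"
proof (induction n arbitrary: c)
  case (Suc n)
  have "partial i (\<lambda>x. c) = (\<lambda>x. 0)" for i :: 'a by (rule ext) simp
  with Suc show ?case by simp
qed simp

lemma smooth_on_const [simp]: "smooth_on S (\<lambda>x. c)"
  unfolding smooth_on_def using Ck_on_const by blast

lemma Ck_on_add:
  assumes "open S" "Ck_on n S h" "Ck_on n S k"
  shows "Ck_on n S (\<lambda>x. h x + k x)"
  using assms(2,3)
proof (induction n arbitrary: h k)
  case (Suc n)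
  have d: "h differentiable at x" "k differentiable at x" if "x \<in> S" for x
    using Suc.prems that assms(1) by (auto simp: differentiable_on_eq_differentiable_at)
  have "Ck_on n S (partial i (\<lambda>x. h x + k x))" for i
    by (rule Ck_on_cong[OF assms(1) _ Suc.IH[of "partial i h" "partial i k"]])
      (use Suc.prems d in \<open>auto simp: partial_add\<close>)
  then show ?case using Suc.prems by (auto intro: differentiable_on_add)
qed (auto intro: continuous_on_add)

lemma Ck_on_Suc_imp: "open S \<Longrightarrow> Ck_on (Suc n) S h \<Longrightarrow> Ck_on n S h"
  by (induction n arbitrary: h)
    (auto intro: continuous_on_subset differentiable_imp_continuous_on)

text \<open>In the Leibniz rule one factor stays undifferentiated, so the induction step also needs
  \<open>h\<close> and \<open>k\<close> themselves in class C^n; \<open>Ck_on_Suc_imp\<close>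
  supplies this.\<close>

lemma Ck_on_mult:
  assumes "open S" "Ck_on n S h" "Ck_on n S k"
  shows "Ck_on n S (\<lambda>x. h x * k x)"
  using assms(2,3)
proof (induction n arbitrary: h k)
  case (Suc n)
  have d: "h differentiable at x" "k differentiable at x" if "x \<in> S" for x
    using Suc.prems that assms(1) by (auto simp: differentiable_on_eq_differentiable_at)
  note low = Ck_on_Suc_imp[OF assms(1) Suc.prems(1)] Ck_on_Suc_imp[OF assms(1) Suc.prems(2)]
  have "Ck_on n S (partial i (\<lambda>x. h x * k x))" for i
    by (rule Ck_on_cong[OF assms(1) _ Ck_on_add[OF assms(1) Suc.IH[of "partial i h" k] Suc.IH[of h "partial i k"]]])
      (use Suc.prems low d in \<open>auto simp: partial_mult\<close>)
  then show ?case using Suc.prems assms(1) d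
    by (auto simp: differentiable_on_eq_differentiable_at intro: differentiable_mult)
qed (auto intro: continuous_on_mult)

context
  fixes S :: "(real^'n::finite) set"
  assumes S: "open S"
begin

lemma smooth_on_add: "smooth_on S h \<Longrightarrow> smooth_on S k \<Longrightarrow> smooth_on S (\<lambda>x. h x + k x)"
  unfolding smooth_on_def using Ck_on_add[OF S] by blast

lemma smooth_on_mult: "smooth_on S h \<Longrightarrow> smooth_on S k \<Longrightarrow> smooth_on S (\<lambda>x. h x * k x)"
  unfolding smooth_on_def using Ck_on_mult[OF S] by blast

lemma smooth_on_minus: "smooth_on S h \<Longrightarrow> smooth_on S (\<lambda>x. - h x)"
  using smooth_on_mult[of "\<lambda>x. -1" h] by simp

lemma smooth_on_diff: "smooth_on S h \<Longrightarrow> smooth_on S k \<Longrightarrow> smooth_on S (\<lambda>x. h x - k x)"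
  using smooth_on_add[OF _ smooth_on_minus, of h k] by simp

lemma smooth_on_divide_const: "smooth_on S h \<Longrightarrow> smooth_on S (\<lambda>x. h x / (c::real))"
  using smooth_on_mult[of "\<lambda>x. 1/c" h] by simp

lemma smooth_on_sum:
  "finite I \<Longrightarrow> (\<And>a. a \<in> I \<Longrightarrow> smooth_on S (h a)) \<Longrightarrow> smooth_on S (\<lambda>x. \<Sum>a\<in>I. h a x)"
  by (induction I rule: finite_induct) (auto intro: smooth_on_add)

text \<open>If all \<open>y a\<close> are C^n, the equations show their partial derivatives to be
  C^n, so the \<open>y a\<close> are C^(n+1). The index \<open>a\<close> is generalized because the
  right-hand side involves every \<open>y b\<close>.\<close>

lemma Ck_on_bootstrap:
  assumes "finite I"
    and "\<And>a x. a \<in> I \<Longrightarrow> x \<in> S \<Longrightarrow> y a differentiable at x"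
    and "\<And>a i x. a \<in> I \<Longrightarrow> x \<in> S \<Longrightarrow> partial i (y a) x = (\<Sum>b\<in>I. B i a b x * y b x)"
    and "\<And>i a b. smooth_on S (B i a b)"
  shows "a \<in> I \<Longrightarrow> Ck_on n S (y a)"
proof (induction n arbitrary: a)
  case 0
  then show ?case using assms(2) by (simp add: continuous_at_imp_continuous_on differentiable_imp_continuous_within)
next
  case (Suc n)
  have s: "finite J \<Longrightarrow> J \<subseteq> I \<Longrightarrow> Ck_on n S (\<lambda>x. \<Sum>b\<in>J. B i a b x * y b x)" for J i
  proof (induction J rule: finite_induct)
    case (insert b J)
    have "Ck_on n S (\<lambda>x. B i a b x * y b x)"
      using assms(4) Suc.IH insert by (intro Ck_on_mult S) (auto simp: smooth_on_def)
    with insert show ?case by (simp add: Ck_on_add S)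
  qed (simp add: Ck_on_const)
  have "Ck_on n S (partial i (y a))" for i
    by (rule Ck_on_cong[OF S _ s[OF assms(1)]]) (use Suc.prems assms(3) in auto)
  then show ?case
    using Suc.prems assms(2) S by (simp add: differentiable_on_eq_differentiable_at)
qed

lemma smooth_on_bootstrap:
  assumes "finite I"
    and "\<And>a x. a \<in> I \<Longrightarrow> x \<in> S \<Longrightarrow> y a differentiable at x"
    and "\<And>a i x. a \<in> I \<Longrightarrow> x \<in> S \<Longrightarrow> partial i (y a) x = (\<Sum>b\<in>I. B i a b x * y b x)"
    and "\<And>i a b. smooth_on S (B i a b)" "a \<in> I"
  shows "smooth_on S (y a)"
  unfolding smooth_on_def by (intro allI Ck_on_bootstrap[OF assms])

text \<open>An outer function with \<phi>' = c \<phi>^m reproduces itself under differentiation, so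
  its regularity can be bootstrapped like that of a solution of a differential equation. The
  reciprocal (c = -1, m = 2) and the exponential (c = m = 1) are the instances.\<close>

lemma smooth_on_compose_pow:
  fixes \<phi> :: "real \<Rightarrow> real"
  assumes "smooth_on S h"
    and d: "\<And>x. x \<in> S \<Longrightarrow> (\<phi> has_real_derivative c * \<phi> (h x) ^ m) (at (h x))" 
  shows "smooth_on S (\<lambda>x. \<phi> (h x))"
  unfolding smooth_on_def
proof
  fix n
  have D: "(\<lambda>x. \<phi> (h x)) differentiable at x" if "x \<in> S" for x
    using smooth_on_differentiable[OF assms(1) S that] d[OF that] by (rule partial_DERIV_compose(2))
  show "Ck_on n S (\<lambda>x. \<phi> (h x))"
  proof (induction n)
    case 0
    then show ?case using D by (simp add: continuous_at_imp_continuous_on differentiable_imp_continuous_within)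
  next
    case (Suc n)
    have p: "Ck_on n S (\<lambda>x. \<phi> (h x) ^ m)" for m
    proof (induction m)
      case (Suc m)
      then show ?case using Ck_on_mult[OF S \<open>Ck_on n S (\<lambda>x. \<phi> (h x))\<close>] by simp
    qed (simp add: Ck_on_const)
    have "Ck_on n S (partial i (\<lambda>x. \<phi> (h x)))" for i
    proof (rule Ck_on_cong[OF S])
      show "Ck_on n S (\<lambda>x. (c * \<phi> (h x) ^ m) * partial i h x)"
        using smooth_on_partial[OF assms(1)] unfolding smooth_on_def
        by (intro Ck_on_mult S p Ck_on_const) auto
      show "c * \<phi> (h x) ^ m * partial i h x = partial i (\<lambda>x. \<phi> (h x)) x" if "x \<in> S" for x
        using partial_DERIV_compose(1)[OF smooth_on_differentiable[OF assms(1) S that] d[OF that]] by simp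
    qed
    then show ?case using D S by (simp add: differentiable_on_eq_differentiable_at)
  qed
qed

lemma smooth_on_inverse:
  assumes "smooth_on S h" "\<And>x. x \<in> S \<Longrightarrow> h x \<noteq> 0"
  shows "smooth_on S (\<lambda>x. inverse (h x))"
  by (rule smooth_on_compose_pow[OF assms(1), where c = "-1" and m = 2])
    (use assms(2) in \<open>auto intro!: derivative_eq_intros simp: power2_eq_square\<close>)

lemma smooth_on_divide:
  "smooth_on S k \<Longrightarrow> smooth_on S h \<Longrightarrow> (\<And>x. x \<in> S \<Longrightarrow> h x \<noteq> 0) \<Longrightarrow> smooth_on S (\<lambda>x. k x / h x)"
  using smooth_on_mult[OF _ smooth_on_inverse, of k h] by (simp add: divide_inverse)

lemma smooth_on_exp: "smooth_on S h \<Longrightarrow> smooth_on S (\<lambda>x. exp (h x))"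
  by (rule smooth_on_compose_pow[where c = 1 and m = 1]) (auto intro!: derivative_eq_intros)

text \<open>The logarithm does not have the preceding self-reproducing form, but its partial
  derivatives are \<open>inverse (h x)\<close> times those of \<open>h\<close>, which are already
  known to be smooth.\<close>

lemma smooth_on_ln:
  assumes "smooth_on S h" "\<And>x. x \<in> S \<Longrightarrow> h x > 0"
  shows "smooth_on S (\<lambda>x. ln (h x))"
proof -
  have d: "(ln has_real_derivative inverse (h x)) (at (h x))" if "x \<in> S" for x
    using DERIV_ln[OF assms(2)[OF that]] by simp
  have D: "(\<lambda>x. ln (h x)) differentiable at x" if "x \<in> S" for x
    using smooth_on_differentiable[OF assms(1) S that] d[OF that] by (rule partial_DERIV_compose(2))
  have P: "smooth_on S (partial i (\<lambda>x. ln (h x)))" for i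
  proof (rule smooth_on_cong[OF S])
    show "smooth_on S (\<lambda>x. inverse (h x) * partial i h x)"
      using assms by (intro smooth_on_mult smooth_on_inverse smooth_on_partial) force+
    show "inverse (h x) * partial i h x = partial i (\<lambda>x. ln (h x)) x" if "x \<in> S" for x
      using partial_DERIV_compose(1)[OF smooth_on_differentiable[OF assms(1) S that] d[OF that]] by simp
  qed
  have "Ck_on n S (\<lambda>x. ln (h x))" for n
  proof (cases n)
    case 0
    then show ?thesis using D by (simp add: continuous_at_imp_continuous_on differentiable_imp_continuous_within)
  next
    case (Suc m)
    then show ?thesis using D S P by (simp add: differentiable_on_eq_differentiable_at smooth_on_def)
  qed
  then show ?thesis by (simp add: smooth_on_def)
qed

end

section \<open>Symmetry of mixed second derivatives\<close>

lemma DERIV_along_axis: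
  assumes "h differentiable at (y + s *\<^sub>R axis i 1)"
  shows "((\<lambda>s. h (y + s *\<^sub>R axis i 1)) has_real_derivative partial i h (y + s *\<^sub>R axis i 1)) (at s)"
proof -
  have "((\<lambda>s. y + s *\<^sub>R axis i 1) has_derivative (\<lambda>t. t *\<^sub>R axis i 1)) (at s)"
    by (auto intro!: derivative_eq_intros)
  from has_derivative_compose[OF this assms[unfolded frechet_derivative_works]]
  have D: "((\<lambda>s. h (y + s *\<^sub>R axis i 1)) has_derivative
      (\<lambda>t. frechet_derivative h (at (y + s *\<^sub>R axis i 1)) (t *\<^sub>R axis i 1))) (at s)" .
  have "linear (frechet_derivative h (at (y + s *\<^sub>R axis i 1)))"
    using assms by (simp add: linear_frechet_derivative)
  with D show ?thesis
    by (simp add: has_field_derivative_def partial_def linear_scale mult_commute_abs)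
qed

text \<open>One application of the mean value theorem in direction \<open>i\<close> to the increment
  in direction \<open>j\<close>, and a second one in direction \<open>j\<close>. The difference
  itself is symmetric in \<open>i\<close> and \<open>j\<close>.\<close>

lemma second_difference:
  fixes h :: "real^'n::finite \<Rightarrow> real"
  assumes ball: "ball x r \<subseteq> S" "open S" and h: "smooth_on S h" and e: "0 < e" "2 * e < r"
  obtains z where "z \<in> cball x (2 * e)"
    "h (x + e *\<^sub>R axis i 1 + e *\<^sub>R axis j 1) - h (x + e *\<^sub>R axis i 1) - h (x + e *\<^sub>R axis j 1) + h x
       = e * e * partial j (partial i h) z"
proof -
  have n: "norm (s *\<^sub>R axis i (1::real) + t *\<^sub>R axis j 1) \<le> 2 * e"
    if "0 \<le> s" "s \<le> e" "0 \<le> t" "t \<le> e" for s t and i j :: 'n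
    using that norm_triangle_ineq[of "s *\<^sub>R axis i (1::real)" "t *\<^sub>R axis j 1"] by simp
  have cb: "x + s *\<^sub>R axis i 1 + t *\<^sub>R axis j 1 \<in> cball x (2 * e)"
    if "0 \<le> s" "s \<le> e" "0 \<le> t" "t \<le> e" for s t
  proof -
    have "x + s *\<^sub>R axis i 1 + t *\<^sub>R axis j 1 = x + (s *\<^sub>R axis i (1::real) + t *\<^sub>R axis j 1)"
      by (simp add: add.assoc)
    moreover have "dist x (x + w) = norm w" for w by (simp add: dist_norm)
    ultimately show ?thesis using n[OF that, of i j] by (simp only: mem_cball)
  qed
  have inS: "x + s *\<^sub>R axis i 1 + t *\<^sub>R axis j 1 \<in> S"
    if "0 \<le> s" "s \<le> e" "0 \<le> t" "t \<le> e" for s t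
    using cb[OF that] e ball(1) by force
  define \<phi> where "\<phi> s = h (x + e *\<^sub>R axis j 1 + s *\<^sub>R axis i 1) - h (x + s *\<^sub>R axis i 1)" for s
  define \<phi>' where "\<phi>' s = partial i h (x + e *\<^sub>R axis j 1 + s *\<^sub>R axis i 1) - partial i h (x + s *\<^sub>R axis i 1)" for s
  have "(\<phi> has_real_derivative \<phi>' s) (at s)" if "0 \<le> s" "s \<le> e" for s
    unfolding \<phi>_def \<phi>'_def
    using inS[of s e] inS[of s 0] that e
    by (intro DERIV_diff DERIV_along_axis smooth_on_differentiable[OF h ball(2)])
      (auto simp: algebra_simps)
  then obtain s where s: "0 < s" "s < e" "\<phi> e - \<phi> 0 = (e - 0) * \<phi>' s"
    using MVT2[of 0 e \<phi> \<phi>'] e by auto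
  have "((\<lambda>t. partial i h (x + s *\<^sub>R axis i 1 + t *\<^sub>R axis j 1)) has_real_derivative
     partial j (partial i h) (x + s *\<^sub>R axis i 1 + t *\<^sub>R axis j 1)) (at t)" if "0 \<le> t" "t \<le> e" for t
    using inS[of s t] s that
    by (intro DERIV_along_axis smooth_on_differentiable[OF smooth_on_partial[OF h] ball(2)]) auto
  then obtain t where t: "0 < t" "t < e"
    "partial i h (x + s *\<^sub>R axis i 1 + e *\<^sub>R axis j 1) - partial i h (x + s *\<^sub>R axis i 1 + 0 *\<^sub>R axis j 1)
      = (e - 0) * partial j (partial i h) (x + s *\<^sub>R axis i 1 + t *\<^sub>R axis j 1)"
    using MVT2[of 0 e "\<lambda>t. partial i h (x + s *\<^sub>R axis i 1 + t *\<^sub>R axis j 1)"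
      "\<lambda>t. partial j (partial i h) (x + s *\<^sub>R axis i 1 + t *\<^sub>R axis j 1)"] e by auto
  show thesis
  proof (rule that[of "x + s *\<^sub>R axis i 1 + t *\<^sub>R axis j 1"])
    show "x + s *\<^sub>R axis i 1 + t *\<^sub>R axis j 1 \<in> cball x (2 * e)" using cb s t by simp
    have "\<phi> e - \<phi> 0 = e * (e * partial j (partial i h) (x + s *\<^sub>R axis i 1 + t *\<^sub>R axis j 1))"
      using s(3) t(3) unfolding \<phi>'_def by (simp add: add_ac)
    then show "h (x + e *\<^sub>R axis i 1 + e *\<^sub>R axis j 1) - h (x + e *\<^sub>R axis i 1) - h (x + e *\<^sub>R axis j 1) + h x
       = e * e * partial j (partial i h) (x + s *\<^sub>R axis i 1 + t *\<^sub>R axis j 1)"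
      by (simp add: \<phi>_def add_ac)
  qed
qed

text \<open>Reading the symmetric second difference in both orders makes the two mixed derivatives
  agree at two points close to \<open>x\<close>; continuity carries the equality to
  \<open>x\<close>.\<close>

lemma partial_commute:
  fixes h :: "real^'n::finite \<Rightarrow> real"
  assumes S: "open S" "x \<in> S" and h: "smooth_on S h"
  shows "partial i (partial j h) x = partial j (partial i h) x"
proof (rule ccontr)
  define p where "p = partial i (partial j h)"
  define q where "q = partial j (partial i h)"
  assume ne: "\<not> ?thesis"
  define d where "d = \<bar>p x - q x\<bar>"
  have d: "d > 0" using ne by (simp add: d_def p_def q_def)
  obtain r where r: "r > 0" "ball x r \<subseteq> S" using S openE by blast
  have "continuous (at x) p" "continuous (at x) q"
    unfolding p_def q_def
    using S smooth_on_continuous[OF smooth_on_partial[OF smooth_on_partial[OF h]]]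
    by (auto simp: continuous_on_eq_continuous_at)
  then obtain a b where a: "a > 0" "\<And>y. dist y x < a \<Longrightarrow> dist (p y) (p x) < d / 2"
    and b: "b > 0" "\<And>y. dist y x < b \<Longrightarrow> dist (q y) (q x) < d / 2"
    unfolding continuous_at_eps_delta using d by (metis half_gt_zero)
  \<comment> \<open>A third of the minimum makes the radius 2e smaller than each of
    \<open>r\<close>, \<open>a\<close> and \<open>b\<close>.\<close>
  define e where "e = min r (min a b) / 3"
  have e: "0 < e" "2 * e < r" "2 * e < a" "2 * e < b"
    using r(1) a(1) b(1) by (auto simp: e_def)
  obtain z where z: "z \<in> cball x (2 * e)"
    "h (x + e *\<^sub>R axis i 1 + e *\<^sub>R axis j 1) - h (x + e *\<^sub>R axis i 1) - h (x + e *\<^sub>R axis j 1) + h x = e * e * q z"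
    using second_difference[OF r(2) S(1) h e(1,2), of i j] unfolding q_def by blast
  obtain w where w: "w \<in> cball x (2 * e)"
    "h (x + e *\<^sub>R axis j 1 + e *\<^sub>R axis i 1) - h (x + e *\<^sub>R axis j 1) - h (x + e *\<^sub>R axis i 1) + h x = e * e * p w"
    using second_difference[OF r(2) S(1) h e(1,2), of j i] unfolding p_def by blast
  have "e * e * q z = e * e * p w" using z(2) w(2) by (simp add: add_ac diff_diff_eq)
  then have "q z = p w" using e(1) by simp
  moreover have "dist (p w) (p x) < d / 2" "dist (q z) (q x) < d / 2"
    using a(2)[of w] b(2)[of z] w(1) z(1) e by (auto simp: dist_commute)
  moreover have "d \<le> \<bar>p w - p x\<bar> + \<bar>p w - q x\<bar>" unfolding d_def by arith
  ultimately show False unfolding dist_real_def by simp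
qed

section \<open>Linear total differential equations\<close>

lemma continuous_on_has_vector_derivative:
  assumes "\<And>t. t \<in> S \<Longrightarrow> (E has_vector_derivative E' t) (at t within S)"
  shows "continuous_on S E"
  unfolding continuous_on_eq_continuous_within
  using has_vector_derivative_continuous[OF assms] by blast

text \<open>At a point \<open>s\<close> where the norm of \<open>E\<close> is maximal, the mean
  value inequality on an interval of length at most one gives |E s| <= |E s| / 2 + \<delta>. This
  plays the part of Gronwall's inequality; \<delta> = 0 yields uniqueness.\<close>

lemma half_contraction_bound:
  fixes E :: "real \<Rightarrow> 'e::euclidean_space"
  assumes E0: "E 0 = 0"
    and der: "\<And>t. t \<in> {0..1} \<Longrightarrow> (E has_vector_derivative E' t) (at t within {0..1})"
    and bd: "\<And>t. t \<in> {0..1} \<Longrightarrow> norm (E' t) \<le> norm (E t) / 2 + \<delta>"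
    and t: "t \<in> {0..1}"
  shows "norm (E t) \<le> 2 * \<delta>"
proof -
  have "continuous_on {0..1} (\<lambda>t. norm (E t))"
    using der by (intro continuous_on_norm continuous_on_has_vector_derivative)
  then obtain s where s: "s \<in> {0..1}" "\<And>t. t \<in> {0..1} \<Longrightarrow> norm (E t) \<le> norm (E s)"
    using continuous_attains_sup[of "{0..1::real}" "\<lambda>t. norm (E t)"] by auto
  have "norm (E s - E 0) \<le> (norm (E s) / 2 + \<delta>) * norm (s - 0)"
  proof (rule differentiable_bound[where S = "{0..1}" and f' = "\<lambda>t h. h *\<^sub>R E' t"])
    show "(E has_derivative (\<lambda>h. h *\<^sub>R E' t)) (at t within {0..1})" if "t \<in> {0..1}" for t
      using der[OF that] by (simp add: has_vector_derivative_def)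
    show "onorm (\<lambda>h. h *\<^sub>R E' t) \<le> norm (E s) / 2 + \<delta>" if "t \<in> {0..1}" for t
    proof (rule onorm_le)
      have "norm (E' t) \<le> norm (E s) / 2 + \<delta>" using bd[OF that] s(2)[OF that] by linarith
      then show "norm (h *\<^sub>R E' t) \<le> (norm (E s) / 2 + \<delta>) * norm h" for h
        using mult_left_mono[of "norm (E' t)" "norm (E s) / 2 + \<delta>" "norm h"] by (simp add: mult.commute)
    qed
  qed (use s in auto)
  also have "\<dots> \<le> (norm (E s) / 2 + \<delta>) * 1"
    using order_trans[OF norm_ge_zero bd[OF s(1)]] s(1) by (intro mult_left_mono) auto
  finally show ?thesis using s(2)[OF t] E0 by simp
qed

lemma norm_blinfun_le:
  fixes A :: "'d::real_normed_vector \<Rightarrow>\<^sub>L 'e::real_normed_vector"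
  assumes "norm A \<le> a" "norm y \<le> b"
  shows "norm (blinfun_apply A y) \<le> a * b"
  by (rule order_trans[OF norm_blinfun mult_mono[OF assms order_trans[OF norm_ge_zero assms(1)] norm_ge_zero]])

lemma norm_scaleR_le: "t \<in> {0..1} \<Longrightarrow> norm y \<le> b \<Longrightarrow> norm (t *\<^sub>R y) \<le> b"
  using mult_left_le_one_le[of "norm y" t] by simp

text \<open>Picard iteration: the bound 1/2 on \<open>P\<close> and the unit length of the interval
  make the integral operator a contraction with factor 1/2 in the supremum norm.\<close>

lemma linear_ode_unit_interval:
  fixes P :: "real \<Rightarrow> ('e::euclidean_space \<Rightarrow>\<^sub>L 'e)"
  assumes cont: "continuous_on {0..1} P" and bd: "\<And>s. s \<in> {0..1} \<Longrightarrow> norm (P s) \<le> 1 / 2"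
  obtains z where "z 0 = y0"
    "\<And>t. t \<in> {0..1} \<Longrightarrow> (z has_vector_derivative blinfun_apply (P t) (z t)) (at t within {0..1})"
proof -
  \<comment> \<open>Clamping time to [0,1] lets the operator act on bounded continuous functions on
    the whole line, a complete space to which \<open>banach_fix_type\<close> applies.\<close>
  define cl where "cl t = min 1 (max 0 t)" for t :: real
  have cl: "cl t \<in> {0..1}" for t by (auto simp: cl_def)
  have ccl: "continuous_on UNIV cl" unfolding cl_def by (intro continuous_intros)
  have cP: "continuous_on {0..1} (\<lambda>s. blinfun_apply (P s) (apply_bcontfun z s))" for z :: "real \<Rightarrow>\<^sub>C 'e"
    using cont by (intro continuous_intros) auto
  define J where "J z t = y0 + integral {0..cl t} (\<lambda>s. blinfun_apply (P s) (apply_bcontfun z s))" for z t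
  have "range cl \<subseteq> {0..1}" using cl by blast
  then have cJ: "continuous_on UNIV (J z)" for z
    unfolding J_def
    by (intro continuous_intros
        continuous_on_compose2[OF indefinite_integral_continuous_1[OF integrable_continuous_real[OF cP]] ccl])
  have cP': "continuous_on {0..cl t} (\<lambda>s. blinfun_apply (P s) (apply_bcontfun z s))" for z t
    using continuous_on_subset[OF cP] cl[of t] by (auto simp: atLeastatMost_subset_iff)
  have Jb: "J z \<in> bcontfun" for z
  proof (rule bcontfun_normI[OF cJ])
    fix t
    have "norm (integral {0..cl t} (\<lambda>s. blinfun_apply (P s) (apply_bcontfun z s))) \<le> 1 / 2 * norm z * (cl t - 0)"
    proof (rule integral_bound[OF _ cP'])
      show "norm (blinfun_apply (P s) (apply_bcontfun z s)) \<le> 1 / 2 * norm z" if "s \<in> {0..cl t}" for s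
        using that cl[of t] by (intro norm_blinfun_le bd norm_bounded) auto
    qed (use cl in auto)
    also have "\<dots> \<le> 1 / 2 * norm z * 1" using cl[of t] by (intro mult_left_mono) auto
    finally show "norm (J z t) \<le> norm y0 + norm z / 2"
      unfolding J_def by (intro norm_triangle_le) simp
  qed
  define T where "T z = Bcontfun (J z)" for z
  have T: "apply_bcontfun (T z) = J z" for z
    unfolding T_def using Jb by (simp add: Bcontfun_inverse)
  have "dist (T y) (T z) \<le> 1 / 2 * dist y z" for y z
  proof (rule dist_bound)
    fix t
    have "dist (apply_bcontfun (T y) t) (apply_bcontfun (T z) t)
      = norm (integral {0..cl t} (\<lambda>s. blinfun_apply (P s) (apply_bcontfun y s) - blinfun_apply (P s) (apply_bcontfun z s)))"
      by (simp add: T J_def dist_norm integral_diff[OF integrable_continuous_real[OF cP'] integrable_continuous_real[OF cP']])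
    also have "\<dots> \<le> 1 / 2 * dist y z * (cl t - 0)"
    proof (rule integral_bound[OF _ continuous_on_diff[OF cP' cP']])
      show "norm (blinfun_apply (P s) (apply_bcontfun y s) - blinfun_apply (P s) (apply_bcontfun z s)) \<le> 1 / 2 * dist y z"
        if "s \<in> {0..cl t}" for s
        unfolding blinfun.diff_right[symmetric]
        using that cl[of t] dist_bounded[of y s z] by (intro norm_blinfun_le bd) (auto simp: dist_norm)
    qed (use cl in auto)
    also have "\<dots> \<le> 1 / 2 * dist y z * 1" using cl[of t] by (intro mult_left_mono) auto
    finally show "dist (apply_bcontfun (T y) t) (apply_bcontfun (T z) t) \<le> 1 / 2 * dist y z" by simp
  qed
  then obtain z where z: "T z = z"
    using banach_fix_type[of "1/2" T] by auto
  have zJ: "apply_bcontfun z t = y0 + integral {0..t} (\<lambda>s. blinfun_apply (P s) (apply_bcontfun z s))" if "t \<in> {0..1}" for t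
  proof -
    have "cl t = t" using that by (simp add: cl_def)
    then show ?thesis using fun_cong[OF T[of z, unfolded z], of t] unfolding J_def by (simp only:)
  qed
  show thesis
  proof (rule that[of "apply_bcontfun z"])
    show "apply_bcontfun z 0 = y0" using zJ[of 0] by simp
    show "(apply_bcontfun z has_vector_derivative blinfun_apply (P t) (apply_bcontfun z t)) (at t within {0..1})"
      if t: "t \<in> {0..1}" for t
    proof (rule has_vector_derivative_transform[OF t, of _ "\<lambda>t. y0 + integral {0..t} (\<lambda>s. blinfun_apply (P s) (apply_bcontfun z s))"])
      show "((\<lambda>t. y0 + integral {0..t} (\<lambda>s. blinfun_apply (P s) (apply_bcontfun z s))) has_vector_derivative
        blinfun_apply (P t) (apply_bcontfun z t)) (at t within {0..1})"
        using has_vector_derivative_add[OF has_vector_derivative_const integral_has_vector_derivative[OF cP t]] by simp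
    qed (rule zJ)
  qed
qed

text \<open>
  Solve along rays from \<open>x0\<close>. To differentiate the result \<open>Y\<close> in the direction \<open>h\<close>, the solution
  along the ray to \<open>x0 + v + h\<close> is compared with \<open>Y + t \<Phi> h Y\<close> along the ray to \<open>x0 + v\<close>:
  flatness makes the latter an approximate solution with error of order \<open>h\<^sup>2\<close>.
\<close>

lemma frobenius_rays:
  fixes \<Phi> :: "'a::euclidean_space \<Rightarrow> 'a \<Rightarrow> ('e::euclidean_space \<Rightarrow>\<^sub>L 'e)"
    and D :: "'a \<Rightarrow> 'a \<Rightarrow> 'a \<Rightarrow> ('e \<Rightarrow>\<^sub>L 'e)"
  assumes r: "r > 0" and M: "M \<ge> 0" "M * r \<le> 1 / 2"
    and lin: "\<And>x. x \<in> cball x0 r \<Longrightarrow> linear (\<Phi> x)"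
    and Dlin: "\<And>x k. x \<in> cball x0 r \<Longrightarrow> linear (D x k)"
    and der: "\<And>x w. x \<in> cball x0 r \<Longrightarrow> ((\<lambda>x. \<Phi> x w) has_derivative (\<lambda>k. D x k w)) (at x)"
    and b1: "\<And>x w. x \<in> cball x0 r \<Longrightarrow> norm (\<Phi> x w) \<le> M * norm w"
    and b2: "\<And>x z w. x \<in> cball x0 r \<Longrightarrow> z \<in> cball x0 r \<Longrightarrow>
      norm (\<Phi> z w - \<Phi> x w) \<le> M * norm (z - x) * norm w"
    and b3: "\<And>x z w. x \<in> cball x0 r \<Longrightarrow> z \<in> cball x0 r \<Longrightarrow>
      norm (\<Phi> z w - \<Phi> x w - D x (z - x) w) \<le> M * (norm (z - x))\<^sup>2 * norm w"
    and b4: "\<And>x k w. x \<in> cball x0 r \<Longrightarrow> norm (D x k w) \<le> M * norm k * norm w"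
    and flat: "\<And>x v h. x \<in> cball x0 r \<Longrightarrow> D x v h + (\<Phi> x h o\<^sub>L \<Phi> x v) = D x h v + (\<Phi> x v o\<^sub>L \<Phi> x h)"
  obtains Y where "Y x0 = y0"
    "\<And>x. x \<in> ball x0 r \<Longrightarrow> (Y has_derivative (\<lambda>h. blinfun_apply (\<Phi> x h) (Y x))) (at x)"
proof -
  have pt: "x0 + t *\<^sub>R v \<in> cball x0 r" if "norm v \<le> r" "t \<in> {0..1}" for t v
  proof -
    have "\<bar>t\<bar> * norm v \<le> 1 * r" using that by (intro mult_mono) auto
    then show ?thesis by (simp add: dist_norm)
  qed
  have half: "norm (\<Phi> x v) \<le> 1 / 2" if "x \<in> cball x0 r" "norm v \<le> r" for x v
    using b1[OF that(1), of v] mult_left_mono[OF that(2) M(1)] M(2) by linarith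
  have half': "norm (blinfun_apply (\<Phi> x v) y) \<le> norm y / 2" if "x \<in> cball x0 r" "norm v \<le> r" for x v y
    using norm_blinfun_le[OF half[OF that] order_refl, of y] by simp
  have rayder: "((\<lambda>s. \<Phi> (x0 + s *\<^sub>R v) w) has_vector_derivative D (x0 + t *\<^sub>R v) v w) (at t within {0..1})"
    if "norm v \<le> r" "t \<in> {0..1}" for t v w
  proof -
    have "((\<lambda>s. x0 + s *\<^sub>R v) has_vector_derivative v) (at t within {0..1})"
      by (auto intro!: derivative_eq_intros)
    from vector_derivative_diff_chain_within[OF this has_derivative_at_withinI[OF der[OF pt[OF that]]]]
    show ?thesis by (simp add: o_def)
  qed
  have cP: "continuous_on {0..1} (\<lambda>s. \<Phi> (x0 + s *\<^sub>R v) v)" if "norm v \<le> r" for v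
    by (rule continuous_on_has_vector_derivative[OF rayder[OF that]])
  have "\<exists>z. z 0 = y0 \<and> (\<forall>t\<in>{0..1}. (z has_vector_derivative
      blinfun_apply (\<Phi> (x0 + t *\<^sub>R v) v) (z t)) (at t within {0..1}))" if v: "norm v \<le> r" for v
    by (rule linear_ode_unit_interval[OF cP[OF v] half[OF pt[OF v] v], of y0]) auto
  then have "\<forall>v. \<exists>z. norm v \<le> r \<longrightarrow> z 0 = y0 \<and> (\<forall>t\<in>{0..1}. (z has_vector_derivative
      blinfun_apply (\<Phi> (x0 + t *\<^sub>R v) v) (z t)) (at t within {0..1}))"
    by simp
  from choice[OF this] obtain z where z: "\<forall>v. norm v \<le> r \<longrightarrow> z v 0 = y0 \<and> (\<forall>t\<in>{0..1}. (z v has_vector_derivative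
      blinfun_apply (\<Phi> (x0 + t *\<^sub>R v) v) (z v t)) (at t within {0..1}))" ..
  have z0: "\<And>v. norm v \<le> r \<Longrightarrow> z v 0 = y0"
    and zd: "\<And>v t. norm v \<le> r \<Longrightarrow> t \<in> {0..1} \<Longrightarrow>
      (z v has_vector_derivative blinfun_apply (\<Phi> (x0 + t *\<^sub>R v) v) (z v t)) (at t within {0..1})"
    using z by simp_all
  define Y where "Y x = z (x - x0) 1" for x
  \<comment> \<open>The solution along the ray to x0 + t v is the one along the ray to x0 + v with
    time rescaled by \<open>t\<close>, so the single function \<open>Y\<close> restricts to the
    solution on every ray. The difference of the two solves the linear equation with initial value
    zero, hence the bound with \<delta> = 0.\<close>
  have Yray: "Y (x0 + t *\<^sub>R v) = z v t" if v: "norm v \<le> r" and t: "t \<in> {0..1}" for v t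
  proof -
    have tv: "norm (t *\<^sub>R v) \<le> r" using pt[OF v t] by (simp add: dist_norm)
    have "norm (z (t *\<^sub>R v) 1 - z v (t * 1)) \<le> 2 * 0"
    proof (rule half_contraction_bound[where E = "\<lambda>s. z (t *\<^sub>R v) s - z v (t * s)"
          and E' = "\<lambda>s. blinfun_apply (\<Phi> (x0 + s *\<^sub>R t *\<^sub>R v) (t *\<^sub>R v)) (z (t *\<^sub>R v) s - z v (t * s))"])
      fix s :: real assume s: "s \<in> {0..1}"
      have ts: "t * s' \<in> {0..1}" if "s' \<in> {0..1}" for s' using t that by (auto simp: mult_le_one)
      have sub: "(\<lambda>s. t * s) ` {0..1} \<subseteq> {0..1}" using ts by blast
      have "((\<lambda>s. t * s) has_vector_derivative t) (at s within {0..1})"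
        by (auto intro!: derivative_eq_intros simp: has_vector_derivative_def)
      from vector_derivative_diff_chain_within[OF this, of "z v",
          OF has_vector_derivative_within_subset[OF zd[OF v ts[OF s]] sub, unfolded has_vector_derivative_def]]
      have "((\<lambda>s. z v (t * s)) has_vector_derivative t *\<^sub>R blinfun_apply (\<Phi> (x0 + (t * s) *\<^sub>R v) v) (z v (t * s))) (at s within {0..1})"
        by (simp add: o_def)
      moreover have "\<Phi> (x0 + s *\<^sub>R t *\<^sub>R v) (t *\<^sub>R v) = t *\<^sub>R \<Phi> (x0 + (t * s) *\<^sub>R v) v"
        using linear_scale[OF lin[OF pt[OF v ts[OF s]]]] by (simp add: mult.commute)
      ultimately show "((\<lambda>s. z (t *\<^sub>R v) s - z v (t * s)) has_vector_derivative
        blinfun_apply (\<Phi> (x0 + s *\<^sub>R t *\<^sub>R v) (t *\<^sub>R v)) (z (t *\<^sub>R v) s - z v (t * s))) (at s within {0..1})"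
        using has_vector_derivative_diff[OF zd[OF tv s]]
        by (simp add: blinfun.diff_right blinfun.scaleR_left)
      show "norm (blinfun_apply (\<Phi> (x0 + s *\<^sub>R t *\<^sub>R v) (t *\<^sub>R v)) (z (t *\<^sub>R v) s - z v (t * s)))
        \<le> norm (z (t *\<^sub>R v) s - z v (t * s)) / 2 + 0"
        using half'[OF pt[OF tv s] tv] by simp
    qed (use z0 v tv in auto)
    then show ?thesis by (simp add: Y_def)
  qed
  have Yd: "((\<lambda>t. Y (x0 + t *\<^sub>R v)) has_vector_derivative
      blinfun_apply (\<Phi> (x0 + t *\<^sub>R v) v) (Y (x0 + t *\<^sub>R v))) (at t within {0..1})"
    if v: "norm v \<le> r" and t: "t \<in> {0..1}" for v t
    using has_vector_derivative_transform[OF t Yray[OF v] zd[OF v t]] Yray[OF v t] by simp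
  have Y0: "Y x0 = y0" using Yray[of 0 0] z0[of 0] r by simp
  \<comment> \<open>The constant comes from |Y - y0| <= |y0|: the derivative of \<open>Y\<close> is
    at most |Y - y0| / 2 + |y0| / 2, so \<open>half_contraction_bound\<close> applies with \<delta>
    = |y0| / 2.\<close>
  define B where "B = 2 * norm y0"
  have YB: "norm (Y (x0 + v)) \<le> B" if v: "norm v \<le> r" for v
  proof -
    have "norm (Y (x0 + 1 *\<^sub>R v) - y0) \<le> 2 * (norm y0 / 2)"
    proof (rule half_contraction_bound[where E = "\<lambda>t. Y (x0 + t *\<^sub>R v) - y0"
          and E' = "\<lambda>t. blinfun_apply (\<Phi> (x0 + t *\<^sub>R v) v) (Y (x0 + t *\<^sub>R v))"])
      fix t :: real assume t: "t \<in> {0..1}"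
      show "((\<lambda>t. Y (x0 + t *\<^sub>R v) - y0) has_vector_derivative
          blinfun_apply (\<Phi> (x0 + t *\<^sub>R v) v) (Y (x0 + t *\<^sub>R v))) (at t within {0..1})"
        using has_vector_derivative_diff[OF Yd[OF v t] has_vector_derivative_const[of y0]] by simp
      have "norm (Y (x0 + t *\<^sub>R v)) \<le> norm (Y (x0 + t *\<^sub>R v) - y0) + norm y0"
        using norm_triangle_sub[of "Y (x0 + t *\<^sub>R v)" y0] by linarith
      then show "norm (blinfun_apply (\<Phi> (x0 + t *\<^sub>R v) v) (Y (x0 + t *\<^sub>R v)))
        \<le> norm (Y (x0 + t *\<^sub>R v) - y0) / 2 + norm y0 / 2"
        using half'[OF pt[OF v t] v, of "Y (x0 + t *\<^sub>R v)"] by linarith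
    qed (use Y0 in auto)
    then show ?thesis using norm_triangle_sub[of "Y (x0 + v)" y0] unfolding B_def by simp
  qed
  have B: "B \<ge> 0" unfolding B_def by simp
  \<comment> \<open>The summands are the bounds for the errors \<open>e1\<close> to
    \<open>e4\<close> below, in this order; the factor 2 comes from
    \<open>half_contraction_bound\<close>.\<close>
  define K where "K = 2 * (M * r * B + M * B + M * r * (M * B) + M * (M * B))"
  have key: "norm (Y (x0 + (v + h)) - Y (x0 + v) - blinfun_apply (\<Phi> (x0 + v) h) (Y (x0 + v))) \<le> K * (norm h)\<^sup>2"
    if v: "norm v \<le> r" and vh: "norm (v + h) \<le> r" for v h
  proof -
    define y where "y t = Y (x0 + t *\<^sub>R v)" for t
    define c where "c t = x0 + t *\<^sub>R v" for t
    define W where "W t = y t + t *\<^sub>R blinfun_apply (\<Phi> (c t) h) (y t)" for t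
    define d where "d t = x0 + t *\<^sub>R (v + h)" for t
    define W' where "W' t = blinfun_apply (\<Phi> (c t) v) (y t) + (blinfun_apply (\<Phi> (c t) h) (y t)
      + t *\<^sub>R (blinfun_apply (\<Phi> (c t) h) (blinfun_apply (\<Phi> (c t) v) (y t)) + blinfun_apply (D (c t) v h) (y t)))" for t
    have cC: "c t \<in> cball x0 r" and dC: "d t \<in> cball x0 r" if "t \<in> {0..1}" for t
      unfolding c_def d_def using pt v vh that by auto
    have yB: "norm (y t) \<le> B" if "t \<in> {0..1}" for t
      unfolding y_def using YB pt[OF v that] by (simp add: dist_norm)
    have W: "(W has_vector_derivative W' t) (at t within {0..1})" if t: "t \<in> {0..1}" for t
    proof -
      have 1: "(y has_vector_derivative blinfun_apply (\<Phi> (c t) v) (y t)) (at t within {0..1})"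
        using Yd[OF v t] unfolding y_def c_def .
      have 2: "((\<lambda>t. \<Phi> (c t) h) has_vector_derivative D (c t) v h) (at t within {0..1})"
        using rayder[OF v t] unfolding c_def .
      have 3: "((\<lambda>t. blinfun_apply (\<Phi> (c t) h) (y t)) has_vector_derivative
        (blinfun_apply (\<Phi> (c t) h) (blinfun_apply (\<Phi> (c t) v) (y t)) + blinfun_apply (D (c t) v h) (y t))) (at t within {0..1})"
        using bounded_bilinear.has_vector_derivative[OF bounded_bilinear_blinfun_apply 2 1] .
      have 4: "((\<lambda>t. t *\<^sub>R blinfun_apply (\<Phi> (c t) h) (y t)) has_vector_derivative
         (t *\<^sub>R (blinfun_apply (\<Phi> (c t) h) (blinfun_apply (\<Phi> (c t) v) (y t)) + blinfun_apply (D (c t) v h) (y t))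
          + 1 *\<^sub>R blinfun_apply (\<Phi> (c t) h) (y t))) (at t within {0..1})"
        by (rule bounded_bilinear.has_vector_derivative[OF bounded_bilinear_scaleR _ 3])
          (simp add: has_vector_derivative_id)
      show ?thesis
        using has_vector_derivative_add[OF 1 4] unfolding W_def W'_def by (simp add: add_ac)
    qed
    have "norm (Y (d 1) - W 1) \<le> 2 * (K / 2 * (norm h)\<^sup>2)"
    proof (rule half_contraction_bound[where E = "\<lambda>t. Y (d t) - W t"
          and E' = "\<lambda>t. blinfun_apply (\<Phi> (d t) (v + h)) (Y (d t)) - W' t"])
      fix t :: real assume t: "t \<in> {0..1}"
      show "((\<lambda>t. Y (d t) - W t) has_vector_derivative
         blinfun_apply (\<Phi> (d t) (v + h)) (Y (d t)) - W' t) (at t within {0..1})"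
        using has_vector_derivative_diff[OF Yd[OF vh t] W[OF t]] unfolding d_def .
      interpret L: linear "\<Phi> (c t)" by (rule lin[OF cC[OF t]])
      interpret DL: linear "D (c t) k" for k by (rule Dlin[OF cC[OF t]])
      interpret Dl: bounded_linear "\<lambda>k. D (c t) k w" for w
        using der[OF cC[OF t]] by (rule has_derivative_bounded_linear)
      have dc: "d t - c t = t *\<^sub>R h" by (simp add: d_def c_def algebra_simps)
      have nt: "norm (t *\<^sub>R h) \<le> norm h" using t by (simp add: mult_left_le_one_le)
      define hy where "hy = blinfun_apply (\<Phi> (c t) h) (y t)"
      have nhy: "norm hy \<le> M * B * norm h"
      proof -
        have "norm hy \<le> (M * norm h) * B"
          unfolding hy_def by (intro norm_blinfun_le b1 cC yB t)
        then show ?thesis by (simp add: mult_ac)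
      qed
      \<comment> \<open>Together these measure how far \<open>W\<close> fails the equation along the
        perturbed ray. \<open>e1\<close> is the Taylor remainder of \<Phi>, \<open>e2\<close> the
        first-order term of \<Phi> evaluated on \<open>h\<close> again, \<open>e3\<close> the
        variation of \<Phi> acting on the correction \<open>hy\<close>, and \<open>e4\<close> the
        part of \<Phi> (v + h) hy quadratic in \<open>h\<close>. Each is of order |h|^2.\<close>
      define e1 where "e1 = blinfun_apply (\<Phi> (d t) (v + h) - \<Phi> (c t) (v + h) - D (c t) (d t - c t) (v + h)) (y t)"
      define e2 where "e2 = t *\<^sub>R blinfun_apply (D (c t) h h) (y t)"
      define e3 where "e3 = t *\<^sub>R blinfun_apply (\<Phi> (d t) (v + h) - \<Phi> (c t) (v + h)) hy"
      define e4 where "e4 = t *\<^sub>R blinfun_apply (\<Phi> (c t) h) hy"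
      \<comment> \<open>Here flatness enters: it trades the derivative of \<Phi> along the ray,
        produced by differentiating \<open>W\<close>, for the derivative in direction
        \<open>h\<close>, produced by expanding \<Phi> at the displaced point.\<close>
      have fl: "blinfun_apply (\<Phi> (c t) h) (blinfun_apply (\<Phi> (c t) v) (y t)) + blinfun_apply (D (c t) v h) (y t)
        = blinfun_apply (D (c t) h v) (y t) + blinfun_apply (\<Phi> (c t) v) hy"
        using arg_cong[OF flat[OF cC[OF t], of v h], of "\<lambda>f. blinfun_apply f (y t)"]
        by (simp add: hy_def blinfun.add_left add.commute)
      have W't: "W' t = blinfun_apply (\<Phi> (c t) v) (y t)
          + (hy + t *\<^sub>R (blinfun_apply (D (c t) h v) (y t) + blinfun_apply (\<Phi> (c t) v) hy))"
        unfolding W'_def fl by (simp only: hy_def)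
      have e1: "e1 = blinfun_apply (\<Phi> (d t) (v + h)) (y t) - blinfun_apply (\<Phi> (c t) v) (y t) - hy
          - t *\<^sub>R (blinfun_apply (D (c t) h v) (y t) + blinfun_apply (D (c t) h h) (y t))"
        unfolding e1_def hy_def dc
        by (simp only: Dl.scaleR L.add DL.add blinfun.diff_left blinfun.add_left blinfun.scaleR_left
              diff_diff_eq scaleR_add_right)
      have e3: "e3 = t *\<^sub>R (blinfun_apply (\<Phi> (d t) (v + h)) hy - blinfun_apply (\<Phi> (c t) v) hy
          - blinfun_apply (\<Phi> (c t) h) hy)"
        unfolding e3_def by (simp only: L.add blinfun.diff_left blinfun.add_left diff_diff_eq)
      have Wt: "blinfun_apply (\<Phi> (d t) (v + h)) (W t) = blinfun_apply (\<Phi> (d t) (v + h)) (y t)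
          + t *\<^sub>R blinfun_apply (\<Phi> (d t) (v + h)) hy"
        unfolding W_def hy_def by (simp only: blinfun.add_right blinfun.scaleR_right)
      have esum: "blinfun_apply (\<Phi> (d t) (v + h)) (W t) - W' t = e1 + e2 + e3 + e4"
        unfolding W't e1 e2_def e3 e4_def Wt by (simp only: algebra_simps)
      have "norm e1 \<le> (M * r * B) * (norm h)\<^sup>2"
      proof -
        have le: "M * (norm (d t - c t))\<^sup>2 * norm (v + h) \<le> M * (norm h)\<^sup>2 * r"
          unfolding dc using nt vh M(1) by (intro mult_mono mult_left_mono power_mono) auto
        have "norm e1 \<le> (M * (norm h)\<^sup>2 * r) * B"
          unfolding e1_def by (rule norm_blinfun_le[OF order_trans[OF b3[OF cC[OF t] dC[OF t]] le] yB[OF t]])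
        then show ?thesis by (simp add: mult_ac)
      qed
      moreover have "norm e2 \<le> (M * B) * (norm h)\<^sup>2"
      proof -
        have "norm e2 \<le> (M * norm h * norm h) * B"
          unfolding e2_def by (intro norm_scaleR_le[OF t] norm_blinfun_le b4 cC yB t)
        then show ?thesis by (simp add: mult_ac power2_eq_square)
      qed
      moreover have "norm e3 \<le> (M * r * (M * B)) * (norm h)\<^sup>2"
      proof -
        have le: "M * norm (d t - c t) * norm (v + h) \<le> M * norm h * r"
          unfolding dc using nt vh M(1) by (intro mult_mono mult_left_mono) auto
        have "norm e3 \<le> (M * norm h * r) * (M * B * norm h)"
          unfolding e3_def
          by (rule norm_scaleR_le[OF t norm_blinfun_le[OF order_trans[OF b2[OF cC[OF t] dC[OF t]] le] nhy]])
        then show ?thesis by (simp add: mult_ac power2_eq_square)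
      qed
      moreover have "norm e4 \<le> (M * (M * B)) * (norm h)\<^sup>2"
      proof -
        have "norm e4 \<le> (M * norm h) * (M * B * norm h)"
          unfolding e4_def by (intro norm_scaleR_le[OF t] norm_blinfun_le b1 cC nhy t)
        then show ?thesis by (simp add: mult_ac power2_eq_square)
      qed
      moreover have "K / 2 * (norm h)\<^sup>2 = (M * r * B) * (norm h)\<^sup>2 + (M * B) * (norm h)\<^sup>2
          + (M * r * (M * B)) * (norm h)\<^sup>2 + (M * (M * B)) * (norm h)\<^sup>2"
        unfolding K_def by (simp add: distrib_right)
      ultimately have "norm (blinfun_apply (\<Phi> (d t) (v + h)) (W t) - W' t) \<le> K / 2 * (norm h)\<^sup>2"
        using norm_triangle_ineq[of "e1 + e2 + e3" e4] norm_triangle_ineq[of "e1 + e2" e3] norm_triangle_ineq[of e1 e2]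
        unfolding esum by linarith
      moreover have eq: "blinfun_apply (\<Phi> (d t) (v + h)) (Y (d t)) - W' t
        = blinfun_apply (\<Phi> (d t) (v + h)) (Y (d t) - W t) + (blinfun_apply (\<Phi> (d t) (v + h)) (W t) - W' t)"
        by (simp add: blinfun.diff_right)
      ultimately show "norm (blinfun_apply (\<Phi> (d t) (v + h)) (Y (d t)) - W' t)
          \<le> norm (Y (d t) - W t) / 2 + K / 2 * (norm h)\<^sup>2"
        using half'[OF dC[OF t] vh, of "Y (d t) - W t"]
          norm_triangle_ineq[of "blinfun_apply (\<Phi> (d t) (v + h)) (Y (d t) - W t)"
            "blinfun_apply (\<Phi> (d t) (v + h)) (W t) - W' t"] unfolding eq by linarith
    qed (simp_all add: d_def W_def y_def)
    then show ?thesis by (simp add: d_def W_def y_def c_def diff_diff_eq)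
  qed
  show thesis
  proof (rule that[of Y], rule Y0)
    fix x assume x: "x \<in> ball x0 r"
    define \<delta> where "\<delta> = r - dist x0 x"
    have \<delta>: "\<delta> > 0" using x by (simp add: \<delta>_def)
    have xC: "x \<in> cball x0 r" using x by simp
    interpret L: linear "\<Phi> x" by (rule lin[OF xC])
    show "(Y has_derivative (\<lambda>h. blinfun_apply (\<Phi> x h) (Y x))) (at x)"
    \<comment> \<open>The estimate \<open>key\<close> is quadratic in the increment and \<delta>
      keeps the displaced point in the ball, so the difference quotient is squeezed by K |y -
      x|.\<close>
    proof (rule has_derivativeI_sandwich[OF \<delta>, where H = "\<lambda>y. K * norm (y - x)"])
      show "bounded_linear (\<lambda>h. blinfun_apply (\<Phi> x h) (Y x))"
        by (simp add: linear_conv_bounded_linear[symmetric] linear_iff L.add L.scale blinfun.add_left blinfun.scaleR_left)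
      show "((\<lambda>y. K * norm (y - x)) \<longlongrightarrow> 0) (at x)"
        by (auto intro!: tendsto_eq_intros)
      fix y assume y: "y \<noteq> x" "dist y x < \<delta>"
      have "norm (x - x0) \<le> r" using xC by (simp add: dist_norm norm_minus_commute)
      moreover have "norm (x - x0 + (y - x)) \<le> r"
        using y(2) dist_triangle[of x0 y x] unfolding \<delta>_def
        by (simp add: dist_commute) (simp add: dist_norm norm_minus_commute)
      ultimately have "norm (Y y - Y x - blinfun_apply (\<Phi> x (y - x)) (Y x)) \<le> K * (norm (y - x))\<^sup>2"
        using key[of "x - x0" "y - x"] by simp
      then show "norm (Y y - Y x - blinfun_apply (\<Phi> x (y - x)) (Y x)) / norm (y - x) \<le> K * norm (y - x)"
        using y(1) by (simp add: divide_le_eq power2_eq_square mult_ac)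
    qed
  qed
qed

section \<open>First- and second-order bounds for smooth functions on a closed ball\<close>

context
  fixes U :: "(real^'n::finite) set" and x0 :: "real^'n" and R :: real and h :: "real^'n \<Rightarrow> real"
  assumes U: "open U" "cball x0 R \<subseteq> U" and h: "smooth_on U h"
begin

lemma smooth_on_cball_bounded: "\<exists>B\<ge>0. \<forall>x\<in>cball x0 R. \<bar>h x\<bar> \<le> B"
proof -
  have "continuous_on (cball x0 R) h"
    using continuous_on_subset[OF smooth_on_continuous[OF h] U(2)] .
  then have "bounded (h ` cball x0 R)"
    by (intro compact_imp_bounded compact_continuous_image) auto
  then obtain B where "\<And>x. x \<in> cball x0 R \<Longrightarrow> norm (h x) \<le> B"
    unfolding bounded_iff by blast
  then show ?thesis by (intro exI[of _ "max B 0"]) (auto simp: le_max_iff_disj)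
qed

end

lemma abs_sum_component_le:
  fixes v :: "real^'n::finite"
  assumes "\<And>l. \<bar>q l\<bar> \<le> B l * t"
  shows "\<bar>\<Sum>l\<in>UNIV. v $ l * q l\<bar> \<le> (\<Sum>l\<in>UNIV. B l) * t * norm v"
proof -
  have "\<bar>v $ l * q l\<bar> \<le> B l * t * norm v" for l
  proof -
    have "\<bar>v $ l\<bar> * \<bar>q l\<bar> \<le> norm v * (B l * t)"
      by (intro mult_mono component_le_norm_cart assms) auto
    then show ?thesis by (simp only: abs_mult mult.commute[of _ "norm v"])
  qed
  then have "\<bar>\<Sum>l\<in>UNIV. v $ l * q l\<bar> \<le> (\<Sum>l\<in>UNIV. B l * t * norm v)"
    by (intro order_trans[OF sum_abs] sum_mono)
  then show ?thesis by (simp add: sum_distrib_right)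
qed

context
  fixes U :: "(real^'n::finite) set" and x0 :: "real^'n" and R :: real
  assumes U: "open U" "cball x0 R \<subseteq> U"
begin

lemma smooth_on_cball_Lipschitz:
  assumes h: "smooth_on U h"
  shows "\<exists>B\<ge>0. \<forall>x\<in>cball x0 R. (\<forall>v. \<bar>\<Sum>l\<in>UNIV. v $ l * partial l h x\<bar> \<le> B * norm v) \<and>
    (\<forall>z\<in>cball x0 R. \<bar>h z - h x\<bar> \<le> B * norm (z - x))"
proof -
  have "\<forall>l. \<exists>B\<ge>0. \<forall>x\<in>cball x0 R. \<bar>partial l h x\<bar> \<le> B"
    using smooth_on_cball_bounded[OF U smooth_on_partial[OF h]] by blast
  from choice[OF this] obtain B where B: "\<forall>l. B l \<ge> 0 \<and> (\<forall>x\<in>cball x0 R. \<bar>partial l h x\<bar> \<le> B l)" ..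
  have b: "\<bar>\<Sum>l\<in>UNIV. v $ l * partial l h x\<bar> \<le> (\<Sum>l\<in>UNIV. B l) * norm v" if "x \<in> cball x0 R" for x v
    using abs_sum_component_le[of "\<lambda>l. partial l h x" B 1 v] B that by simp
  moreover have "\<bar>h z - h x\<bar> \<le> (\<Sum>l\<in>UNIV. B l) * norm (z - x)" if "x \<in> cball x0 R" "z \<in> cball x0 R" for x z
    unfolding real_norm_def[symmetric]
  proof (rule differentiable_bound[where S = "cball x0 R" and f' = "\<lambda>x v. \<Sum>l\<in>UNIV. v $ l * partial l h x"])
    show "(h has_derivative (\<lambda>v. \<Sum>l\<in>UNIV. v $ l * partial l h x)) (at x within cball x0 R)" if "x \<in> cball x0 R" for x
      by (rule has_derivative_at_withinI[OF has_derivative_partial[OF smooth_on_differentiable[OF h U(1)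
              subsetD[OF U(2) that]]]])
    show "onorm (\<lambda>v. \<Sum>l\<in>UNIV. v $ l * partial l h x) \<le> (\<Sum>l\<in>UNIV. B l)" if "x \<in> cball x0 R" for x
      using b[OF that] by (intro onorm_le) simp
  qed (use that in auto)
  moreover have "(\<Sum>l\<in>UNIV. B l) \<ge> 0" using B by (simp add: sum_nonneg)
  ultimately show ?thesis by blast
qed

text \<open>The partial derivatives are Lipschitz, so the differential varies by at most b |z - x|
  on the segment from \<open>x\<close> to \<open>z\<close>. Comparing with the linearization at
  \<open>x\<close> then leaves the quadratic remainder that hypothesis \<open>b3\<close> of
  \<open>frobenius_rays\<close> demands.\<close>

lemma smooth_on_cball_Taylor:
  assumes h: "smooth_on U h"
  shows "\<exists>B\<ge>0. \<forall>x\<in>cball x0 R. \<forall>z\<in>cball x0 R.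
    \<bar>h z - h x - (\<Sum>l\<in>UNIV. (z - x) $ l * partial l h x)\<bar> \<le> B * (norm (z - x))\<^sup>2"
proof -
  have "\<forall>l. \<exists>B\<ge>0. \<forall>x\<in>cball x0 R. \<forall>z\<in>cball x0 R. \<bar>partial l h z - partial l h x\<bar> \<le> B * norm (z - x)"
  proof
    fix l
    show "\<exists>B\<ge>0. \<forall>x\<in>cball x0 R. \<forall>z\<in>cball x0 R. \<bar>partial l h z - partial l h x\<bar> \<le> B * norm (z - x)"
      using smooth_on_cball_Lipschitz[OF smooth_on_partial[OF h, of l]] by (elim exE conjE, intro exI conjI) auto
  qed
  from choice[OF this] obtain B
    where B: "\<forall>l. B l \<ge> 0 \<and> (\<forall>x\<in>cball x0 R. \<forall>z\<in>cball x0 R. \<bar>partial l h z - partial l h x\<bar> \<le> B l * norm (z - x))" ..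
  define b where "b = (\<Sum>l\<in>UNIV. B l)"
  have b0: "b \<ge> 0" unfolding b_def using B by (simp add: sum_nonneg)
  have "\<bar>h z - h x - (\<Sum>l\<in>UNIV. (z - x) $ l * partial l h x)\<bar> \<le> b * (norm (z - x))\<^sup>2"
    if xz: "x \<in> cball x0 R" "z \<in> cball x0 R" for x z
  proof -
    have seg: "closed_segment x z \<subseteq> cball x0 R"
      using xz by (intro closed_segment_subset) auto
    define F where "F y v = (\<Sum>l\<in>UNIV. v $ l * partial l h y)" for y v
    have F: "(h has_derivative F y) (at y within closed_segment x z)" if "y \<in> closed_segment x z" for y
      unfolding F_def
      by (rule has_derivative_at_withinI[OF has_derivative_partial[OF smooth_on_differentiable[OF h U(1)
              subsetD[OF U(2) subsetD[OF seg that]]]]])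
    have dF: "onorm (F y - F x) \<le> b * norm (z - x)" if y: "y \<in> closed_segment x z" for y
    proof (rule onorm_le)
      fix v :: "real^'n"
      have yR: "y \<in> cball x0 R" using y seg by blast
      have Bl: "\<bar>partial l h y - partial l h x\<bar> \<le> B l * norm (y - x)" for l
        using spec[OF B, of l] xz(1) yR by simp
      have "(F y - F x) v = (\<Sum>l\<in>UNIV. v $ l * (partial l h y - partial l h x))"
        by (simp add: F_def sum_subtractf right_diff_distrib)
      then have "norm ((F y - F x) v) \<le> b * norm (y - x) * norm v"
        unfolding b_def real_norm_def by (simp only: abs_sum_component_le[OF Bl])
      also have "\<dots> \<le> b * norm (z - x) * norm v"
        using segment_bound(1)[OF y] b0 by (intro mult_right_mono mult_left_mono) auto
      finally show "norm ((F y - F x) v) \<le> b * norm (z - x) * norm v" .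
    qed
    have seg': "x + t *\<^sub>R (z - x) \<in> closed_segment x z" if "t \<in> {0..1}" for t
      using that unfolding in_segment by (intro exI[of _ t]) (simp add: algebra_simps)
    have "norm (h z - h x - F x (z - x)) \<le> norm (z - x) * (b * norm (z - x))"
      by (rule differentiable_bound_linearization[OF seg' F dF]) simp_all
    then show ?thesis by (simp add: F_def power2_eq_square mult_ac)
  qed
  then show ?thesis using b0 by blast
qed

end

section \<open>Matrix-valued one-forms and the Frobenius theorem for linear systems\<close>

definition elementary_blinfun :: "'m::finite \<Rightarrow> 'm \<Rightarrow> ((real^'m) \<Rightarrow>\<^sub>L (real^'m))" where
  "elementary_blinfun a b = Blinfun (\<lambda>y. y $ b *\<^sub>R axis a 1)"

lemma elementary_blinfun_apply: "blinfun_apply (elementary_blinfun a b) y = y $ b *\<^sub>R axis a 1"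
  unfolding elementary_blinfun_def
  by (rule fun_cong[OF bounded_linear_Blinfun_apply])
    (rule bounded_linear_compose[OF bounded_linear_scaleR_left bounded_linear_vec_nth])

text \<open>The value on the vector \<open>w\<close> of a matrix-valued one-form with components
  \<open>q i a b\<close>, at one point. Writing it in the matrix units
  \<open>elementary_blinfun a b\<close> reduces linearity, differentiation and norm bounds to finite
  sums with scalar coefficients.\<close>

definition connection_form :: "('n::finite \<Rightarrow> 'm::finite \<Rightarrow> 'm \<Rightarrow> real) \<Rightarrow> real^'n \<Rightarrow> ((real^'m) \<Rightarrow>\<^sub>L (real^'m))" where
  "connection_form q w = (\<Sum>i\<in>UNIV. \<Sum>a\<in>UNIV. \<Sum>b\<in>UNIV. (w $ i * q i a b) *\<^sub>R elementary_blinfun a b)"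

lemma connection_form_apply:
  fixes q :: "'n::finite \<Rightarrow> 'm::finite \<Rightarrow> 'm \<Rightarrow> real"
  shows "blinfun_apply (connection_form q w) y $ a = (\<Sum>i\<in>UNIV. \<Sum>b\<in>UNIV. w $ i * q i a b * y $ b)"
proof -
  have c: "(\<Sum>b\<in>UNIV. if a = a' then F b else 0) = (if a = a' then \<Sum>b\<in>UNIV. F b else 0)"
    for a' and F :: "'m \<Rightarrow> real" by simp
  have "blinfun_apply (connection_form q w) y $ a
    = (\<Sum>i\<in>UNIV. \<Sum>a'\<in>UNIV. \<Sum>b\<in>UNIV. if a = a' then w $ i * q i a' b * y $ b else 0)"
    unfolding connection_form_def blinfun.sum_left blinfun.scaleR_left elementary_blinfun_apply sum_component
    by (intro sum.cong refl) (simp add: axis_def)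
  then show ?thesis unfolding c by simp
qed

text \<open>The common factor \<open>t\<close> lets one estimate serve all four bounds of the ray
  construction: it is taken to be 1, \<open>norm k\<close>, \<open>norm (z - x)\<close> and the
  square of the latter.\<close>

lemma norm_connection_form_le:
  assumes "\<And>i a b. \<bar>q i a b\<bar> \<le> B i a b * t" "\<And>i a b. B i a b \<ge> 0" "t \<ge> 0"
  shows "norm (connection_form q w) \<le> (\<Sum>i\<in>UNIV. \<Sum>a\<in>UNIV. \<Sum>b\<in>UNIV. B i a b * norm (elementary_blinfun a b)) * t * norm w"
proof -
  have "norm (connection_form q w) \<le> (\<Sum>i\<in>UNIV. \<Sum>a\<in>UNIV. \<Sum>b\<in>UNIV. (B i a b * norm (elementary_blinfun a b)) * t * norm w)"
    unfolding connection_form_def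
  proof (intro sum_norm_le)
    fix i a b
    have "\<bar>w $ i * q i a b\<bar> \<le> norm w * (B i a b * t)"
      unfolding abs_mult using assms by (intro mult_mono component_le_norm_cart) auto
    then have "\<bar>w $ i * q i a b\<bar> * norm (elementary_blinfun a b) \<le> norm w * (B i a b * t) * norm (elementary_blinfun a b)"
      by (intro mult_right_mono) auto
    then show "norm ((w $ i * q i a b) *\<^sub>R elementary_blinfun a b) \<le> B i a b * norm (elementary_blinfun a b) * t * norm w"
      by (simp add: mult_ac)
  qed
  then show ?thesis by (simp add: sum_distrib_right)
qed

lemma linear_connection_form: "linear (connection_form q)"
  unfolding connection_form_def
  by (auto simp: linear_iff sum.distrib scaleR_sum_right distrib_right scaleR_add_left mult.assoc)

lemma connection_form_diff: "connection_form q w - connection_form q' w = connection_form (\<lambda>i a b. q i a b - q' i a b) w"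
  unfolding connection_form_def by (simp add: sum_subtractf right_diff_distrib scaleR_diff_left)

lemma sum_rotate:
  "(\<Sum>c\<in>A. \<Sum>j\<in>J. \<Sum>b\<in>K. T c j b) = (\<Sum>j\<in>J. \<Sum>b\<in>K. \<Sum>c\<in>A. T c j b)"
  by (subst sum.swap) (intro sum.cong refl sum.swap)

text \<open>The hypothesis \<open>flat\<close> is what equality of mixed second derivatives forces
  on the coefficients: differentiate the right-hand side of the system and substitute the system
  again.\<close>

theorem linear_frobenius:
  fixes B :: "'n::finite \<Rightarrow> 'm::finite \<Rightarrow> 'm \<Rightarrow> real^'n \<Rightarrow> real"
  assumes U: "open U" "x0 \<in> U" and B: "\<And>i a b. smooth_on U (B i a b)"
    and flat: "\<And>i j a b x. x \<in> U \<Longrightarrow>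
      partial i (B j a b) x + (\<Sum>c\<in>UNIV. B j a c x * B i c b x)
      = partial j (B i a b) x + (\<Sum>c\<in>UNIV. B i a c x * B j c b x)"
  obtains r y where "r > 0" "ball x0 r \<subseteq> U" "\<And>a. smooth_on (ball x0 r) (y a)" "\<And>a. y a x0 = y0 a"
    "\<And>a i x. x \<in> ball x0 r \<Longrightarrow> partial i (y a) x = (\<Sum>b\<in>UNIV. B i a b x * y b x)"
proof -
  obtain R where R: "R > 0" "cball x0 R \<subseteq> U" using U open_contains_cball by blast
  define q where "q x i a b = B i a b x" for x i a b
  define dq where "dq x k i a b = (\<Sum>l\<in>UNIV. k $ l * partial l (B i a b) x)" for x k i a b
  \<comment> \<open>One constant for the size, the derivative, the Lipschitz and the Taylor estimate
    of each coefficient, so that a single sum \<open>N\<close> bounds the whole form in all four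
    senses.\<close>
  define P where "P i a b M \<longleftrightarrow> M \<ge> 0 \<and> (\<forall>x\<in>cball x0 R. \<bar>q x i a b\<bar> \<le> M
     \<and> (\<forall>k. \<bar>dq x k i a b\<bar> \<le> M * norm k)
     \<and> (\<forall>z\<in>cball x0 R. \<bar>q z i a b - q x i a b\<bar> \<le> M * norm (z - x)
        \<and> \<bar>q z i a b - q x i a b - dq x (z - x) i a b\<bar> \<le> M * (norm (z - x))\<^sup>2))" for i a b M
  have "\<forall>i a b. \<exists>M. P i a b M"
  proof (intro allI)
    fix i a b
    obtain B1 where B1: "B1 \<ge> 0" "\<forall>x\<in>cball x0 R. \<bar>q x i a b\<bar> \<le> B1"
      using smooth_on_cball_bounded[OF U(1) R(2) B] unfolding q_def by blast
    obtain B2 where B2: "B2 \<ge> 0" "\<forall>x\<in>cball x0 R. (\<forall>k. \<bar>dq x k i a b\<bar> \<le> B2 * norm k) \<and>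
        (\<forall>z\<in>cball x0 R. \<bar>q z i a b - q x i a b\<bar> \<le> B2 * norm (z - x))"
      using smooth_on_cball_Lipschitz[OF U(1) R(2) B] unfolding q_def dq_def by blast
    obtain B3 where B3: "B3 \<ge> 0" "\<forall>x\<in>cball x0 R. \<forall>z\<in>cball x0 R.
        \<bar>q z i a b - q x i a b - dq x (z - x) i a b\<bar> \<le> B3 * (norm (z - x))\<^sup>2"
      using smooth_on_cball_Taylor[OF U(1) R(2) B] unfolding q_def dq_def by blast
    have le: "s \<le> (B1 + B2 + B3) * t"
      if "s \<le> B1 * t \<or> s \<le> B2 * t \<or> s \<le> B3 * t" "t \<ge> 0" for s t :: real
      using that mult_nonneg_nonneg[OF B1(1) that(2)] mult_nonneg_nonneg[OF B2(1) that(2)]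
        mult_nonneg_nonneg[OF B3(1) that(2)] by (auto simp: distrib_right)
    have "P i a b (B1 + B2 + B3)"
      unfolding P_def using B1 B2 B3 le[of _ 1] by (auto intro!: le)
    then show "\<exists>M. P i a b M" ..
  qed
  then obtain M where M: "\<And>i a b. P i a b (M i a b)" by metis
  define N where "N = (\<Sum>i\<in>UNIV. \<Sum>a\<in>UNIV. \<Sum>b\<in>UNIV. M i a b * norm (elementary_blinfun a b))"
  have M0: "M i a b \<ge> 0" for i a b using M unfolding P_def by blast
  have N: "N \<ge> 0" unfolding N_def using M0 by (intro sum_nonneg mult_nonneg_nonneg) auto
  \<comment> \<open>Chosen to give N r <= 1/2, the smallness needed for the contraction; the 1 added
    to \<open>N\<close> keeps the denominator positive when all bounds are zero.\<close>
  define r where "r = min R (1 / (2 * (N + 1)))"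
  have r: "r > 0" "r \<le> R" unfolding r_def using R N by auto
  have "N * r \<le> N * (1 / (2 * (N + 1)))" unfolding r_def using N by (intro mult_left_mono) auto
  also have "\<dots> \<le> 1 / 2" using N by (simp add: field_simps)
  finally have Nr: "N * r \<le> 1 / 2" .
  have rR: "cball x0 r \<subseteq> cball x0 R" using r by auto
  obtain Y where Y0: "Y x0 = (\<chi> a. y0 a)" and
    Y: "\<And>x. x \<in> ball x0 r \<Longrightarrow> (Y has_derivative (\<lambda>h. blinfun_apply (connection_form (q x) h) (Y x))) (at x)"
  proof (rule frobenius_rays[of r N x0 "\<lambda>x. connection_form (q x)" "\<lambda>x k. connection_form (dq x k)"])
    fix x w assume x: "x \<in> cball x0 r"
    have xU: "x \<in> U" using x rR R by blast
    show "((\<lambda>x. connection_form (q x) w) has_derivative (\<lambda>k. connection_form (dq x k) w)) (at x)"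
      unfolding connection_form_def q_def dq_def
      by (intro has_derivative_sum has_derivative_scaleR_left has_derivative_mult_right has_derivative_partial
          smooth_on_differentiable[OF B U(1) xU])
    show "norm (connection_form (q x) w) \<le> N * norm w"
      using norm_connection_form_le[of "q x" M 1 w] M x rR M0 unfolding N_def P_def by fastforce
    show "norm (connection_form (dq x k) w) \<le> N * norm k * norm w" for k
      unfolding N_def using M x rR unfolding P_def by (intro norm_connection_form_le M0) auto
    fix z assume z: "z \<in> cball x0 r"
    show "norm (connection_form (q z) w - connection_form (q x) w) \<le> N * norm (z - x) * norm w"
      unfolding N_def connection_form_diff
      using M x z rR unfolding P_def by (intro norm_connection_form_le M0 norm_ge_zero) blast+
    show "norm (connection_form (q z) w - connection_form (q x) w - connection_form (dq x (z - x)) w) \<le> N * (norm (z - x))\<^sup>2 * norm w"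
      unfolding N_def connection_form_diff
      using M x z rR unfolding P_def by (intro norm_connection_form_le M0) (blast | simp)+
  next
    fix x v h assume x: "x \<in> cball x0 r"
    have xU: "x \<in> U" using x rR R by blast
    \<comment> \<open>The two sides of the operator identity are this expression for (v, h) and for
      (h, v). After exchanging the sums over \<open>i\<close> and \<open>j\<close> they match
      coefficient by coefficient through \<open>flat\<close>.\<close>
    have D: "(blinfun_apply (connection_form (dq x v) h + (connection_form (q x) h o\<^sub>L connection_form (q x) v)) y) $ a
      = (\<Sum>i\<in>UNIV. \<Sum>j\<in>UNIV. \<Sum>b\<in>UNIV. h $ i * v $ j * y $ b * (partial j (B i a b) x + (\<Sum>c\<in>UNIV. B i a c x * B j c b x)))"
      for v h y a
    proof -
      have "blinfun_apply (connection_form (dq x v) h) y $ a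
         = (\<Sum>i\<in>UNIV. \<Sum>j\<in>UNIV. \<Sum>b\<in>UNIV. h $ i * v $ j * y $ b * partial j (B i a b) x)"
        unfolding connection_form_apply dq_def sum_distrib_left sum_distrib_right
        by (intro sum.cong refl, subst sum.swap) (simp add: mult_ac)
      moreover have "blinfun_apply (connection_form (q x) h) (blinfun_apply (connection_form (q x) v) y) $ a
         = (\<Sum>i\<in>UNIV. \<Sum>j\<in>UNIV. \<Sum>b\<in>UNIV. h $ i * v $ j * y $ b * (\<Sum>c\<in>UNIV. B i a c x * B j c b x))"
        unfolding connection_form_apply q_def sum_distrib_left
        by (intro sum.cong refl, subst sum_rotate) (simp add: mult_ac)
      ultimately show ?thesis by (simp add: blinfun.add_left sum.distrib distrib_left)
    qed
    show "connection_form (dq x v) h + (connection_form (q x) h o\<^sub>L connection_form (q x) v)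
      = connection_form (dq x h) v + (connection_form (q x) v o\<^sub>L connection_form (q x) h)"
    proof (rule blinfun_eqI, subst vec_eq_iff, rule allI)
      fix y a
      show "(blinfun_apply (connection_form (dq x v) h + (connection_form (q x) h o\<^sub>L connection_form (q x) v)) y) $ a
        = (blinfun_apply (connection_form (dq x h) v + (connection_form (q x) v o\<^sub>L connection_form (q x) h)) y) $ a"
        unfolding D by (subst sum.swap) (simp add: flat[OF xU] mult_ac)
    qed
  qed (use r N Nr linear_connection_form in auto)
  have rU: "ball x0 r \<subseteq> U" using rR R(2) ball_subset_cball by blast
  have comp: "((\<lambda>x. Y x $ a) has_derivative (\<lambda>h. blinfun_apply (connection_form (q x) h) (Y x) $ a)) (at x)"
    if "x \<in> ball x0 r" for x a
    using bounded_linear.has_derivative[OF bounded_linear_vec_nth Y[OF that]] .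
  have p: "partial i (\<lambda>x. Y x $ a) x = (\<Sum>b\<in>UNIV. B i a b x * Y x $ b)" if "x \<in> ball x0 r" for x a i
  proof -
    have "(\<Sum>b\<in>UNIV. axis i 1 $ j * B j a b x * Y x $ b) = (if j = i then \<Sum>b\<in>UNIV. B i a b x * Y x $ b else 0)" for j
      by (simp add: axis_def)
    then show ?thesis unfolding partial_eqI[OF comp[OF that]] connection_form_apply q_def by simp
  qed
  show thesis
  proof (rule that[of r "\<lambda>a x. Y x $ a"])
    show "smooth_on (ball x0 r) (\<lambda>x. Y x $ a)" for a
      by (rule smooth_on_bootstrap[of _ UNIV "\<lambda>a x. Y x $ a" B])
        (use comp p B smooth_on_subset[OF _ rU] in \<open>auto simp: differentiable_def\<close>)
  qed (use r rU Y0 p in auto)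
qed

section \<open>Contractions in a three-dimensional inner product space\<close>

text \<open>The metric \<open>g\<close> and its inverse \<open>H\<close> at a single point, as plain
  numbers. A threefold contraction would expand to 3^6 terms, so identities are derived here by
  rules for nested traces and only then instantiated at the points of a chart.\<close>

locale inner_product_components =
  fixes g H :: "3 \<Rightarrow> 3 \<Rightarrow> real"
  assumes g_sym: "g i j = g j i" and H_sym: "H i j = H j i"
    and H_g: "(\<Sum>m\<in>UNIV. H i m * g m j) = (if i = j then 1 else 0)"
begin

definition tr :: "(3 \<Rightarrow> 3 \<Rightarrow> real) \<Rightarrow> real" where
  "tr T = (\<Sum>a\<in>UNIV. \<Sum>b\<in>UNIV. H a b * T a b)"

lemma tr_add: "tr (\<lambda>a b. T a b + T' a b) = tr T + tr T'"
  by (simp add: tr_def distrib_left sum.distrib)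

lemma tr_diff: "tr (\<lambda>a b. T a b - T' a b) = tr T - tr T'"
  by (simp add: tr_def right_diff_distrib sum_subtractf)

lemma tr_minus: "tr (\<lambda>a b. - T a b) = - tr T"
  by (simp add: tr_def sum_negf)

lemma tr_zero [simp]: "tr (\<lambda>a b. 0) = 0"
  by (simp add: tr_def)

lemma tr_scale: "tr (\<lambda>a b. c * T a b) = c * tr T"
  unfolding tr_def sum_distrib_left by (simp only: mult.left_commute)

lemma tr_scale_right: "tr (\<lambda>a b. T a b * c) = tr T * c"
  by (simp only: mult.commute[of _ c] tr_scale)

lemma tr_sum: "tr (\<lambda>a b. \<Sum>m\<in>I. T m a b) = (\<Sum>m\<in>I. tr (T m))"
proof -
  have "tr (\<lambda>a b. \<Sum>m\<in>I. T m a b) = (\<Sum>a\<in>UNIV. \<Sum>b\<in>UNIV. \<Sum>m\<in>I. H a b * T m a b)"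
    by (simp add: tr_def sum_distrib_left)
  also have "\<dots> = (\<Sum>m\<in>I. \<Sum>a\<in>UNIV. \<Sum>b\<in>UNIV. H a b * T m a b)"
    by (rule sum_rotate[symmetric])
  finally show ?thesis by (simp add: tr_def)
qed

lemma tr_flip: "tr (\<lambda>a b. T b a) = tr T"
  unfolding tr_def by (subst sum.swap) (simp add: H_sym)

text \<open>Contractions over independent index pairs commute. Reordering nested traces below rests
  on this rule and on \<open>tr_flip\<close>.\<close>

lemma tr_swap: "tr (\<lambda>a b. tr (\<lambda>c d. T a b c d)) = tr (\<lambda>c d. tr (\<lambda>a b. T a b c d))"
proof -
  have "tr (\<lambda>a b. tr (\<lambda>c d. T a b c d)) = (\<Sum>c\<in>UNIV. \<Sum>d\<in>UNIV. tr (\<lambda>a b. H c d * T a b c d))"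
    unfolding tr_def[of "\<lambda>c d. T _ _ c d"] by (simp add: tr_sum)
  also have "\<dots> = tr (\<lambda>c d. tr (\<lambda>a b. T a b c d))"
    unfolding tr_scale by (rule tr_def[symmetric])
  finally show ?thesis .
qed

lemma tr_g: "tr (\<lambda>a b. g b c * X a) = X c" "tr (\<lambda>a b. g c b * X a) = X c"
  "tr (\<lambda>a b. g a c * X b) = X c" "tr (\<lambda>a b. g c a * X b) = X c"
proof -
  have "tr (\<lambda>a b. g b c * X a) = (\<Sum>a\<in>UNIV. X a * (\<Sum>b\<in>UNIV. H a b * g b c))"
    by (simp add: tr_def sum_distrib_left mult_ac)
  also have "\<dots> = (\<Sum>a\<in>UNIV. if a = c then X a else 0)"
    unfolding H_g by (intro sum.cong) auto
  finally show 1: "tr (\<lambda>a b. g b c * X a) = X c" by simp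
  then show 2: "tr (\<lambda>a b. g c b * X a) = X c" by (simp add: g_sym[of c])
  show "tr (\<lambda>a b. g a c * X b) = X c" using tr_flip[of "\<lambda>a b. g b c * X a"] 1 by simp
  show "tr (\<lambda>a b. g c a * X b) = X c" using tr_flip[of "\<lambda>a b. g c b * X a"] 2 by simp
qed

lemma tr_g_self: "tr g = 3"
proof -
  have "tr g = (\<Sum>a\<in>UNIV. \<Sum>b\<in>UNIV. H a b * g b a)" by (simp add: tr_def g_sym)
  then show ?thesis unfolding H_g by simp
qed

end

section \<open>Algebraic curvature tensors in dimension three\<close>

locale curvature_components = inner_product_components +
  fixes Rm :: "3 \<Rightarrow> 3 \<Rightarrow> 3 \<Rightarrow> 3 \<Rightarrow> real"
  assumes Rm_anti: "Rm l k i j = - Rm k l i j" "Rm l k i j = - Rm l k j i"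
    and Rm_pair: "Rm l k i j = Rm i j l k"
begin

definition Ric where "Ric j k = tr (\<lambda>a b. Rm a k b j)"
definition Scal where "Scal = tr Ric"
text \<open>The coefficient 1/4 is 1/(2(n-1)) for n = 3; the prefactor 1/(n-2) of the Schouten
  tensor is 1 in this dimension.\<close>

definition Sch where "Sch i j = Ric i j - Scal / 4 * g i j"

lemma Ric_sym: "Ric j k = Ric k j"
proof -
  have "Ric j k = tr (\<lambda>a b. Rm b j a k)"
    unfolding Ric_def by (intro arg_cong[of _ _ tr] ext Rm_pair)
  then show ?thesis unfolding Ric_def using tr_flip[of "\<lambda>a b. Rm a j b k"] by (rule trans)
qed

lemma Sch_sym: "Sch i j = Sch j i"
  unfolding Sch_def by (simp only: Ric_sym[of i j] g_sym[of i j])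

text \<open>In dimension three, the Weyl tensor vanishes: six components of \<open>Rm\<close> are recovered from
  the six components of \<open>Ric\<close>.\<close>

lemma Rm_decomposition:
  "Rm l k i j = g l i * Sch k j + g k j * Sch l i - g l j * Sch k i - g k i * Sch l j"
proof -
  define a b c d e f where "a = g 1 1" and "b = g 2 2" and "c = g 3 3"
    and "d = g 1 2" and "e = g 1 3" and "f = g 2 3"
  have gs: "g 1 1 = a" "g 2 2 = b" "g 3 3 = c" "g 1 2 = d" "g 2 1 = d" "g 1 3 = e" "g 3 1 = e" "g 2 3 = f" "g 3 2 = f"
    using g_sym by (auto simp: a_def b_def c_def d_def e_def f_def)
  \<comment> \<open>\<open>D\<close> is the determinant of the metric. Identities are multiplied by
    it, so that the inverse metric is replaced by the cofactors in \<open>adj\<close> and polynomial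
    arithmetic suffices.\<close>
  define D where "D = a * (b * c - f * f) - d * (d * c - f * e) + e * (d * f - b * e)"
  have "(\<chi> i j. H i j) ** (\<chi> i j. g i j) = (mat 1 :: real^3^3)"
    by (simp add: vec_eq_iff matrix_matrix_mult_def H_g mat_def)
  then have "det (\<chi> i j. H i j) * det (\<chi> i j. g i j) = (1::real)"
    by (metis det_mul det_I)
  moreover have "det (\<chi> i j. g i j) = D"
    unfolding det_3 D_def by (simp add: gs algebra_simps)
  ultimately have D0: "D \<noteq> 0" by auto
  have eqs: "H i 1 * a + H i 2 * d + H i 3 * e = (if i = 1 then 1 else 0)"
    "H i 1 * d + H i 2 * b + H i 3 * f = (if i = 2 then 1 else 0)"
    "H i 1 * e + H i 2 * f + H i 3 * c = (if i = 3 then 1 else 0)" for i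
    using H_g[of i 1] H_g[of i 2] H_g[of i 3] by (simp_all only: sum_3 gs)
  have adj: "D * H 1 1 = b * c - f * f" "D * H 2 2 = a * c - e * e" "D * H 3 3 = a * b - d * d"
    "D * H 1 2 = e * f - d * c" "D * H 1 3 = d * f - b * e" "D * H 2 3 = d * e - a * f"
    using eqs[of 1] eqs[of 2] eqs[of 3] H_sym[of 2 1] H_sym[of 3 1] H_sym[of 3 2]
    unfolding D_def by (simp_all, algebra+)
  \<comment> \<open>The tensor is a symmetric form on the skew index pairs 12, 13, 23, hence has six
    independent components.\<close>
  define p q r s t u where "p = Rm 1 2 1 2" and "q = Rm 1 3 1 3" and "r = Rm 2 3 2 3"
    and "s = Rm 1 2 1 3" and "t = Rm 1 2 2 3" and "u = Rm 1 3 2 3"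
  have z: "Rm l l i j = 0" "Rm l k i i = 0" for l k i j
    using Rm_anti(1)[of l l i j] Rm_anti(2)[of l k i i] by simp_all
  have n: "Rm 2 1 i j = - Rm 1 2 i j" "Rm 3 1 i j = - Rm 1 3 i j" "Rm 3 2 i j = - Rm 2 3 i j"
    "Rm l k 2 1 = - Rm l k 1 2" "Rm l k 3 1 = - Rm l k 1 3" "Rm l k 3 2 = - Rm l k 2 3" for l k i j
    by (rule Rm_anti)+
  have m: "Rm 1 2 1 2 = p" "Rm 1 3 1 3 = q" "Rm 2 3 2 3 = r" "Rm 1 2 1 3 = s" "Rm 1 3 1 2 = s"
    "Rm 1 2 2 3 = t" "Rm 2 3 1 2 = t" "Rm 1 3 2 3 = u" "Rm 2 3 1 3 = u"
    using Rm_pair by (simp_all add: p_def q_def r_def s_def t_def u_def)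
  note Rn = z n m
  have hs: "H 2 1 = H 1 2" "H 3 1 = H 1 3" "H 3 2 = H 2 3" by (rule H_sym)+
  have Ric: "Ric 1 1 = H 2 2 * p + 2 * H 2 3 * s + H 3 3 * q"
    "Ric 2 2 = H 1 1 * p - 2 * H 1 3 * t + H 3 3 * r"
    "Ric 3 3 = H 1 1 * q + 2 * H 1 2 * u + H 2 2 * r"
    "Ric 1 2 = - H 1 2 * p - H 1 3 * s + H 2 3 * t + H 3 3 * u"
    "Ric 1 3 = - H 1 2 * s - H 1 3 * q - H 2 2 * t - H 2 3 * u"
    "Ric 2 3 = H 1 1 * s + H 1 2 * t - H 1 3 * u - H 2 3 * r"
    unfolding Ric_def tr_def sum_3 by (simp_all add: Rn hs algebra_simps)
  have DRic: "D * Ric 1 1 = (a * c - e * e) * p + 2 * (d * e - a * f) * s + (a * b - d * d) * q"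
    "D * Ric 2 2 = (b * c - f * f) * p - 2 * (d * f - b * e) * t + (a * b - d * d) * r"
    "D * Ric 3 3 = (b * c - f * f) * q + 2 * (e * f - d * c) * u + (a * c - e * e) * r"
    "D * Ric 1 2 = - (e * f - d * c) * p - (d * f - b * e) * s + (d * e - a * f) * t + (a * b - d * d) * u"
    "D * Ric 1 3 = - (e * f - d * c) * s - (d * f - b * e) * q - (a * c - e * e) * t - (d * e - a * f) * u"
    "D * Ric 2 3 = (b * c - f * f) * s + (e * f - d * c) * t - (d * f - b * e) * u - (d * e - a * f) * r"
    unfolding Ric adj[symmetric] by (simp_all add: algebra_simps)
  \<comment> \<open>Both \<open>H\<close> and \<open>Ric\<close> carry a denominator
    \<open>D\<close>, so the equation is multiplied by its square; the numerator is then divisible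
    by \<open>D\<close>.\<close>
  have DScal: "D * Scal = 2 * (c * p + b * q + a * r - 2 * f * s + 2 * e * t - 2 * d * u)"
  proof -
    have "D * (D * Scal) = (D * H 1 1) * (D * Ric 1 1) + (D * H 2 2) * (D * Ric 2 2) + (D * H 3 3) * (D * Ric 3 3)
      + 2 * (D * H 1 2) * (D * Ric 1 2) + 2 * (D * H 1 3) * (D * Ric 1 3) + 2 * (D * H 2 3) * (D * Ric 2 3)"
      unfolding Scal_def tr_def sum_3 hs Ric_sym[of 2 1] Ric_sym[of 3 1] Ric_sym[of 3 2]
      by (simp add: algebra_simps)
    also have "\<dots> = D * (2 * (c * p + b * q + a * r - 2 * f * s + 2 * e * t - 2 * d * u))"
      unfolding DRic adj unfolding D_def by algebra
    finally show ?thesis using D0 by simp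
  qed
  \<comment> \<open>The right-hand side has the same symmetries as \<open>Rm\<close>, so equality
    has to be checked only on the six independent components.\<close>
  define Q where "Q l k i j = g l i * Sch k j + g k j * Sch l i - g l j * Sch k i - g k i * Sch l j" for l k i j
  have DSch: "D * Sch i j = D * Ric i j - (D * Scal) / 4 * g i j" for i j
    by (simp add: Sch_def algebra_simps)
  have DQ: "D * Q l k i j = g l i * (D * Sch k j) + g k j * (D * Sch l i) - g l j * (D * Sch k i) - g k i * (D * Sch l j)" for l k i j
    by (simp add: Q_def algebra_simps)
  note full = DQ DSch gs Ric_sym[of 2 1] Ric_sym[of 3 1] Ric_sym[of 3 2] DRic DScal
  have "D * Q 1 2 1 2 = D * p" "D * Q 1 3 1 3 = D * q" "D * Q 2 3 2 3 = D * r"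
    "D * Q 1 2 1 3 = D * s" "D * Q 1 2 2 3 = D * t" "D * Q 1 3 2 3 = D * u"
    unfolding full unfolding D_def by (simp_all add: field_simps)
  then have Q1: "Q 1 2 1 2 = p" "Q 1 3 1 3 = q" "Q 2 3 2 3 = r" "Q 1 2 1 3 = s" "Q 1 2 2 3 = t" "Q 1 3 2 3 = u"
    using D0 by simp_all
  have Qsym: "Q l k i j = - Q k l i j" "Q l k i j = - Q l k j i" "Q l k i j = Q i j l k" for l k i j
    unfolding Q_def using g_sym Sch_sym by (simp_all add: algebra_simps)
  have Qz: "Q l l i j = 0" "Q l k i i = 0" for l k i j
    using Qsym(1)[of l l i j] Qsym(2)[of l k i i] by simp_all
  have Qn: "Q 2 1 i j = - Q 1 2 i j" "Q 3 1 i j = - Q 1 3 i j" "Q 3 2 i j = - Q 2 3 i j"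
    "Q l k 2 1 = - Q l k 1 2" "Q l k 3 1 = - Q l k 1 3" "Q l k 3 2 = - Q l k 2 3" for l k i j
    by (rule Qsym)+
  have Q2: "Q 1 3 1 2 = s" "Q 2 3 1 2 = t" "Q 2 3 1 3 = u"
    using Qsym(3) Q1 by simp_all
  have "\<forall>l k i j. Rm l k i j = Q l k i j"
    unfolding forall_3 by (simp add: Rn Qz Qn Q1 Q2)
  then show ?thesis unfolding Q_def by blast
qed

text \<open>Up to sign both contractions are the Ricci tensor, which in dimension three is Sch + (tr
  Sch) g.\<close>

lemma tr_Rm_inner: "tr (\<lambda>k l. Rm a k m l) = g a m * tr Sch + Sch a m"
  "tr (\<lambda>j m. Rm a j m l) = - (g a l * tr Sch) - Sch a l"
proof -
  have g': "tr (\<lambda>k l. g k l * c) = 3 * c" for c using tr_scale_right[of g c] tr_g_self by simp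
  have "tr (\<lambda>k l. Rm a k m l)
    = tr (\<lambda>k l. g a m * Sch k l + g k l * Sch a m - g a l * Sch k m - g k m * Sch a l)"
    by (intro arg_cong[of _ _ tr] ext Rm_decomposition)
  then show "tr (\<lambda>k l. Rm a k m l) = g a m * tr Sch + Sch a m"
    by (simp only: tr_add tr_diff tr_scale g' tr_g)
  have "tr (\<lambda>j m. Rm a j m l)
    = tr (\<lambda>j m. g a m * Sch j l + g j l * Sch a m - g a l * Sch j m - g j m * Sch a l)"
    by (intro arg_cong[of _ _ tr] ext Rm_decomposition)
  then show "tr (\<lambda>j m. Rm a j m l) = - (g a l * tr Sch) - Sch a l"
    by (simp only: tr_add tr_diff tr_scale g' tr_g)
qed

section \<open>Contractions with a tensor that has the symmetries of the Cotton tensor\<close>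

context
  fixes C :: "3 \<Rightarrow> 3 \<Rightarrow> 3 \<Rightarrow> real"
  assumes C_anti: "\<And>i j k. C i j k = - C j i k" and C_tr: "\<And>i. tr (\<lambda>j k. C i j k) = 0"
begin

lemma C_traces: "tr (\<lambda>k j. C i j k) = 0" "tr (\<lambda>j k. C j i k) = 0" "tr (\<lambda>k j. C j i k) = 0"
  "tr (\<lambda>i j. C i j k) = 0"
proof -
  show 1: "tr (\<lambda>k j. C i j k) = 0" using tr_flip[of "\<lambda>j k. C i j k"] C_tr by simp
  have e: "C j i k = - C i j k" for j k by (rule C_anti)
  show 2: "tr (\<lambda>j k. C j i k) = 0" unfolding e tr_minus C_tr by simp
  show "tr (\<lambda>k j. C j i k) = 0" unfolding e tr_minus 1 by simp
  have "tr (\<lambda>i j. C i j k) = tr (\<lambda>i j. C j i k)" using tr_flip[of "\<lambda>i j. C j i k"] .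
  also have "\<dots> = tr (\<lambda>i j. - C i j k)"
    by (rule arg_cong[of _ _ tr], intro ext) (rule C_anti)
  also have "\<dots> = - tr (\<lambda>i j. C i j k)" by (rule tr_minus)
  finally show "tr (\<lambda>i j. C i j k) = 0" by simp
qed

definition Sch_C where "Sch_C i = tr (\<lambda>j b. tr (\<lambda>k c. Sch b c * C i j k))"

text \<open>\<open>Ric\<close> and \<open>Sch\<close> differ by a multiple of the metric, which is
  annihilated by the trace-free \<open>C\<close>.\<close>

lemma Ric_C_eq_Sch_C: "tr (\<lambda>j b. tr (\<lambda>k c. Ric b c * C i j k)) = Sch_C i"
proof -
  have "Ric b c * C i j k = Sch b c * C i j k + Scal / 4 * (g b c * C i j k)" for b c j k
    by (simp add: Sch_def algebra_simps)
  then show ?thesis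
    by (simp only: tr_add tr_scale tr_g C_tr Sch_C_def tr_zero mult_zero_right add_0_right)
qed

text \<open>These are the curvature terms that arise when the two derivatives in the divergence of
  the Bach tensor are exchanged, one for each index of \<open>C\<close>. They contract to -X, X and
  X with X = \<open>Sch_C i\<close>.\<close>

lemma curvature_C_contraction:
  "tr (\<lambda>j m. tr (\<lambda>k l. tr (\<lambda>p a. Rm a k m l * C p i j) + tr (\<lambda>p a. Rm a i m l * C k p j)
     + tr (\<lambda>p a. Rm a j m l * C k i p))) = Sch_C i"
proof -
  have E1: "tr (\<lambda>j m. tr (\<lambda>k l. tr (\<lambda>p a. Rm a k m l * C p i j))) = - Sch_C i"
  proof -
    have "tr (\<lambda>j m. tr (\<lambda>k l. tr (\<lambda>p a. Rm a k m l * C p i j)))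
      = tr (\<lambda>j m. tr (\<lambda>p a. (g a m * tr Sch + Sch a m) * C p i j))"
      by (subst tr_swap) (simp add: tr_scale_right tr_Rm_inner)
    also have "\<dots> = tr Sch * tr (\<lambda>j m. C m i j) + tr (\<lambda>j m. tr (\<lambda>p a. Sch a m * C p i j))"
    proof -
      have "(g a m * tr Sch + Sch a m) * C p i j = tr Sch * (g a m * C p i j) + Sch a m * C p i j" for a m p j
        by (simp add: algebra_simps)
      then show ?thesis by (simp add: tr_add tr_scale tr_g)
    qed
    also have "tr (\<lambda>j m. tr (\<lambda>p a. Sch a m * C p i j)) = tr (\<lambda>p a. tr (\<lambda>j m. Sch a m * C p i j))"
      by (rule tr_swap)
    also have "\<dots> = - Sch_C i"
    proof -
      have "Sch a m * C p i j = - (Sch a m * C i p j)" for a m p j using C_anti[of p i j] by simp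
      then show ?thesis by (simp only: Sch_C_def tr_minus)
    qed
    finally show ?thesis by (simp add: C_traces)
  qed
  have E2: "tr (\<lambda>j m. tr (\<lambda>k l. tr (\<lambda>p a. Rm a i m l * C k p j))) = Sch_C i"
  proof -
    \<comment> \<open>In this term every contraction joins \<open>Rm\<close> to \<open>C\<close>, so
      no Ricci trace can be split off and the full decomposition of \<open>Rm\<close> is
      inserted.\<close>
    have "tr (\<lambda>p a. Rm a i m l * C k p j) = Sch i l * C k m j + g i l * tr (\<lambda>p a. Sch a m * C k p j)
       - Sch i m * C k l j - g i m * tr (\<lambda>p a. Sch a l * C k p j)" for m l k j
    proof -
      have "Rm a i m l * C k p j = Sch i l * (g a m * C k p j) + g i l * (Sch a m * C k p j)
         - Sch i m * (g a l * C k p j) - g i m * (Sch a l * C k p j)" for a p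
        by (subst Rm_decomposition) (simp only: algebra_simps)
      then show ?thesis by (simp add: tr_add tr_diff tr_scale tr_g)
    qed
    then have "tr (\<lambda>k l. tr (\<lambda>p a. Rm a i m l * C k p j)) = tr (\<lambda>k l. Sch i l * C k m j) + tr (\<lambda>p a. Sch a m * C i p j)
       - Sch i m * tr (\<lambda>k l. C k l j) - g i m * tr (\<lambda>k l. tr (\<lambda>p a. Sch a l * C k p j))" for m j
      by (simp add: tr_add tr_diff tr_scale tr_g)
    then have "tr (\<lambda>j m. tr (\<lambda>k l. tr (\<lambda>p a. Rm a i m l * C k p j)))
      = tr (\<lambda>j m. tr (\<lambda>k l. Sch i l * C k m j)) + tr (\<lambda>j m. tr (\<lambda>p a. Sch a m * C i p j))
       - tr (\<lambda>k l. tr (\<lambda>p a. Sch a l * C k p i))"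
      by (simp add: tr_add tr_diff tr_g C_traces)
    also have "tr (\<lambda>j m. tr (\<lambda>k l. Sch i l * C k m j)) = 0"
      by (subst tr_swap) (simp add: tr_scale C_traces)
    also have "tr (\<lambda>j m. tr (\<lambda>p a. Sch a m * C i p j)) = Sch_C i"
      unfolding Sch_C_def by (rule tr_swap)
    \<comment> \<open>A symmetric tensor contracted with the skew pair \<open>k\<close>,
      \<open>p\<close> equals its own negative.\<close>
    also have "tr (\<lambda>k l. tr (\<lambda>p a. Sch a l * C k p i)) = 0"
    proof -
      have "tr (\<lambda>k l. tr (\<lambda>p a. Sch a l * C k p i)) = tr (\<lambda>p a. tr (\<lambda>k l. Sch a l * C k p i))"
        by (rule tr_swap)
      also have "\<dots> = tr (\<lambda>p a. tr (\<lambda>k l. - (Sch l a * C p k i)))"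
      proof -
        have "Sch a l * C k p i = - (Sch l a * C p k i)" for a l k p
          using C_anti[of k p i] Sch_sym[of a l] by simp
        then show ?thesis by (intro arg_cong[of _ _ tr] ext)
      qed
      also have "\<dots> = - tr (\<lambda>p a. tr (\<lambda>k l. Sch l a * C p k i))"
        by (simp only: tr_minus)
      finally show ?thesis by simp
    qed
    finally show ?thesis by simp
  qed
  have E3: "tr (\<lambda>j m. tr (\<lambda>k l. tr (\<lambda>p a. Rm a j m l * C k i p))) = Sch_C i"
  proof -
    have "tr (\<lambda>j m. tr (\<lambda>k l. tr (\<lambda>p a. Rm a j m l * C k i p)))
      = tr (\<lambda>k l. tr (\<lambda>p a. (- (g a l * tr Sch) - Sch a l) * C k i p))"
      by (subst tr_swap, subst (2) tr_swap) (simp add: tr_scale_right tr_Rm_inner)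
    also have "\<dots> = - tr Sch * tr (\<lambda>k l. C k i l) - tr (\<lambda>k l. tr (\<lambda>p a. Sch a l * C k i p))"
    proof -
      have "(- (g a l * tr Sch) - Sch a l) * C k i p = - tr Sch * (g a l * C k i p) - Sch a l * C k i p" for a l k p
        by (simp add: algebra_simps)
      then show ?thesis by (simp add: tr_diff tr_minus tr_scale tr_g)
    qed
    also have "tr (\<lambda>k l. tr (\<lambda>p a. Sch a l * C k i p)) = - Sch_C i"
    proof -
      have "Sch a l * C k i p = - (Sch l a * C i k p)" for a l k p
        using C_anti[of k i p] Sch_sym[of a l] by simp
      then have "tr (\<lambda>k l. tr (\<lambda>p a. Sch a l * C k i p)) = tr (\<lambda>k l. tr (\<lambda>p a. - (Sch l a * C i k p)))"
        by (intro arg_cong[of _ _ tr] ext)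
      then show ?thesis by (simp only: Sch_C_def tr_minus)
    qed
    finally show ?thesis by (simp add: C_traces)
  qed
  show ?thesis by (simp add: tr_add E1 E2 E3)
qed

text \<open>Only one factor is expanded. The metric terms with coefficient \<open>z\<close> meet
  traces of \<open>C\<close> and vanish; the two Ricci terms are \<open>f\<close> paired with the
  expression in \<open>RC\<close>, the second one after a sign change by skewness.\<close>

lemma norm_C_eq_zero:
  assumes C: "\<And>i j k. C i j k = f i * Ric j k - f j * Ric i k + g j k * z i - g i k * z j"
    and RC: "\<And>i. tr (\<lambda>j b. tr (\<lambda>k c. Ric b c * C i j k)) = 0"
  shows "tr (\<lambda>i a. tr (\<lambda>j b. tr (\<lambda>k c. C i j k * C a b c))) = 0"
proof -
  have "C i j k * C a b c = f a * (Ric b c * C i j k) - f b * (Ric a c * C i j k)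
     + z a * (g b c * C i j k) - z b * (g a c * C i j k)" for i j k a b c
    unfolding C[of a b c] by (simp add: algebra_simps)
  then have "tr (\<lambda>i a. tr (\<lambda>j b. tr (\<lambda>k c. C i j k * C a b c)))
    = tr (\<lambda>i a. f a * tr (\<lambda>j b. tr (\<lambda>k c. Ric b c * C i j k)))
     - tr (\<lambda>i a. tr (\<lambda>j b. f b * tr (\<lambda>k c. Ric a c * C i j k)))
     + tr (\<lambda>i a. z a * tr (\<lambda>j b. C i j b)) - tr (\<lambda>i a. tr (\<lambda>j b. z b * C i j a))"
    by (simp add: tr_add tr_diff tr_scale tr_g)
  also have "tr (\<lambda>i a. tr (\<lambda>j b. f b * tr (\<lambda>k c. Ric a c * C i j k)))
     = tr (\<lambda>j b. tr (\<lambda>i a. f b * tr (\<lambda>k c. Ric a c * C i j k)))"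
    by (rule tr_swap)
  also have "\<dots> = tr (\<lambda>j b. f b * tr (\<lambda>i a. tr (\<lambda>k c. Ric a c * C i j k)))"
    by (simp add: tr_scale)
  also have "\<dots> = - tr (\<lambda>j b. f b * tr (\<lambda>i a. tr (\<lambda>k c. Ric a c * C j i k)))"
  proof -
    have "Ric a c * C i j k = - (Ric a c * C j i k)" for a c i j k using C_anti[of i j k] by simp
    then have "tr (\<lambda>i a. tr (\<lambda>k c. Ric a c * C i j k)) = tr (\<lambda>i a. tr (\<lambda>k c. - (Ric a c * C j i k)))" for j
      by (intro arg_cong[of _ _ tr] ext)
    then show ?thesis by (simp only: tr_minus mult_minus_right)
  qed
  also have "tr (\<lambda>i a. tr (\<lambda>j b. z b * C i j a)) = tr (\<lambda>j b. tr (\<lambda>i a. z b * C i j a))"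
    by (rule tr_swap)
  finally show ?thesis by (simp add: RC C_traces C_tr tr_scale)
qed

end

end

section \<open>Positive definiteness and the norm of a tensor of rank three\<close>

locale pos_inner_product_components = inner_product_components +
  assumes g_pos: "(\<exists>i. v i \<noteq> 0) \<Longrightarrow> (\<Sum>i\<in>UNIV. \<Sum>j\<in>UNIV. g i j * v i * v j) > 0"
begin

text \<open>Raising the index of \<open>T\<close> gives a vector whose \<open>g\<close>-norm squared
  is this trace, and which is nonzero because lowering it returns \<open>T\<close>.\<close>

lemma H_pos:
  assumes "\<exists>i. T i \<noteq> 0"
  shows "tr (\<lambda>a b. T a * T b) > 0"
proof -
  define v where "v i = (\<Sum>b\<in>UNIV. H i b * T b)" for i
  have gH: "(\<Sum>i\<in>UNIV. g i j * H i b) = (if j = b then 1 else 0)" for j b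
  proof -
    have "(\<Sum>i\<in>UNIV. g i j * H i b) = (\<Sum>i\<in>UNIV. H b i * g i j)"
      by (intro sum.cong refl) (metis H_sym mult.commute)
    then show ?thesis unfolding H_g by auto
  qed
  have gv: "(\<Sum>i\<in>UNIV. g i j * v i) = T j" for j
  proof -
    have "(\<Sum>i\<in>UNIV. g i j * v i) = (\<Sum>b\<in>UNIV. \<Sum>i\<in>UNIV. g i j * H i b * T b)"
      unfolding v_def sum_distrib_left by (subst sum.swap) (simp add: mult_ac)
    also have "\<dots> = (\<Sum>b\<in>UNIV. if j = b then T b else 0)"
      unfolding sum_distrib_right[symmetric] gH by (intro sum.cong refl) simp
    also have "\<dots> = T j" by simp
    finally show ?thesis .
  qed
  have ne: "\<exists>i. v i \<noteq> 0"
  proof (rule ccontr)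
    assume "\<nexists>i. v i \<noteq> 0"
    then have "T j = 0" for j using gv[of j] by simp
    with assms show False by blast
  qed
  have "(\<Sum>i\<in>UNIV. \<Sum>j\<in>UNIV. g i j * v i * v j) = (\<Sum>j\<in>UNIV. T j * v j)"
    by (subst sum.swap) (simp only: sum_distrib_right[symmetric] gv)
  also have "\<dots> = tr (\<lambda>a b. T a * T b)"
    by (simp add: v_def tr_def sum_distrib_left mult_ac)
  finally show ?thesis using g_pos[OF ne] by simp
qed

text \<open>The decomposition \<open>L D L\<^sup>T\<close> of the positive definite matrix \<open>H\<close>.\<close>

lemma H_diagonalization:
  obtains d V where "\<And>s :: 3. d s > 0" "\<And>a b. H a b = (\<Sum>s\<in>UNIV. d s * V s a * V s b)"
    "\<And>T :: 3 \<Rightarrow> real. (\<And>s :: 3. (\<Sum>a\<in>UNIV. V s a * T a) = 0) \<Longrightarrow> (\<And>a. T a = 0)"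
proof -
  define T3 :: "real \<Rightarrow> real \<Rightarrow> real \<Rightarrow> 3 \<Rightarrow> real" where
    "T3 x y z i = (if i = 1 then x else if i = 2 then y else z)" for x y z i
  have T3 [simp]: "T3 x y z 1 = x" "T3 x y z 2 = y" "T3 x y z 3 = z" for x y z
    by (simp_all add: T3_def)
  define a b c d e f where "a = H 1 1" and "b = H 2 2" and "c = H 3 3"
    and "d = H 1 2" and "e = H 1 3" and "f = H 2 3"
  have hs: "H 1 1 = a" "H 2 2 = b" "H 3 3 = c" "H 1 2 = d" "H 2 1 = d" "H 1 3 = e" "H 3 1 = e" "H 2 3 = f" "H 3 2 = f"
    by (simp_all only: a_def b_def c_def d_def e_def f_def H_sym[of 2 1] H_sym[of 3 1] H_sym[of 3 2])
  have q: "tr (\<lambda>i j. T3 x y z i * T3 x y z j)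
     = a * x * x + b * y * y + c * z * z + 2 * d * x * y + 2 * e * x * z + 2 * f * y * z" for x y z
    unfolding tr_def sum_3 hs by (simp add: algebra_simps)
  have pos: "a * x * x + b * y * y + c * z * z + 2 * d * x * y + 2 * e * x * z + 2 * f * y * z > 0"
    if "\<exists>i. T3 x y z i \<noteq> 0" for x y z
    unfolding q[symmetric] using that by (rule H_pos)
  have a: "a > 0" using pos[OF exI[of _ 1], of 1 0 0] by simp
  define ia where "ia = 1 / a"
  have ia: "a * ia = 1" using a by (simp add: ia_def)
  have iw: "a * (w * ia) = w" for w using ia by (simp add: mult.left_commute)
  define B where "B = b - d * d * ia"
  \<comment> \<open>The test vector (-d/a, 1, 0) minimizes the quadratic form among vectors with
    last coordinates 1 and 0, and the minimum is the second pivot \<open>B\<close>. The vector used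
    for \<open>E\<close> is likewise the minimizer with last coordinate 1.\<close>
  have "a * (- d * ia) * (- d * ia) + b * 1 * 1 + c * 0 * 0 + 2 * d * (- d * ia) * 1 + 2 * e * (- d * ia) * 0 + 2 * f * 1 * 0 = B"
    unfolding iw B_def by (simp add: algebra_simps)
  then have B: "B > 0" using pos[OF exI[of _ 2], of "- d * ia" 1 0] by simp
  define F where "F = f - d * e * ia"
  define m where "m = F / B"
  have m: "B * m = F" using B by (simp add: m_def)
  define E where "E = c - e * e * ia - F * m"
  have "a * (- (e - m * d) * ia) * (- (e - m * d) * ia) + b * (-m) * (-m) + c * 1 * 1 + 2 * d * (- (e - m * d) * ia) * (-m)
       + 2 * e * (- (e - m * d) * ia) * 1 + 2 * f * (-m) * 1 - E = (B * m - F) * m"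
    unfolding iw B_def F_def E_def by (simp add: algebra_simps)
  then have E: "E > 0" using pos[OF exI[of _ 3], of "- (e - m * d) * ia" "-m" 1] m by simp
  define V where "V s = (if s = 1 then T3 1 (d * ia) (e * ia) else if s = 2 then T3 0 1 m else T3 0 0 1)" for s :: 3
  have V: "V 1 = T3 1 (d * ia) (e * ia)" "V 2 = T3 0 1 m" "V 3 = T3 0 0 1" by (simp_all add: V_def)
  show thesis
  proof (rule that[of "T3 a B E" V])
    show "T3 a B E s > 0" for s using a B E by (simp add: T3_def)
    have eq': "d * (d * ia) + B = b" "d * (e * ia) + F = f" "e * (d * ia) + F = f" "e * (e * ia) + F * m + E = c"
      unfolding B_def F_def E_def by (simp_all add: algebra_simps)
    have "\<forall>i j. H i j = (\<Sum>s\<in>UNIV. T3 a B E s * V s i * V s j)"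
      unfolding forall_3 sum_3 V T3 hs
      by (simp add: iw m eq')
    then show "H i j = (\<Sum>s\<in>UNIV. T3 a B E s * V s i * V s j)" for i j by blast
    \<comment> \<open>The vectors \<open>V s\<close> form a unit triangular matrix, so back
      substitution starts from the last coordinate.\<close>
    show "T i = 0" if 0: "\<And>s. (\<Sum>a\<in>UNIV. V s a * T a) = 0" for T i
    proof -
      have "T 3 = 0" using 0[of 3] by (simp add: sum_3 V)
      moreover from this have "T 2 = 0" using 0[of 2] by (simp add: sum_3 V)
      ultimately have "T 1 = 0" "T 2 = 0" "T 3 = 0" using 0[of 1] by (simp_all add: sum_3 V)
      then show ?thesis using exhaust_3[of i] by auto
    qed
  qed
qed

text \<open>In the basis diagonalizing \<open>H\<close> the squared norm is a sum of squares of the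
  components \<open>Z s t u\<close> with positive weights. Once these vanish, the change of basis is
  undone one slot at a time, from \<open>Z\<close> through \<open>Y\<close> and \<open>X\<close> to
  \<open>C\<close>.\<close>

lemma tensor_norm_zero:
  assumes "tr (\<lambda>i a. tr (\<lambda>j b. tr (\<lambda>k c. C i j k * C a b c))) = 0"
  shows "C i j k = 0"
proof (rule H_diagonalization)
  fix d V assume d: "\<And>s :: 3. d s > 0" and H: "\<And>a b. H a b = (\<Sum>s\<in>UNIV. d s * V s a * V s b)"
    and V: "\<And>T :: 3 \<Rightarrow> real. (\<And>s :: 3. (\<Sum>a\<in>UNIV. V s a * T a) = 0) \<Longrightarrow> (\<And>a. T a = 0)"
  have trV: "tr (\<lambda>a b. X a * Y b) = (\<Sum>s\<in>UNIV. d s * ((\<Sum>a\<in>UNIV. V s a * X a) * (\<Sum>b\<in>UNIV. V s b * Y b)))" for X Y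
  proof -
    have "tr (\<lambda>a b. X a * Y b) = (\<Sum>a\<in>UNIV. \<Sum>b\<in>UNIV. \<Sum>s\<in>UNIV. d s * ((V s a * X a) * (V s b * Y b)))"
      unfolding tr_def H sum_distrib_right by (simp only: mult_ac)
    also have "\<dots> = (\<Sum>s\<in>UNIV. \<Sum>a\<in>UNIV. \<Sum>b\<in>UNIV. d s * ((V s a * X a) * (V s b * Y b)))"
      by (rule sum_rotate[symmetric])
    finally show ?thesis unfolding sum_product unfolding sum_distrib_left .
  qed
  define X where "X u i j = (\<Sum>k\<in>UNIV. V u k * C i j k)" for u i j
  define Y where "Y t u i = (\<Sum>j\<in>UNIV. V t j * X u i j)" for t u i
  define Z where "Z s t u = (\<Sum>i\<in>UNIV. V s i * Y t u i)" for s t u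
  have 1: "tr (\<lambda>k c. C i j k * C a b c) = (\<Sum>u\<in>UNIV. d u * (X u i j * X u a b))" for i j a b
    unfolding trV X_def ..
  have 2: "tr (\<lambda>j b. tr (\<lambda>k c. C i j k * C a b c)) = (\<Sum>u\<in>UNIV. d u * (\<Sum>t\<in>UNIV. d t * (Y t u i * Y t u a)))" for i a
    unfolding 1 tr_sum tr_scale unfolding trV Y_def ..
  have "tr (\<lambda>i a. tr (\<lambda>j b. tr (\<lambda>k c. C i j k * C a b c)))
    = (\<Sum>u\<in>UNIV. d u * (\<Sum>t\<in>UNIV. d t * (\<Sum>s\<in>UNIV. d s * (Z s t u * Z s t u))))"
    unfolding 2 tr_sum tr_scale unfolding trV Z_def ..
  with assms have 0: "(\<Sum>u\<in>UNIV. d u * (\<Sum>t\<in>UNIV. d t * (\<Sum>s\<in>UNIV. d s * (Z s t u * Z s t u)))) = 0" by (rule trans[OF sym, rotated])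
  have nn: "q \<ge> 0 \<Longrightarrow> d u * q \<ge> 0" for q u
    using d[of u] by simp
  have n1: "(\<Sum>s\<in>UNIV. d s * (Z s t u * Z s t u)) \<ge> 0" for t u by (intro sum_nonneg nn) simp
  have n2: "(\<Sum>t\<in>UNIV. d t * (\<Sum>s\<in>UNIV. d s * (Z s t u * Z s t u))) \<ge> 0" for u
    by (intro sum_nonneg nn n1)
  have z: "(\<Sum>u\<in>UNIV. d u * q u) = 0 \<Longrightarrow> (\<And>u. q u \<ge> 0) \<Longrightarrow> q u = 0" for q u
    using sum_nonneg_eq_0_iff[of UNIV "\<lambda>u. d u * q u"] nn d[of u] by (auto dest: spec[of _ u])
  have "(\<Sum>t\<in>UNIV. d t * (\<Sum>s\<in>UNIV. d s * (Z s t u * Z s t u))) = 0" for u by (rule z[OF 0 n2])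
  then have "(\<Sum>s\<in>UNIV. d s * (Z s t u * Z s t u)) = 0" for t u by (rule z[OF _ n1])
  then have "Z s t u * Z s t u = 0" for s t u by (rule z) simp
  then have "Z s t u = 0" for s t u by simp
  then have "Y t u i = 0" for t u i unfolding Z_def by (rule V)
  then have "X u i j = 0" for u i j unfolding Y_def by (rule V)
  then show ?thesis unfolding X_def by (rule V)
qed

end

section \<open>Tensor calculus in a chart\<close>

context inner_product_components
begin

lemma g_H: "(\<Sum>m\<in>UNIV. g i m * H m j) = (if i = j then 1 else 0)"
proof -
  have "(\<Sum>m\<in>UNIV. g i m * H m j) = (\<Sum>m\<in>UNIV. H j m * g m i)"
    by (intro sum.cong refl) (metis H_sym g_sym mult.commute)
  then show ?thesis unfolding H_g by auto
qed

lemma sum_delta_mult: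
  "(\<Sum>j\<in>UNIV. (if i = j then 1 else 0) * X j) = (X i :: real)"
  "(\<Sum>j\<in>UNIV. X j * (if j = i then 1 else 0)) = (X i :: real)" for i :: 3
  by (simp_all add: if_distrib[of "\<lambda>u. u * _"] if_distrib[of "\<lambda>u. _ * u"] cong: if_cong)

lemma lower_raise: "(\<Sum>m\<in>UNIV. g i m * (\<Sum>l\<in>UNIV. H m l * B l)) = B i"
proof -
  have "(\<Sum>m\<in>UNIV. g i m * (\<Sum>l\<in>UNIV. H m l * B l)) = (\<Sum>l\<in>UNIV. (\<Sum>m\<in>UNIV. g i m * H m l) * B l)"
    unfolding sum_distrib_left sum_distrib_right by (subst sum.swap) (simp only: mult.assoc)
  then show ?thesis unfolding g_H sum_delta_mult .
qed

lemma raise_lower: "(\<Sum>m\<in>UNIV. H i m * (\<Sum>l\<in>UNIV. g m l * B l)) = B i"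
proof -
  have "(\<Sum>m\<in>UNIV. H i m * (\<Sum>l\<in>UNIV. g m l * B l)) = (\<Sum>l\<in>UNIV. (\<Sum>m\<in>UNIV. H i m * g m l) * B l)"
    unfolding sum_distrib_left sum_distrib_right by (subst sum.swap) (simp only: mult.assoc)
  then show ?thesis unfolding H_g sum_delta_mult .
qed

lemma lower_inject:
  assumes "\<And>j. (\<Sum>k\<in>UNIV. A k * g k j) = (\<Sum>k\<in>UNIV. B k * g k j)"
  shows "A i = B i"
proof -
  have e: "(\<Sum>l\<in>UNIV. g m l * X l) = (\<Sum>k\<in>UNIV. X k * g k m)" for X m
    by (intro sum.cong refl) (metis g_sym mult.commute)
  have "A i = (\<Sum>m\<in>UNIV. H i m * (\<Sum>l\<in>UNIV. g m l * A l))" by (rule raise_lower[symmetric])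
  also have "\<dots> = (\<Sum>m\<in>UNIV. H i m * (\<Sum>l\<in>UNIV. g m l * B l))"
    unfolding e assms ..
  finally show ?thesis unfolding raise_lower .
qed

lemma raise_inject:
  assumes "\<And>l. (\<Sum>m\<in>UNIV. g l m * A m) = (\<Sum>m\<in>UNIV. g l m * B m)"
  shows "A i = B i"
proof -
  have "A i = (\<Sum>m\<in>UNIV. H i m * (\<Sum>l\<in>UNIV. g m l * A l))" by (rule raise_lower[symmetric])
  then show ?thesis unfolding assms raise_lower .
qed

end

text \<open>Rank four is needed for the lowered curvature tensor in the second Bianchi identity, and
  for the covariant derivative of the Cotton tensor, which is differentiated once more in the
  divergence of the Bach tensor.\<close>

definition nabla4 ::
  "3 metric_components \<Rightarrow> (3 \<Rightarrow> 3 \<Rightarrow> 3 \<Rightarrow> 3 \<Rightarrow> real ^ 3 \<Rightarrow> real) \<Rightarrow>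
     3 \<Rightarrow> 3 \<Rightarrow> 3 \<Rightarrow> 3 \<Rightarrow> 3 \<Rightarrow> real ^ 3 \<Rightarrow> real" where
  "nabla4 G T i j k l n x =
     partial i (T j k l n) x
     - (\<Sum>m\<in>UNIV. christoffel G m i j x * T m k l n x)
     - (\<Sum>m\<in>UNIV. christoffel G m i k x * T j m l n x)
     - (\<Sum>m\<in>UNIV. christoffel G m i l x * T j k m n x)
     - (\<Sum>m\<in>UNIV. christoffel G m i n x * T j k l m x)"

section \<open>A metric in a chart and the smoothness of the quantities derived from it\<close>

locale metric_chart =
  fixes U :: "(real^3) set" and G :: "3 metric_components"
  assumes U: "open U" and G_smooth: "\<And>i j. smooth_on U (\<lambda>x. G x $ i $ j)"
    and G_sym: "\<And>x i j. x \<in> U \<Longrightarrow> G x $ i $ j = G x $ j $ i"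
    and G_pos: "\<And>x v. x \<in> U \<Longrightarrow> v \<noteq> 0 \<Longrightarrow> v \<bullet> (G x *v v) > 0"
begin

lemma G_invertible:
  assumes x: "x \<in> U"
  shows "G x ** matrix_inv (G x) = mat 1" "matrix_inv (G x) ** G x = mat 1" "det (G x) \<noteq> 0"
proof -
  have "v = 0" if "G x *v v = 0" for v
    using G_pos[OF x, of v] that by force
  then obtain B where "B ** G x = mat 1" using matrix_left_invertible_ker[of "G x"] by auto
  then have inv: "invertible (G x)" using invertible_left_inverse by blast
  then have "G x ** matrix_inv (G x) = mat 1 \<and> matrix_inv (G x) ** G x = mat 1"
    unfolding matrix_inv_def invertible_def by (rule someI_ex)
  then show "G x ** matrix_inv (G x) = mat 1" "matrix_inv (G x) ** G x = mat 1" by auto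
  show "det (G x) \<noteq> 0" using inv invertible_det_nz by blast
qed

lemma pos_inner_product:
  assumes x: "x \<in> U"
  shows "pos_inner_product_components (\<lambda>i j. G x $ i $ j) (\<lambda>i j. inverse_metric G i j x)"
proof
  show "G x $ i $ j = G x $ j $ i" for i j by (rule G_sym[OF x])
  then have t: "transpose (G x) = G x" by (simp add: vec_eq_iff transpose_def)
  define M where "M = matrix_inv (G x)"
  note GM = G_invertible(1,2)[OF x, folded M_def]
  have "transpose (G x ** M) = transpose (mat 1 :: real^3^3)" by (simp only: GM)
  then have tM: "transpose M ** G x = mat 1" by (simp only: matrix_transpose_mul t transpose_mat)
  have "transpose M = transpose M ** (G x ** M)" by (simp only: GM matrix_mul_rid)
  also have "\<dots> = (transpose M ** G x) ** M" by (rule matrix_mul_assoc)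
  also have "\<dots> = M" by (simp only: tM matrix_mul_lid)
  finally have "transpose M = M" .
  from arg_cong[OF this, of "\<lambda>A. A $ i $ j" for i j]
  have "M $ j $ i = M $ i $ j" for i j by (simp add: transpose_def)
  then show "inverse_metric G i j x = inverse_metric G j i x" for i j
    unfolding inverse_metric_def M_def .
  show "(\<Sum>m\<in>UNIV. inverse_metric G i m x * G x $ m $ j) = (if i = j then 1 else 0)" for i j
    using arg_cong[OF G_invertible(2)[OF x], of "\<lambda>A. A $ i $ j"]
    unfolding inverse_metric_def by (simp add: matrix_matrix_mult_def mat_def)
  fix v :: "3 \<Rightarrow> real" assume "\<exists>i. v i \<noteq> 0"
  then have "(\<chi> i. v i) \<noteq> 0" by (auto simp: vec_eq_iff)
  from G_pos[OF x this] show "0 < (\<Sum>i\<in>UNIV. \<Sum>j\<in>UNIV. G x $ i $ j * v i * v j)"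
    by (simp add: inner_vec_def matrix_vector_mult_def sum_3 algebra_simps)
qed

lemmas smooth_intros = smooth_on_add[OF U] smooth_on_diff[OF U] smooth_on_mult[OF U] smooth_on_minus[OF U]
  smooth_on_divide_const[OF U] smooth_on_partial smooth_on_const G_smooth

lemma smooth_sum: "(\<And>a. smooth_on U (h a)) \<Longrightarrow> smooth_on U (\<lambda>x. \<Sum>a\<in>UNIV. h (a :: 3) x)"
  by (rule smooth_on_sum[OF U]) auto

lemma smooth_det:
  assumes "\<And>i j. smooth_on U (\<lambda>x. A x i j)"
  shows "smooth_on U (\<lambda>x. det ((\<chi> i j. A x i j) :: real^3^3))"
  unfolding det_3 vec_lambda_beta by (intro smooth_intros assms)

text \<open>By Cramer's rule each entry of the inverse is a quotient of determinants that are
  polynomial in the metric coefficients, and the denominator has no zero on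
  \<open>U\<close>.\<close>

lemma smooth_inverse_metric: "smooth_on U (inverse_metric G i j)"
proof (rule smooth_on_cong[OF U])
  show "smooth_on U (\<lambda>x. det ((\<chi> a b. if b = i then axis j 1 $ a else G x $ a $ b) :: real^3^3)
     / det ((\<chi> a b. G x $ a $ b) :: real^3^3))"
  proof (rule smooth_on_divide[OF U smooth_det smooth_det])
    show "smooth_on U (\<lambda>x. if b = i then axis j 1 $ a else G x $ a $ b)" for a b
      by (cases "b = i") (simp_all add: G_smooth)
    show "det ((\<chi> a b. G x $ a $ b) :: real^3^3) \<noteq> 0" if "x \<in> U" for x
      using G_invertible(3)[OF that] by simp
  qed (rule G_smooth)
  fix x assume x: "x \<in> U"
  have "G x *v (matrix_inv (G x) *v axis j 1) = axis j 1"
    by (simp add: matrix_vector_mul_assoc G_invertible(1)[OF x])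
  then have "matrix_inv (G x) *v axis j 1 = (\<chi> k. det (\<chi> a b. if b = k then axis j 1 $ a else G x $ a $ b) / det (G x))"
    using cramer[OF G_invertible(3)[OF x]] by blast
  from arg_cong[OF this, of "\<lambda>v. v $ i"]
  have "matrix_inv (G x) $ i $ j = det (\<chi> a b. if b = i then axis j 1 $ a else G x $ a $ b) / det (G x)"
    by (simp add: matrix_vector_mult_basis column_def)
  then show "det (\<chi> a b. if b = i then axis j 1 $ a else G x $ a $ b) / det (\<chi> a b. G x $ a $ b) = inverse_metric G i j x"
    by (simp add: inverse_metric_def)
qed

lemma smooth_christoffel: "smooth_on U (christoffel G k i j)"
proof -
  \<comment> \<open>The point is written out because the defining equation unfolds only when applied
    to it; the smoothness lemmas that follow do the same.\<close>
  have "smooth_on U (\<lambda>x. christoffel G k i j x)"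
    unfolding christoffel_def by (intro smooth_intros smooth_sum smooth_inverse_metric)
  then show ?thesis by simp
qed

lemma smooth_riemann: "smooth_on U (riemann G l k i j)"
proof -
  have "smooth_on U (\<lambda>x. riemann G l k i j x)"
    unfolding riemann_def by (intro smooth_intros smooth_sum smooth_christoffel)
  then show ?thesis by simp
qed

lemma smooth_ricci: "smooth_on U (ricci G i j)"
proof -
  have "smooth_on U (\<lambda>x. ricci G i j x)"
    unfolding ricci_def by (intro smooth_intros smooth_sum smooth_riemann)
  then show ?thesis by simp
qed

lemma smooth_scalar_curvature: "smooth_on U (scalar_curvature G)"
proof -
  have "smooth_on U (\<lambda>x. scalar_curvature G x)"
    unfolding scalar_curvature_def by (intro smooth_intros smooth_sum smooth_inverse_metric smooth_ricci)
  then show ?thesis by simp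
qed

lemma smooth_nabla1: "(\<And>i. smooth_on U (T i)) \<Longrightarrow> smooth_on U (nabla1 G T i j)"
proof -
  assume T: "\<And>i. smooth_on U (T i)"
  have "smooth_on U (\<lambda>x. nabla1 G T i j x)"
    unfolding nabla1_def by (intro smooth_intros smooth_sum smooth_christoffel T)
  then show ?thesis by simp
qed

lemma smooth_nabla2: "(\<And>i j. smooth_on U (T i j)) \<Longrightarrow> smooth_on U (nabla2 G T i j k)"
proof -
  assume T: "\<And>i j. smooth_on U (T i j)"
  have "smooth_on U (\<lambda>x. nabla2 G T i j k x)"
    unfolding nabla2_def by (intro smooth_intros smooth_sum smooth_christoffel T)
  then show ?thesis by simp
qed

lemma smooth_nabla3: "(\<And>i j k. smooth_on U (T i j k)) \<Longrightarrow> smooth_on U (nabla3 G T i j k l)"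
proof -
  assume T: "\<And>i j k. smooth_on U (T i j k)"
  have "smooth_on U (\<lambda>x. nabla3 G T i j k l x)"
    unfolding nabla3_def by (intro smooth_intros smooth_sum smooth_christoffel T)
  then show ?thesis by simp
qed

lemmas smooth_rules = smooth_intros smooth_sum smooth_inverse_metric smooth_christoffel smooth_riemann
  smooth_ricci smooth_scalar_curvature

lemma smooth_diff_at: "smooth_on U h \<Longrightarrow> x \<in> U \<Longrightarrow> h differentiable at x"
  by (rule smooth_on_differentiable[OF _ U])

lemma pd_add: "x \<in> U \<Longrightarrow> smooth_on U h \<Longrightarrow> smooth_on U k \<Longrightarrow>
    partial i (\<lambda>y. h y + k y) x = partial i h x + partial i k x"
  by (intro partial_add smooth_diff_at)

lemma pd_diff: "x \<in> U \<Longrightarrow> smooth_on U h \<Longrightarrow> smooth_on U k \<Longrightarrow>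
    partial i (\<lambda>y. h y - k y) x = partial i h x - partial i k x"
  by (intro partial_diff smooth_diff_at)

lemma pd_mult: "x \<in> U \<Longrightarrow> smooth_on U h \<Longrightarrow> smooth_on U k \<Longrightarrow>
    partial i (\<lambda>y. h y * k y) x = partial i h x * k x + h x * partial i k x"
  by (intro partial_mult smooth_diff_at)

lemma pd_minus: "x \<in> U \<Longrightarrow> smooth_on U h \<Longrightarrow> partial i (\<lambda>y. - h y) x = - partial i h x"
  by (intro partial_minus smooth_diff_at)

lemma pd_divide: "x \<in> U \<Longrightarrow> smooth_on U h \<Longrightarrow> partial i (\<lambda>y. h y / c) x = partial i h x / c"
  using pd_mult[of x "\<lambda>y. inverse c" h i] by (simp add: field_simps)

lemma pd_sum: "x \<in> U \<Longrightarrow> (\<And>a. smooth_on U (h a)) \<Longrightarrow>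
    partial i (\<lambda>y. \<Sum>a\<in>UNIV. h (a :: 3) y) x = (\<Sum>a\<in>UNIV. partial i (h a) x)"
  by (intro partial_sum smooth_diff_at) auto

lemma pd_G_sym: "x \<in> U \<Longrightarrow> partial k (\<lambda>y. G y $ i $ j) x = partial k (\<lambda>y. G y $ j $ i) x"
  by (rule partial_cong[OF U]) (auto intro: G_sym)

section \<open>The Levi-Civita connection and metric compatibility\<close>

lemma christoffel_sym: "x \<in> U \<Longrightarrow> christoffel G k i j x = christoffel G k j i x"
  unfolding christoffel_def using pd_G_sym[of x _ i j] by (simp add: add.commute)

text \<open>Lowering the upper index undoes the inverse metric in the definition and leaves the
  Christoffel symbols of the first kind.\<close>

lemma christoffel_lower:
  assumes x: "x \<in> U"
  shows "(\<Sum>m\<in>UNIV. G x $ l $ m * christoffel G m i j x)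
    = (partial i (\<lambda>y. G y $ j $ l) x + partial j (\<lambda>y. G y $ i $ l) x - partial l (\<lambda>y. G y $ i $ j) x) / 2"
proof -
  interpret pos_inner_product_components "\<lambda>i j. G x $ i $ j" "\<lambda>i j. inverse_metric G i j x"
    by (rule pos_inner_product[OF x])
  have "(\<Sum>m\<in>UNIV. G x $ l $ m * christoffel G m i j x) = (\<Sum>m\<in>UNIV. G x $ l $ m *
     (\<Sum>n\<in>UNIV. inverse_metric G m n x * (partial i (\<lambda>y. G y $ j $ n) x + partial j (\<lambda>y. G y $ i $ n) x - partial n (\<lambda>y. G y $ i $ j) x))) / 2"
    unfolding christoffel_def times_divide_eq_right sum_divide_distrib[symmetric] ..
  then show ?thesis unfolding lower_raise .
qed

lemma metric_derivative:
  assumes x: "x \<in> U"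
  shows "partial k (\<lambda>y. G y $ i $ j) x
    = (\<Sum>m\<in>UNIV. christoffel G m k i x * G x $ m $ j) + (\<Sum>m\<in>UNIV. christoffel G m k j x * G x $ i $ m)"
proof -
  have "(\<Sum>m\<in>UNIV. christoffel G m k i x * G x $ m $ j) = (\<Sum>m\<in>UNIV. G x $ j $ m * christoffel G m k i x)"
    by (intro sum.cong refl) (metis G_sym[OF x] mult.commute)
  moreover have "(\<Sum>m\<in>UNIV. christoffel G m k j x * G x $ i $ m) = (\<Sum>m\<in>UNIV. G x $ i $ m * christoffel G m k j x)"
    by (simp add: mult.commute)
  ultimately show ?thesis
    unfolding christoffel_lower[OF x]
    using pd_G_sym[OF x, of k i j] pd_G_sym[OF x, of i k j] pd_G_sym[OF x, of j k i] by (simp add: field_simps)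
qed

text \<open>Differentiate H g = 1, rewrite the derivative of \<open>g\<close> by metric
  compatibility, and cancel the factor \<open>g\<close> by nondegeneracy
  (\<open>lower_inject\<close>).\<close>

lemma inverse_metric_derivative:
  assumes x: "x \<in> U"
  shows "partial p (inverse_metric G i l) x
    = - (\<Sum>m\<in>UNIV. christoffel G i p m x * inverse_metric G m l x) - (\<Sum>m\<in>UNIV. christoffel G l p m x * inverse_metric G i m x)"
proof -
  interpret pos_inner_product_components "\<lambda>i j. G x $ i $ j" "\<lambda>i j. inverse_metric G i j x"
    by (rule pos_inner_product[OF x])
  define g where "g i j = G x $ i $ j" for i j
  define h where "h i j = inverse_metric G i j x" for i j
  define c where "c k i j = christoffel G k i j x" for k i j
  have hg: "(\<Sum>m\<in>UNIV. h i m * g m j) = (if i = j then 1 else 0)" for i j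
    unfolding h_def g_def by (rule H_g)
  have "(\<Sum>k\<in>UNIV. partial p (inverse_metric G i k) x * g k j) = - (\<Sum>k\<in>UNIV. h i k * partial p (\<lambda>y. G y $ k $ j) x)" for j
  proof -
    have "partial p (\<lambda>y. \<Sum>k\<in>UNIV. inverse_metric G i k y * G y $ k $ j) x = partial p (\<lambda>y. if i = j then 1 else 0) x"
      by (rule partial_cong[OF U x]) (rule inner_product_components.H_g[OF pos_inner_product_components.axioms(1)[OF pos_inner_product]])
    also have "partial p (\<lambda>y. \<Sum>k\<in>UNIV. inverse_metric G i k y * G y $ k $ j) x
      = (\<Sum>k\<in>UNIV. partial p (inverse_metric G i k) x * g k j + h i k * partial p (\<lambda>y. G y $ k $ j) x)"
      unfolding g_def h_def
      by (simp only: pd_sum[OF x smooth_on_mult[OF U smooth_inverse_metric G_smooth]] pd_mult[OF x smooth_inverse_metric G_smooth])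
    finally show ?thesis by (simp add: sum.distrib)
  qed
  also have "(\<Sum>k\<in>UNIV. h i k * partial p (\<lambda>y. G y $ k $ j) x)
     = (\<Sum>m\<in>UNIV. (\<Sum>k\<in>UNIV. c m p k * h i k) * g m j) + (\<Sum>m\<in>UNIV. (\<Sum>k\<in>UNIV. h i k * g k m) * c m p j)" for j
    unfolding metric_derivative[OF x] g_def[symmetric] c_def[symmetric] sum_3 by (simp add: algebra_simps)
  also have "(\<Sum>m\<in>UNIV. (\<Sum>k\<in>UNIV. h i k * g k m) * c m p j) = (\<Sum>m\<in>UNIV. c i p m * (\<Sum>k\<in>UNIV. h m k * g k j))" for j
    unfolding hg sum_delta_mult ..
  finally have *: "(\<Sum>k\<in>UNIV. partial p (inverse_metric G i k) x * g k j)
     = - ((\<Sum>m\<in>UNIV. (\<Sum>k\<in>UNIV. c m p k * h i k) * g m j) + (\<Sum>m\<in>UNIV. c i p m * (\<Sum>k\<in>UNIV. h m k * g k j)))" for j .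
  have "partial p (inverse_metric G i l) x = (\<lambda>l. - (\<Sum>m\<in>UNIV. c i p m * h m l) - (\<Sum>m\<in>UNIV. c l p m * h i m)) l"
    by (rule lower_inject) (unfold g_def[symmetric] *, unfold sum_3, simp add: algebra_simps)
  then show ?thesis by (simp add: c_def h_def)
qed

section \<open>Traces and their covariant derivatives\<close>

abbreviation trc :: "real^3 \<Rightarrow> (3 \<Rightarrow> 3 \<Rightarrow> real) \<Rightarrow> real" where
  "trc x \<equiv> inner_product_components.tr (\<lambda>i j. inverse_metric G i j x)"

lemmas trc_def = inner_product_components.tr_def[OF pos_inner_product_components.axioms(1)[OF pos_inner_product]]


lemma smooth_trc: "(\<And>a b. smooth_on U (T a b)) \<Longrightarrow> smooth_on U (\<lambda>y. trc y (\<lambda>a b. T a b y))"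
proof -
  assume T: "\<And>a b. smooth_on U (T a b)"
  have "smooth_on U (\<lambda>y. \<Sum>a\<in>UNIV. \<Sum>b\<in>UNIV. inverse_metric G a b y * T a b y)"
    by (intro smooth_rules T)
  then show ?thesis by (rule smooth_on_cong[OF U, rotated]) (simp only: trc_def)
qed

text \<open>Contraction commutes with covariant differentiation: the derivative of the inverse
  metric contributes exactly the Christoffel terms of \<open>nabla2\<close>.\<close>

lemma trc_derivative:
  assumes x: "x \<in> U" and T: "\<And>a b. smooth_on U (T a b)"
  shows "partial k (\<lambda>y. trc y (\<lambda>a b. T a b y)) x = trc x (\<lambda>a b. nabla2 G T k a b x)"
proof -
  have "partial k (\<lambda>y. trc y (\<lambda>a b. T a b y)) x = partial k (\<lambda>y. \<Sum>a\<in>UNIV. \<Sum>b\<in>UNIV. inverse_metric G a b y * T a b y) x"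
    by (rule partial_cong[OF U x]) (simp only: trc_def)
  also have "\<dots> = (\<Sum>a\<in>UNIV. \<Sum>b\<in>UNIV. partial k (inverse_metric G a b) x * T a b x + inverse_metric G a b x * partial k (T a b) x)"
    by (simp only: pd_sum[OF x] pd_mult[OF x] smooth_rules T)
  also have "\<dots> = trc x (\<lambda>a b. nabla2 G T k a b x)"
    unfolding trc_def[OF x] nabla2_def inverse_metric_derivative[OF x] sum_3 by (simp add: algebra_simps)
  finally show ?thesis .
qed

text \<open>The traced pair occupies the first slots of \<open>T\<close>; the Christoffel term of
  the remaining index is linear in \<open>T\<close> and passes through the trace. Other slot orders
  are brought to this one by permuting arguments at the point of use.\<close>

lemma nabla1_trc:
  assumes x: "x \<in> U" and T: "\<And>a b i. smooth_on U (T a b i)"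
  shows "nabla1 G (\<lambda>i y. trc y (\<lambda>a b. T a b i y)) k i x = trc x (\<lambda>a b. nabla3 G T k a b i x)"
proof -
  interpret pos_inner_product_components "\<lambda>i j. G x $ i $ j" "\<lambda>i j. inverse_metric G i j x"
    by (rule pos_inner_product[OF x])
  have "nabla3 G T k a b i x = nabla2 G (\<lambda>a b. T a b i) k a b x - (\<Sum>m\<in>UNIV. christoffel G m k i x * T a b m x)" for a b
    by (simp add: nabla3_def nabla2_def)
  then show ?thesis
    by (simp only: nabla1_def trc_derivative[OF x T] tr_diff tr_sum tr_scale)
qed

lemma nabla2_trc:
  assumes x: "x \<in> U" and T: "\<And>a b i j. smooth_on U (T a b i j)"
  shows "nabla2 G (\<lambda>i j y. trc y (\<lambda>a b. T a b i j y)) k i j x = trc x (\<lambda>a b. nabla4 G T k a b i j x)"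
proof -
  interpret pos_inner_product_components "\<lambda>i j. G x $ i $ j" "\<lambda>i j. inverse_metric G i j x"
    by (rule pos_inner_product[OF x])
  have "nabla4 G T k a b i j x = nabla2 G (\<lambda>a b. T a b i j) k a b x
     - (\<Sum>m\<in>UNIV. christoffel G m k i x * T a b m j x) - (\<Sum>m\<in>UNIV. christoffel G m k j x * T a b i m x)" for a b
    by (simp add: nabla4_def nabla2_def)
  then show ?thesis
    by (simp only: nabla2_def[of G "\<lambda>i j y. trc y (\<lambda>a b. T a b i j y)"] trc_derivative[OF x T] tr_diff tr_sum tr_scale)
qed

section \<open>Locality of covariant derivatives and the Ricci identities\<close>

lemma nabla1_cong:
  assumes "x \<in> U" "\<And>i y. y \<in> U \<Longrightarrow> T i y = T' i y"
  shows "nabla1 G T k i x = nabla1 G T' k i x"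
proof -
  have "partial k (T i) x = partial k (T' i) x"
    by (rule partial_cong[OF U assms(1) assms(2)])
  then show ?thesis unfolding nabla1_def assms(2)[OF assms(1)] by (simp only:)
qed

lemma nabla2_cong:
  assumes "x \<in> U" "\<And>i j y. y \<in> U \<Longrightarrow> T i j y = T' i j y"
  shows "nabla2 G T k i j x = nabla2 G T' k i j x"
proof -
  have "partial k (T i j) x = partial k (T' i j) x"
    by (rule partial_cong[OF U assms(1) assms(2)])
  then show ?thesis unfolding nabla2_def assms(2)[OF assms(1)] by (simp only:)
qed

lemma nabla3_cong:
  assumes "x \<in> U" "\<And>i j l y. y \<in> U \<Longrightarrow> T i j l y = T' i j l y"
  shows "nabla3 G T k i j l x = nabla3 G T' k i j l x"
proof -
  have "partial k (T i j l) x = partial k (T' i j l) x"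
    by (rule partial_cong[OF U assms(1) assms(2)])
  then show ?thesis unfolding nabla3_def assms(2)[OF assms(1)] by (simp only:)
qed

text \<open>Second partial derivatives commute, terms with first derivatives of \<open>T\<close>
  cancel, and the coefficients of \<open>T\<close> assemble into the curvature. The minus sign is
  that of the dual connection on covectors; in higher rank there is one such term per index.\<close>

lemma ricci_identity1:
  assumes x: "x \<in> U" and T: "\<And>i. smooth_on U (T i)"
  shows "nabla2 G (nabla1 G T) i j k x - nabla2 G (nabla1 G T) j i k x = - (\<Sum>p\<in>UNIV. riemann G p k i j x * T p x)"
proof -
  have c: "partial i (partial j (T k)) x = partial j (partial i (T k)) x"
    by (rule partial_commute[OF U x T])
  have s: "christoffel G m j i x = christoffel G m i j x" for m by (rule christoffel_sym[OF x])
  have p: "partial i (nabla1 G T j k) x = partial i (partial j (T k)) x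
    - (\<Sum>m\<in>UNIV. partial i (christoffel G m j k) x * T m x + christoffel G m j k x * partial i (T m) x)" for i j
  proof -
    have "nabla1 G T j k = (\<lambda>y. partial j (T k) y - (\<Sum>m\<in>UNIV. christoffel G m j k y * T m y))"
      by (rule ext) (rule nabla1_def)
    then show ?thesis by (simp only: pd_diff[OF x] pd_sum[OF x] pd_mult[OF x] smooth_rules T)
  qed
  show ?thesis
    unfolding nabla2_def p unfolding nabla1_def riemann_def sum_3 s c by (simp add: algebra_simps)
qed

lemma ricci_identity2:
  assumes x: "x \<in> U" and T: "\<And>i j. smooth_on U (T i j)"
  shows "nabla3 G (nabla2 G T) i j k l x - nabla3 G (nabla2 G T) j i k l x
    = - (\<Sum>p\<in>UNIV. riemann G p k i j x * T p l x) - (\<Sum>p\<in>UNIV. riemann G p l i j x * T k p x)"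
proof -
  have c: "partial i (partial j (T k l)) x = partial j (partial i (T k l)) x"
    by (rule partial_commute[OF U x T])
  have s: "christoffel G m j i x = christoffel G m i j x" for m by (rule christoffel_sym[OF x])
  have p: "partial i (nabla2 G T j k l) x = partial i (partial j (T k l)) x
    - (\<Sum>m\<in>UNIV. partial i (christoffel G m j k) x * T m l x + christoffel G m j k x * partial i (T m l) x)
    - (\<Sum>m\<in>UNIV. partial i (christoffel G m j l) x * T k m x + christoffel G m j l x * partial i (T k m) x)" for i j
  proof -
    have "nabla2 G T j k l = (\<lambda>y. partial j (T k l) y - (\<Sum>m\<in>UNIV. christoffel G m j k y * T m l y)
        - (\<Sum>m\<in>UNIV. christoffel G m j l y * T k m y))"
      by (rule ext) (rule nabla2_def)
    then show ?thesis by (simp only: pd_diff[OF x] pd_sum[OF x] pd_mult[OF x] smooth_rules T)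
  qed
  show ?thesis
    unfolding nabla3_def p unfolding nabla2_def riemann_def sum_3 s c by (simp add: algebra_simps)
qed

lemma ricci_identity3:
  assumes x: "x \<in> U" and T: "\<And>i j k. smooth_on U (T i j k)"
  shows "nabla4 G (nabla3 G T) i j k l n x - nabla4 G (nabla3 G T) j i k l n x
    = - (\<Sum>p\<in>UNIV. riemann G p k i j x * T p l n x) - (\<Sum>p\<in>UNIV. riemann G p l i j x * T k p n x)
      - (\<Sum>p\<in>UNIV. riemann G p n i j x * T k l p x)"
proof -
  have c: "partial i (partial j (T k l n)) x = partial j (partial i (T k l n)) x"
    by (rule partial_commute[OF U x T])
  have s: "christoffel G m j i x = christoffel G m i j x" for m by (rule christoffel_sym[OF x])
  have p: "partial i (nabla3 G T j k l n) x = partial i (partial j (T k l n)) x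
    - (\<Sum>m\<in>UNIV. partial i (christoffel G m j k) x * T m l n x + christoffel G m j k x * partial i (T m l n) x)
    - (\<Sum>m\<in>UNIV. partial i (christoffel G m j l) x * T k m n x + christoffel G m j l x * partial i (T k m n) x)
    - (\<Sum>m\<in>UNIV. partial i (christoffel G m j n) x * T k l m x + christoffel G m j n x * partial i (T k l m) x)" for i j
  proof -
    have "nabla3 G T j k l n = (\<lambda>y. partial j (T k l n) y - (\<Sum>m\<in>UNIV. christoffel G m j k y * T m l n y)
        - (\<Sum>m\<in>UNIV. christoffel G m j l y * T k m n y) - (\<Sum>m\<in>UNIV. christoffel G m j n y * T k l m y))"
      by (rule ext) (rule nabla3_def)
    then show ?thesis by (simp only: pd_diff[OF x] pd_sum[OF x] pd_mult[OF x] smooth_rules T)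
  qed
  show ?thesis
    unfolding nabla4_def p unfolding nabla3_def riemann_def sum_3 s c by (simp add: algebra_simps)
qed

section \<open>Symmetries of the curvature tensor\<close>

definition riem :: "3 \<Rightarrow> 3 \<Rightarrow> 3 \<Rightarrow> 3 \<Rightarrow> real^3 \<Rightarrow> real" where
  "riem l k i j x = (\<Sum>p\<in>UNIV. G x $ l $ p * riemann G p k i j x)"

lemma smooth_riem: "smooth_on U (riem l k i j)"
proof -
  have "smooth_on U (\<lambda>x. riem l k i j x)"
    unfolding riem_def by (intro smooth_rules)
  then show ?thesis by simp
qed

text \<open>The classical expression by second derivatives of the metric and quadratic terms in the
  Christoffel symbols. It makes visible the symmetries that the definition through
  \<open>riemann\<close> hides.\<close>

lemma riem_formula:
  assumes x: "x \<in> U"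
  shows "riem l k i j x
    = (partial i (partial k (\<lambda>y. G y $ j $ l)) x - partial i (partial l (\<lambda>y. G y $ j $ k)) x
      - partial j (partial k (\<lambda>y. G y $ i $ l)) x + partial j (partial l (\<lambda>y. G y $ i $ k)) x) / 2
    - (\<Sum>p\<in>UNIV. \<Sum>q\<in>UNIV. G x $ p $ q * christoffel G q i l x * christoffel G p j k x)
    + (\<Sum>p\<in>UNIV. \<Sum>q\<in>UNIV. G x $ p $ q * christoffel G q j l x * christoffel G p i k x)"
proof -
  have sG: "smooth_on U (partial a (\<lambda>y. G y $ b $ c))" for a b c by (intro smooth_rules)
  have L: "(\<Sum>m\<in>UNIV. G x $ l $ m * partial i (christoffel G m j k) x)
    = (partial i (partial j (\<lambda>y. G y $ k $ l)) x + partial i (partial k (\<lambda>y. G y $ j $ l)) x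
        - partial i (partial l (\<lambda>y. G y $ j $ k)) x) / 2
      - (\<Sum>m\<in>UNIV. partial i (\<lambda>y. G y $ l $ m) x * christoffel G m j k x)" for i j
  proof -
    have "partial i (\<lambda>y. \<Sum>m\<in>UNIV. G y $ l $ m * christoffel G m j k y) x
      = partial i (\<lambda>y. (partial j (\<lambda>y. G y $ k $ l) y + partial k (\<lambda>y. G y $ j $ l) y - partial l (\<lambda>y. G y $ j $ k) y) / 2) x"
      by (rule partial_cong[OF U x]) (rule christoffel_lower)
    also have "\<dots> = (partial i (partial j (\<lambda>y. G y $ k $ l)) x + partial i (partial k (\<lambda>y. G y $ j $ l)) x
        - partial i (partial l (\<lambda>y. G y $ j $ k)) x) / 2"
      by (simp only: pd_divide[OF x] pd_add[OF x] pd_diff[OF x] smooth_rules sG)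
    also have "partial i (\<lambda>y. \<Sum>m\<in>UNIV. G y $ l $ m * christoffel G m j k y) x
      = (\<Sum>m\<in>UNIV. partial i (\<lambda>y. G y $ l $ m) x * christoffel G m j k x + G x $ l $ m * partial i (christoffel G m j k) x)"
      by (simp only: pd_sum[OF x] pd_mult[OF x] smooth_rules)
    finally show ?thesis by (simp add: sum.distrib algebra_simps)
  qed
  have c: "partial i (partial j (\<lambda>y. G y $ k $ l)) x = partial j (partial i (\<lambda>y. G y $ k $ l)) x"
    by (rule partial_commute[OF U x G_smooth])
  have g: "G x $ 2 $ 1 = G x $ 1 $ 2" "G x $ 3 $ 1 = G x $ 1 $ 3" "G x $ 3 $ 2 = G x $ 2 $ 3"
    by (rule G_sym[OF x])+
  have gl: "G x $ a $ l = G x $ l $ a" for a by (rule G_sym[OF x])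
  have "riem l k i j x = (\<Sum>m\<in>UNIV. G x $ l $ m * partial i (christoffel G m j k) x)
     - (\<Sum>m\<in>UNIV. G x $ l $ m * partial j (christoffel G m i k) x)
     + (\<Sum>p\<in>UNIV. G x $ l $ p * (\<Sum>m\<in>UNIV. christoffel G p i m x * christoffel G m j k x
                 - christoffel G p j m x * christoffel G m i k x))"
    unfolding riem_def riemann_def by (simp add: sum.distrib sum_subtractf distrib_left right_diff_distrib)
  then show ?thesis
    unfolding L c unfolding metric_derivative[OF x] sum_3 by (simp add: gl g field_simps)
qed

lemma pd2_G_sym: "x \<in> U \<Longrightarrow> partial l (partial k (\<lambda>y. G y $ i $ j)) x = partial l (partial k (\<lambda>y. G y $ j $ i)) x"
  by (rule partial_cong[OF U]) (auto intro: pd_G_sym)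

lemma curvature: 
  assumes x: "x \<in> U"
  shows "curvature_components (\<lambda>i j. G x $ i $ j) (\<lambda>i j. inverse_metric G i j x) (\<lambda>l k i j. riem l k i j x)"
proof -
  interpret pos_inner_product_components "\<lambda>i j. G x $ i $ j" "\<lambda>i j. inverse_metric G i j x"
    by (rule pos_inner_product[OF x])
  \<comment> \<open>The quadratic terms are values of the symmetric bilinear form
    \<open>G x\<close>, so their arguments may be exchanged.\<close>
  have Q: "(\<Sum>p\<in>UNIV. \<Sum>q\<in>UNIV. G x $ p $ q * A q * B p) = (\<Sum>p\<in>UNIV. \<Sum>q\<in>UNIV. G x $ p $ q * B q * A p)" for A B :: "3 \<Rightarrow> real"
    by (subst sum.swap) (intro sum.cong refl, metis G_sym[OF x] mult.assoc mult.commute)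
  have c: "partial i (partial j (\<lambda>y. G y $ k $ l)) x = partial j (partial i (\<lambda>y. G y $ k $ l)) x" for i j k l
    by (rule partial_commute[OF U x G_smooth])
  show ?thesis
  proof
    fix l k i j
    show 1: "riem l k i j x = - riem l k j i x"
      unfolding riem_formula[OF x] by (simp add: field_simps)
    show "riem l k i j x = - riem k l i j x"
      unfolding riem_formula[OF x] Q[of "\<lambda>q. christoffel G q i l x" "\<lambda>p. christoffel G p j k x"]
        Q[of "\<lambda>q. christoffel G q j l x" "\<lambda>p. christoffel G p i k x"]
      by (simp add: field_simps)
    show "riem l k i j x = riem i j l k x"
      unfolding riem_formula[OF x] Q[of "\<lambda>q. christoffel G q i l x" "\<lambda>p. christoffel G p j k x"]
        Q[of "\<lambda>q. christoffel G q j l x" "\<lambda>p. christoffel G p i k x"]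
        pd2_G_sym[OF x, of _ _ l] pd2_G_sym[OF x, of _ _ k]
        c[of l j] c[of l i] c[of k j] c[of k i]
        christoffel_sym[OF x, of _ l] christoffel_sym[OF x, of _ k]
      by (simp add: field_simps)
  qed
qed

end

context curvature_components
begin

text \<open>This and \<open>Rm_Sch_trace_sym\<close> treat the two curvature terms that appear when
  derivatives of the Schouten tensor are exchanged; being symmetric in \<open>i\<close> and
  \<open>j\<close>, these drop out of the divergence of the Cotton tensor. Here the reason is the
  pair symmetry of \<open>Rm\<close>.\<close>

lemma Rm_Sch_contraction_sym:
  "tr (\<lambda>m k. tr (\<lambda>p a. Rm a j m i * Sch p k)) = tr (\<lambda>m k. tr (\<lambda>p a. Rm a i m j * Sch p k))"
proof -
  have "tr (\<lambda>m k. tr (\<lambda>p a. Rm a i m j * Sch p k)) = tr (\<lambda>p a. tr (\<lambda>m k. Rm a i m j * Sch p k))"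
    by (rule tr_swap)
  also have "\<dots> = tr (\<lambda>a p. tr (\<lambda>m k. Rm a i m j * Sch p k))" by (rule tr_flip[symmetric])
  also have "\<dots> = tr (\<lambda>a p. tr (\<lambda>k m. Rm a i m j * Sch p k))"
    by (rule arg_cong[of _ _ tr], intro ext) (rule tr_flip[symmetric])
  also have "\<dots> = tr (\<lambda>a p. tr (\<lambda>k m. Rm m j a i * Sch k p))"
  proof -
    have "Rm a i m j * Sch p k = Rm m j a i * Sch k p" for a m p k
      using Rm_pair[of a i m j] Sch_sym[of p k] by (rule arg_cong2[of _ _ _ _ "(*)"])
    then show ?thesis by (intro arg_cong[of _ _ tr] ext)
  qed
  finally show ?thesis by (rule sym)
qed

text \<open>Tracing \<open>Rm\<close> leaves a multiple of \<open>Sch\<close> and the square of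
  \<open>Sch\<close>, which are both symmetric.\<close>

lemma Rm_Sch_trace_sym:
  "tr (\<lambda>m k. tr (\<lambda>p a. Rm a k m i * Sch j p)) = tr (\<lambda>m k. tr (\<lambda>p a. Rm a k m j * Sch i p))"
proof -
  have 1: "tr (\<lambda>m k. tr (\<lambda>p a. Rm a k m i * Sch j p)) = - tr Sch * Sch j i - tr (\<lambda>p a. Sch a i * Sch j p)" for i j
  proof -
    have "tr (\<lambda>m k. tr (\<lambda>p a. Rm a k m i * Sch j p)) = tr (\<lambda>p a. tr (\<lambda>m k. Rm a k m i * Sch j p))"
      by (rule tr_swap)
    also have "\<dots> = tr (\<lambda>p a. tr (\<lambda>m k. Rm a k m i) * Sch j p)" by (simp only: tr_scale_right)
    also have "\<dots> = tr (\<lambda>p a. (- (g a i * tr Sch) - Sch a i) * Sch j p)"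
    proof -
      have "tr (\<lambda>m k. Rm a k m i) = - (g a i * tr Sch) - Sch a i" for a
        using tr_flip[of "\<lambda>k m. Rm a k m i"] tr_Rm_inner(2) by (rule trans)
      then show ?thesis by (simp only:)
    qed
    also have "\<dots> = tr (\<lambda>p a. - tr Sch * (g a i * Sch j p) - Sch a i * Sch j p)"
      by (intro arg_cong[of _ _ tr] ext) (simp add: algebra_simps)
    also have "\<dots> = - tr Sch * Sch j i - tr (\<lambda>p a. Sch a i * Sch j p)"
      by (simp only: tr_diff tr_scale tr_g)
    finally show ?thesis .
  qed
  have "tr (\<lambda>p a. Sch a i * Sch j p) = tr (\<lambda>p a. Sch a j * Sch i p)"
  proof -
    have "tr (\<lambda>p a. Sch a i * Sch j p) = tr (\<lambda>a p. Sch a i * Sch j p)" by (rule tr_flip[symmetric])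
    also have "\<dots> = tr (\<lambda>a p. Sch p j * Sch i a)"
    proof -
      have "Sch a i * Sch j p = Sch p j * Sch i a" for a p
        using Sch_sym[of a i] Sch_sym[of j p] by (simp only: mult.commute)
      then show ?thesis by (intro arg_cong[of _ _ tr] ext)
    qed
    finally show ?thesis .
  qed
  then show ?thesis unfolding 1 by (simp only: Sch_sym[of j i])
qed

end

section \<open>The Schouten tensor and the Bianchi identities\<close>

context metric_chart
begin

lemma riemann_raise:
  assumes x: "x \<in> U"
  shows "riemann G l k i j x = (\<Sum>p\<in>UNIV. inverse_metric G l p x * riem p k i j x)"
proof -
  interpret pos_inner_product_components "\<lambda>i j. G x $ i $ j" "\<lambda>i j. inverse_metric G i j x"
    by (rule pos_inner_product[OF x])
  show ?thesis unfolding riem_def raise_lower ..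
qed

lemma riemann_contract:
  assumes x: "x \<in> U"
  shows "(\<Sum>p\<in>UNIV. riemann G p k i j x * X p) = trc x (\<lambda>p a. riem a k i j x * X p)"
  unfolding trc_def[OF x] riemann_raise[OF x] sum_distrib_right by (simp only: mult.assoc)

definition schouten where "schouten i j x = ricci G i j x - scalar_curvature G x / 4 * G x $ i $ j"

lemma smooth_schouten: "smooth_on U (schouten i j)"
proof -
  have "smooth_on U (\<lambda>x. schouten i j x)"
    unfolding schouten_def by (intro smooth_rules)
  then show ?thesis by simp
qed

lemma scalar_curvature_trc: "x \<in> U \<Longrightarrow> scalar_curvature G x = trc x (\<lambda>a b. ricci G a b x)"
  by (simp only: scalar_curvature_def trc_def)

lemma ricci_trc:
  assumes x: "x \<in> U"
  shows "ricci G j k x = trc x (\<lambda>a b. riem a k b j x)"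
proof -
  interpret pos_inner_product_components "\<lambda>i j. G x $ i $ j" "\<lambda>i j. inverse_metric G i j x"
    by (rule pos_inner_product[OF x])
  have "ricci G j k x = trc x (\<lambda>i p. riem p k i j x)"
    unfolding ricci_def riemann_raise[OF x] trc_def[OF x] ..
  then show ?thesis using tr_flip[of "\<lambda>a b. riem a k b j x"] by (rule trans)
qed

lemma
  assumes x: "x \<in> U"
  shows ricci_Ric: "ricci G i j x = curvature_components.Ric (\<lambda>i j. inverse_metric G i j x) (\<lambda>l k i j. riem l k i j x) i j"
    and scalar_Scal: "scalar_curvature G x = curvature_components.Scal (\<lambda>i j. inverse_metric G i j x) (\<lambda>l k i j. riem l k i j x)"
    and schouten_Sch: "schouten i j x = curvature_components.Sch (\<lambda>i j. G x $ i $ j) (\<lambda>i j. inverse_metric G i j x) (\<lambda>l k i j. riem l k i j x) i j"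
proof -
  interpret curvature_components "\<lambda>i j. G x $ i $ j" "\<lambda>i j. inverse_metric G i j x" "\<lambda>l k i j. riem l k i j x"
    by (rule curvature[OF x])
  show 1: "ricci G i j x = Ric i j" for i j
    unfolding Ric_def ricci_trc[OF x] ..
  have "(\<lambda>i j. ricci G i j x) = Ric" by (intro ext 1)
  then show 2: "scalar_curvature G x = Scal"
    unfolding Scal_def scalar_curvature_trc[OF x] by (rule arg_cong)
  show "schouten i j x = Sch i j"
    unfolding schouten_def Sch_def 1 2 ..
qed

lemma riem_decomposition:
  assumes x: "x \<in> U"
  shows "riem l k i j x = G x $ l $ i * schouten k j x + G x $ k $ j * schouten l i x
    - G x $ l $ j * schouten k i x - G x $ k $ i * schouten l j x"
  unfolding schouten_Sch[OF x] by (rule curvature_components.Rm_decomposition[OF curvature[OF x]])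

lemma schouten_sym: "x \<in> U \<Longrightarrow> schouten i j x = schouten j i x"
  unfolding schouten_Sch by (rule curvature_components.Sch_sym[OF curvature])

text \<open>The exterior covariant derivative of the curvature, seen as a two-form with values in
  endomorphisms, vanishes. Accordingly \<open>B\<close> has Christoffel terms only for the
  endomorphism indices \<open>l\<close> and \<open>k\<close>; those of the form indices are added in
  \<open>second_bianchi\<close>.\<close>

lemma second_bianchi_mixed:
  assumes x: "x \<in> U"
  defines "B i l k j m \<equiv> partial i (riemann G l k j m) x
    + (\<Sum>p\<in>UNIV. christoffel G l i p x * riemann G p k j m x)
    - (\<Sum>p\<in>UNIV. christoffel G p i k x * riemann G l p j m x)"
  shows "B i l k j m + B j l k m i + B m l k i j = 0"
proof -
  have p: "partial i (riemann G l k j m) x = partial i (partial j (christoffel G l m k)) x - partial i (partial m (christoffel G l j k)) x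
    + (\<Sum>n\<in>UNIV. (partial i (christoffel G l j n) x * christoffel G n m k x + christoffel G l j n x * partial i (christoffel G n m k) x)
        - (partial i (christoffel G l m n) x * christoffel G n j k x + christoffel G l m n x * partial i (christoffel G n j k) x))" for i j m
  proof -
    have "riemann G l k j m = (\<lambda>y. partial j (christoffel G l m k) y - partial m (christoffel G l j k) y
     + (\<Sum>n\<in>UNIV. christoffel G l j n y * christoffel G n m k y - christoffel G l m n y * christoffel G n j k y))"
      by (rule ext) (rule riemann_def)
    then show ?thesis by (simp only: pd_add[OF x] pd_diff[OF x] pd_sum[OF x] pd_mult[OF x] smooth_rules)
  qed
  have c: "partial i (partial j (christoffel G l m k)) x = partial j (partial i (christoffel G l m k)) x" for i j m
    by (rule partial_commute[OF U x smooth_christoffel])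
  show ?thesis
    unfolding B_def p c[of j i] c[of m i] c[of m j] unfolding riemann_def sum_3 by (simp add: algebra_simps)
qed

text \<open>By metric compatibility, lowering the first index commutes with the derivative. The
  connection terms of the form indices \<open>j\<close> and \<open>m\<close> stay separate, ready to
  cancel in the cyclic sum.\<close>

lemma nabla4_riem:
  assumes x: "x \<in> U"
  shows "nabla4 G riem i l k j m x = (\<Sum>q\<in>UNIV. G x $ l $ q * (partial i (riemann G q k j m) x
      + (\<Sum>p\<in>UNIV. christoffel G q i p x * riemann G p k j m x)
      - (\<Sum>p\<in>UNIV. christoffel G p i k x * riemann G q p j m x)))
    - (\<Sum>p\<in>UNIV. christoffel G p i j x * riem l k p m x) - (\<Sum>p\<in>UNIV. christoffel G p i m x * riem l k j p x)"
proof -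
  have "riem l k j m = (\<lambda>y. \<Sum>q\<in>UNIV. G y $ l $ q * riemann G q k j m y)"
    by (rule ext) (rule riem_def)
  then have "partial i (riem l k j m) x = (\<Sum>q\<in>UNIV. partial i (\<lambda>y. G y $ l $ q) x * riemann G q k j m x
     + G x $ l $ q * partial i (riemann G q k j m) x)"
    by (simp only: pd_sum[OF x] pd_mult[OF x] smooth_rules)
  then show ?thesis
    unfolding nabla4_def metric_derivative[OF x] unfolding riem_def sum_3 by (simp add: algebra_simps)
qed

lemma riem_anti: "x \<in> U \<Longrightarrow> riem l k i j x = - riem l k j i x"
  by (rule curvature_components.Rm_anti(2)[OF curvature])

lemma second_bianchi:
  assumes x: "x \<in> U"
  shows "nabla4 G riem i l k j m x + nabla4 G riem j l k m i x + nabla4 G riem m l k i j x = 0"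
proof -
  define B where "B i q j m = partial i (riemann G q k j m) x
      + (\<Sum>p\<in>UNIV. christoffel G q i p x * riemann G p k j m x)
      - (\<Sum>p\<in>UNIV. christoffel G p i k x * riemann G q p j m x)" for i q j m
  have B: "B i q j m + B j q m i + B m q i j = 0" for q
    unfolding B_def by (rule second_bianchi_mixed[OF x])
  have "(\<Sum>q\<in>UNIV. G x $ l $ q * B i q j m) + (\<Sum>q\<in>UNIV. G x $ l $ q * B j q m i) + (\<Sum>q\<in>UNIV. G x $ l $ q * B m q i j)
    = (\<Sum>q\<in>UNIV. G x $ l $ q * (B i q j m + B j q m i + B m q i j))"
    by (simp add: sum.distrib distrib_left)
  then have 0: "(\<Sum>q\<in>UNIV. G x $ l $ q * B i q j m) + (\<Sum>q\<in>UNIV. G x $ l $ q * B j q m i) + (\<Sum>q\<in>UNIV. G x $ l $ q * B m q i j) = 0"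
    unfolding B by simp
  \<comment> \<open>Symmetry of the Christoffel symbols and skewness in the last pair match each
    form-index term with one of another member of the cyclic sum, with opposite sign.\<close>
  have 1: "(\<Sum>p\<in>UNIV. christoffel G p a b x * riem l k p c x) = - (\<Sum>p\<in>UNIV. christoffel G p b a x * riem l k c p x)" for a b c
    unfolding sum_negf[symmetric]
    by (intro sum.cong refl) (simp only: christoffel_sym[OF x, of _ a b] riem_anti[OF x, of l k _ c] mult_minus_right)
  have n: "nabla4 G riem i l k j m x = (\<Sum>q\<in>UNIV. G x $ l $ q * B i q j m)
    - (\<Sum>p\<in>UNIV. christoffel G p i j x * riem l k p m x) - (\<Sum>p\<in>UNIV. christoffel G p i m x * riem l k j p x)" for i j m
    unfolding B_def by (rule nabla4_riem[OF x])
  show ?thesis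
    unfolding n 1[of i j m] 1[of j m i] 1[of m i j] using 0 by simp
qed

lemma nabla4_riem_anti:
  assumes x: "x \<in> U"
  shows "nabla4 G riem i l k m j x = - nabla4 G riem i l k j m x"
proof -
  have "partial i (riem l k m j) x = partial i (\<lambda>y. - riem l k j m y) x"
    by (rule partial_cong[OF U x]) (rule riem_anti)
  then have "partial i (riem l k m j) x = - partial i (riem l k j m) x"
    by (simp only: pd_minus[OF x smooth_riem])
  then show ?thesis
    unfolding nabla4_def riem_anti[OF x, of _ _ m j] riem_anti[OF x, of l k _ j] riem_anti[OF x, of l k m]
    by (simp add: sum_negf)
qed

text \<open>Two sign changes, one in each skew pair, cancel. This puts the middle term of the traced
  Bianchi identity into the index order of a derivative of the Ricci tensor.\<close>

lemma nabla4_riem_pair: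
  assumes x: "x \<in> U"
  shows "nabla4 G riem i l k m j x = nabla4 G riem i k l j m x"
proof -
  have s: "riem l k m j y = riem k l j m y" if "y \<in> U" for y l k m j
    using curvature_components.Rm_anti[OF curvature[OF that], of l k m j]
      curvature_components.Rm_anti(2)[OF curvature[OF that], of k l m j] by simp
  have "partial i (riem l k m j) x = partial i (riem k l j m) x"
    by (rule partial_cong[OF U x s])
  then show ?thesis unfolding nabla4_def by (simp add: s[OF x, of _ k m j] s[OF x, of l _ m j] s[OF x, of l k _ j] s[OF x, of l k m])
qed

lemma nabla2_ricci:
  assumes x: "x \<in> U"
  shows "nabla2 G (ricci G) k i j x = trc x (\<lambda>a b. nabla4 G riem k a j b i x)"
proof -
  have "nabla2 G (ricci G) k i j x = nabla2 G (\<lambda>i j y. trc y (\<lambda>a b. riem a j b i y)) k i j x"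
    by (rule nabla2_cong[OF x]) (rule ricci_trc)
  also have "\<dots> = trc x (\<lambda>a b. nabla4 G (\<lambda>a b i j. riem a j b i) k a b i j x)"
    by (rule nabla2_trc[OF x smooth_riem])
  finally show ?thesis by (simp add: nabla4_def diff_diff_eq add_ac)
qed

lemma partial_scalar_curvature:
  assumes x: "x \<in> U"
  shows "partial m (scalar_curvature G) x = trc x (\<lambda>a b. nabla2 G (ricci G) m a b x)"
proof -
  have "partial m (scalar_curvature G) x = partial m (\<lambda>y. trc y (\<lambda>a b. ricci G a b y)) x"
    by (rule partial_cong[OF U x]) (rule scalar_curvature_trc)
  also have "\<dots> = trc x (\<lambda>a b. nabla2 G (ricci G) m a b x)"
    by (rule trc_derivative[OF x smooth_ricci])
  finally show ?thesis .
qed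

text \<open>Tracing the second Bianchi identity twice produces the divergence of the Ricci tensor
  twice, and the differential of the scalar curvature once with a minus sign.\<close>

lemma contracted_bianchi:
  assumes x: "x \<in> U"
  shows "trc x (\<lambda>k i. nabla2 G (ricci G) i m k x) = partial m (scalar_curvature G) x / 2"
proof -
  interpret pos_inner_product_components "\<lambda>i j. G x $ i $ j" "\<lambda>i j. inverse_metric G i j x"
    by (rule pos_inner_product[OF x])
  have 1: "nabla2 G (ricci G) i m k x + trc x (\<lambda>l j. nabla4 G riem j l k m i x) - nabla2 G (ricci G) m i k x = 0" for i k
  proof -
    have "trc x (\<lambda>l j. nabla4 G riem m l k i j x) = - nabla2 G (ricci G) m i k x"
      unfolding nabla2_ricci[OF x] nabla4_riem_anti[OF x, of _ _ _ i] by (rule tr_minus)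
    moreover have "trc x (\<lambda>l j. nabla4 G riem i l k j m x + nabla4 G riem j l k m i x + nabla4 G riem m l k i j x) = 0"
      unfolding second_bianchi[OF x] by (rule tr_zero)
    ultimately show ?thesis unfolding tr_add nabla2_ricci[OF x, of i m k] by simp
  qed
  have 2: "trc x (\<lambda>k i. trc x (\<lambda>l j. nabla4 G riem j l k m i x)) = trc x (\<lambda>l j. nabla2 G (ricci G) j m l x)"
    unfolding nabla2_ricci[OF x] nabla4_riem_pair[OF x, of _ _ _ m] by (rule tr_swap)
  have 3: "trc x (\<lambda>k i. nabla2 G (ricci G) m i k x) = partial m (scalar_curvature G) x"
    unfolding partial_scalar_curvature[OF x] by (rule tr_flip)
  have "trc x (\<lambda>k i. nabla2 G (ricci G) i m k x + trc x (\<lambda>l j. nabla4 G riem j l k m i x) - nabla2 G (ricci G) m i k x) = 0"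
    unfolding 1 by (rule tr_zero)
  then show ?thesis unfolding tr_add tr_diff 2 3 by simp
qed


section \<open>The Cotton and Bach tensors, and the soliton equation\<close>

lemma nabla2_metric:
  assumes x: "x \<in> U"
  shows "nabla2 G (\<lambda>i j y. G y $ i $ j) k i j x = 0"
  unfolding nabla2_def metric_derivative[OF x] by simp

lemma nabla2_schouten:
  assumes x: "x \<in> U"
  shows "nabla2 G schouten i j k x = nabla2 G (ricci G) i j k x - partial i (scalar_curvature G) x / 4 * G x $ j $ k"
proof -
  have "schouten j k = (\<lambda>y. ricci G j k y - scalar_curvature G y / 4 * G y $ j $ k)"
    by (rule ext) (rule schouten_def)
  then have "partial i (schouten j k) x = partial i (ricci G j k) x - (partial i (scalar_curvature G) x / 4 * G x $ j $ k
     + scalar_curvature G x / 4 * partial i (\<lambda>y. G y $ j $ k) x)"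
    by (simp only: pd_diff[OF x] pd_mult[OF x] pd_divide[OF x] smooth_rules)
  then show ?thesis
    unfolding nabla2_def metric_derivative[OF x] schouten_def sum_3 by (simp add: algebra_simps)
qed

lemma cotton_schouten:
  assumes x: "x \<in> U"
  shows "cotton G i j k x = nabla2 G schouten i j k x - nabla2 G schouten j i k x"
  unfolding cotton_def nabla2_schouten[OF x] by algebra

lemma smooth_nabla2_schouten: "smooth_on U (nabla2 G schouten i j k)"
  by (rule smooth_nabla2[OF smooth_schouten])

lemma smooth_cotton: "smooth_on U (cotton G i j k)"
proof -
  have "smooth_on U (\<lambda>x. cotton G i j k x)"
    unfolding cotton_def by (intro smooth_rules smooth_nabla2)
  then show ?thesis by simp
qed

lemma cotton_anti: "cotton G i j k x = - cotton G j i k x"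
  unfolding cotton_def right_diff_distrib by linarith

text \<open>The trace of the Schouten tensor is R - 3R/4 = R/4, and its divergence is dR/2 - dR/4.
  That both lead to the same covector is why the Cotton tensor is trace free.\<close>

lemma trc_nabla2_schouten:
  assumes x: "x \<in> U"
  shows "trc x (\<lambda>j k. nabla2 G schouten i j k x) = partial i (scalar_curvature G) x / 4"
    and "trc x (\<lambda>j k. nabla2 G schouten k i j x) = partial i (scalar_curvature G) x / 4"
    and "trc x (\<lambda>j k. nabla2 G schouten j i k x) = partial i (scalar_curvature G) x / 4"
proof -
  interpret pos_inner_product_components "\<lambda>i j. G x $ i $ j" "\<lambda>i j. inverse_metric G i j x"
    by (rule pos_inner_product[OF x])
  show "trc x (\<lambda>j k. nabla2 G schouten i j k x) = partial i (scalar_curvature G) x / 4"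
    unfolding nabla2_schouten[OF x] tr_diff tr_scale tr_g_self partial_scalar_curvature[OF x] by simp
  have e: "partial k (scalar_curvature G) x / 4 * G x $ i $ j = G x $ i $ j * (partial k (scalar_curvature G) x / 4)" for k j
    by (rule mult.commute)
  show 1: "trc x (\<lambda>j k. nabla2 G schouten k i j x) = partial i (scalar_curvature G) x / 4"
    unfolding nabla2_schouten[OF x] tr_diff contracted_bianchi[OF x] e tr_g by simp
  show "trc x (\<lambda>j k. nabla2 G schouten j i k x) = partial i (scalar_curvature G) x / 4"
    using tr_flip[of "\<lambda>j k. nabla2 G schouten k i j x"] 1 by (rule trans)
qed

lemma trc_cotton:
  assumes x: "x \<in> U"
  shows "trc x (\<lambda>j k. cotton G i j k x) = 0"
proof -
  interpret pos_inner_product_components "\<lambda>i j. G x $ i $ j" "\<lambda>i j. inverse_metric G i j x"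
    by (rule pos_inner_product[OF x])
  show ?thesis
    unfolding cotton_schouten[OF x] tr_diff trc_nabla2_schouten[OF x] by simp
qed

text \<open>Exchanging the derivatives lets the divergence act on the Schouten tensor first, which
  leaves the Hessian of R/4. That Hessian and the curvature terms \<open>W\<close> and
  \<open>W'\<close> are each symmetric in \<open>i\<close> and \<open>j\<close>.\<close>

lemma div_nabla2_schouten_sym:
  assumes x: "x \<in> U"
  shows "trc x (\<lambda>m k. nabla3 G (nabla2 G schouten) m i j k x) = trc x (\<lambda>m k. nabla3 G (nabla2 G schouten) m j i k x)"
proof -
  interpret curvature_components "\<lambda>i j. G x $ i $ j" "\<lambda>i j. inverse_metric G i j x" "\<lambda>l k i j. riem l k i j x"
    by (rule curvature[OF x])
  note Sch = schouten_Sch[OF x]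
  define W where "W i j = trc x (\<lambda>m k. trc x (\<lambda>p a. riem a j m i x * schouten p k x))" for i j
  define W' where "W' i j = trc x (\<lambda>m k. trc x (\<lambda>p a. riem a k m i x * schouten j p x))" for i j
  have W: "W i j = W j i" unfolding W_def Sch by (rule Rm_Sch_contraction_sym)
  have W': "W' i j = W' j i" unfolding W'_def Sch by (rule Rm_Sch_trace_sym)
  have D: "trc x (\<lambda>m k. nabla3 G (nabla2 G schouten) i m j k x)
    = nabla1 G (\<lambda>j y. partial j (scalar_curvature G) y / 4) i j x" for i j
  proof -
    have "nabla1 G (\<lambda>j y. trc y (\<lambda>m k. nabla2 G schouten m j k y)) i j x
      = trc x (\<lambda>m k. nabla3 G (\<lambda>m k j. nabla2 G schouten m j k) i m k j x)"
      by (rule nabla1_trc[OF x smooth_nabla2_schouten])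
    also have "\<dots> = trc x (\<lambda>m k. nabla3 G (nabla2 G schouten) i m j k x)"
      by (simp add: nabla3_def diff_diff_eq add_ac)
    finally have "trc x (\<lambda>m k. nabla3 G (nabla2 G schouten) i m j k x)
      = nabla1 G (\<lambda>j y. trc y (\<lambda>m k. nabla2 G schouten m j k y)) i j x" by (rule sym)
    also have "\<dots> = nabla1 G (\<lambda>j y. partial j (scalar_curvature G) y / 4) i j x"
      by (rule nabla1_cong[OF x]) (rule trc_nabla2_schouten)
    finally show ?thesis .
  qed
  have sym: "nabla1 G (\<lambda>j y. partial j (scalar_curvature G) y / 4) i j x
    = nabla1 G (\<lambda>j y. partial j (scalar_curvature G) y / 4) j i x"
    unfolding nabla1_def christoffel_sym[OF x, of _ i j] pd_divide[OF x smooth_on_partial[OF smooth_scalar_curvature]]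
      partial_commute[OF U x smooth_scalar_curvature, of i j] ..
  have R: "nabla3 G (nabla2 G schouten) m i j k x = nabla3 G (nabla2 G schouten) i m j k x
     - trc x (\<lambda>p a. riem a j m i x * schouten p k x) - trc x (\<lambda>p a. riem a k m i x * schouten j p x)" for m i j k
    using ricci_identity2[OF x, of schouten m i j k, OF smooth_schouten] unfolding riemann_contract[OF x] by linarith
  have E: "trc x (\<lambda>m k. nabla3 G (nabla2 G schouten) m i j k x)
    = nabla1 G (\<lambda>j y. partial j (scalar_curvature G) y / 4) i j x - W i j - W' i j" for i j
    unfolding R[of _ i] tr_diff D W_def W'_def ..
  show ?thesis using E[of i j] E[of j i] sym W W' by linarith
qed

text \<open>The contraction is with the last index; with the first one it would be the Bach tensor.
  As the Cotton tensor is the skew part of the derivative of the Schouten tensor, the symmetry just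
  shown is what makes it vanish.\<close>

lemma div_cotton:
  assumes x: "x \<in> U"
  shows "trc x (\<lambda>m k. nabla3 G (cotton G) m i j k x) = 0"
proof -
  interpret pos_inner_product_components "\<lambda>i j. G x $ i $ j" "\<lambda>i j. inverse_metric G i j x"
    by (rule pos_inner_product[OF x])
  have "nabla3 G (cotton G) m i j k x = nabla3 G (\<lambda>i j k y. nabla2 G schouten i j k y - nabla2 G schouten j i k y) m i j k x" for m k
    by (rule nabla3_cong[OF x]) (rule cotton_schouten)
  also have "nabla3 G (\<lambda>i j k y. nabla2 G schouten i j k y - nabla2 G schouten j i k y) m i j k x
    = nabla3 G (nabla2 G schouten) m i j k x - nabla3 G (nabla2 G schouten) m j i k x" for m k
    unfolding nabla3_def pd_diff[OF x smooth_nabla2_schouten smooth_nabla2_schouten] sum_3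
    by (simp add: algebra_simps)
  finally have "trc x (\<lambda>m k. nabla3 G (cotton G) m i j k x)
     = trc x (\<lambda>m k. nabla3 G (nabla2 G schouten) m i j k x) - trc x (\<lambda>m k. nabla3 G (nabla2 G schouten) m j i k x)"
    by (simp only: tr_diff)
  then show ?thesis unfolding div_nabla2_schouten_sym[OF x, of i j] by simp
qed

text \<open>The outer derivative is contracted with the last slot of the Cotton tensor. Once it is
  moved next to that tensor, \<open>div_cotton\<close> removes the main term and only the curvature
  of the exchange survives.\<close>

lemma div_bach_eq:
  assumes x: "x \<in> U"
  shows "div_bach G i x = - trc x (\<lambda>j b. trc x (\<lambda>k c. ricci G b c x * cotton G i j k x))"
proof -
  interpret curvature_components "\<lambda>i j. G x $ i $ j" "\<lambda>i j. inverse_metric G i j x" "\<lambda>l k i j. riem l k i j x"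
    by (rule curvature[OF x])
  have B: "bach G i j y = trc y (\<lambda>k l. nabla3 G (cotton G) l k i j y)" if "y \<in> U" for i j y
    unfolding bach_def trc_def[OF that] ..
  have nB: "nabla2 G (bach G) m i j x = trc x (\<lambda>k l. nabla4 G (nabla3 G (cotton G)) m l k i j x)" for m j
  proof -
    have "nabla2 G (bach G) m i j x = nabla2 G (\<lambda>i j y. trc y (\<lambda>k l. nabla3 G (cotton G) l k i j y)) m i j x"
      by (rule nabla2_cong[OF x B])
    also have "\<dots> = trc x (\<lambda>k l. nabla4 G (\<lambda>k l i j. nabla3 G (cotton G) l k i j) m k l i j x)"
      by (rule nabla2_trc[OF x smooth_nabla3[OF smooth_cotton]])
    also have "\<dots> = trc x (\<lambda>k l. nabla4 G (nabla3 G (cotton G)) m l k i j x)"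
      by (simp add: nabla4_def diff_diff_eq add_ac)
    finally show ?thesis .
  qed
  have R: "nabla4 G (nabla3 G (cotton G)) m l k i j x = nabla4 G (nabla3 G (cotton G)) l m k i j x
    - (trc x (\<lambda>p a. riem a k m l x * cotton G p i j x) + trc x (\<lambda>p a. riem a i m l x * cotton G k p j x)
      + trc x (\<lambda>p a. riem a j m l x * cotton G k i p x))" for m l k j
    using ricci_identity3[OF x, of "cotton G" m l k i j, OF smooth_cotton] unfolding riemann_contract[OF x] by linarith
  \<comment> \<open>The divergence in the last slot vanishes on all of \<open>U\<close>, not just at
    \<open>x\<close>, so its covariant derivative vanishes as well.\<close>
  have Z: "trc x (\<lambda>j m. nabla4 G (nabla3 G (cotton G)) l m k i j x) = 0" for l k
  proof -
    have "nabla2 G (\<lambda>k i y. trc y (\<lambda>j m. nabla3 G (cotton G) m k i j y)) l k i x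
      = trc x (\<lambda>j m. nabla4 G (\<lambda>j m k i. nabla3 G (cotton G) m k i j) l j m k i x)"
      by (rule nabla2_trc[OF x smooth_nabla3[OF smooth_cotton]])
    also have "\<dots> = trc x (\<lambda>j m. nabla4 G (nabla3 G (cotton G)) l m k i j x)"
      by (simp add: nabla4_def diff_diff_eq add_ac)
    finally have "trc x (\<lambda>j m. nabla4 G (nabla3 G (cotton G)) l m k i j x)
      = nabla2 G (\<lambda>k i y. trc y (\<lambda>j m. nabla3 G (cotton G) m k i j y)) l k i x" by (rule sym)
    also have "\<dots> = nabla2 G (\<lambda>k i y. 0) l k i x"
    proof (rule nabla2_cong[OF x])
      fix k i y assume y: "y \<in> U"
      have "trc y (\<lambda>j m. nabla3 G (cotton G) m k i j y) = trc y (\<lambda>m j. nabla3 G (cotton G) m k i j y)"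
        by (rule inner_product_components.tr_flip[OF pos_inner_product_components.axioms(1)[OF pos_inner_product[OF y]]])
      then show "trc y (\<lambda>j m. nabla3 G (cotton G) m k i j y) = 0" unfolding div_cotton[OF y] .
    qed
    also have "\<dots> = 0" by (simp add: nabla2_def)
    finally show ?thesis .
  qed
  note C_anti = cotton_anti[of _ _ _ x]
  note C_tr = trc_cotton[OF x]
  have "div_bach G i x = trc x (\<lambda>j m. nabla2 G (bach G) m i j x)"
    unfolding div_bach_def trc_def[OF x] ..
  also have "\<dots> = trc x (\<lambda>j m. trc x (\<lambda>k l. nabla4 G (nabla3 G (cotton G)) l m k i j x
    - (trc x (\<lambda>p a. riem a k m l x * cotton G p i j x) + trc x (\<lambda>p a. riem a i m l x * cotton G k p j x)
      + trc x (\<lambda>p a. riem a j m l x * cotton G k i p x))))"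
    unfolding nB by (intro arg_cong[of _ _ "trc x"] ext) (rule R)
  also have "\<dots> = trc x (\<lambda>j m. trc x (\<lambda>k l. nabla4 G (nabla3 G (cotton G)) l m k i j x))
    - trc x (\<lambda>j m. trc x (\<lambda>k l. trc x (\<lambda>p a. riem a k m l x * cotton G p i j x)
      + trc x (\<lambda>p a. riem a i m l x * cotton G k p j x) + trc x (\<lambda>p a. riem a j m l x * cotton G k i p x)))"
    by (simp only: tr_diff)
  also have "trc x (\<lambda>j m. trc x (\<lambda>k l. nabla4 G (nabla3 G (cotton G)) l m k i j x))
    = trc x (\<lambda>k l. trc x (\<lambda>j m. nabla4 G (nabla3 G (cotton G)) l m k i j x))"
    by (rule tr_swap)
  also have "\<dots> = 0" unfolding Z by (rule tr_zero)
  also note curvature_C_contraction[of "\<lambda>i j k. cotton G i j k x", OF C_anti C_tr]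
  also note Ric_C_eq_Sch_C[of "\<lambda>i j k. cotton G i j k x", OF C_anti C_tr, symmetric]
  finally show ?thesis unfolding ricci_Ric[OF x] by simp
qed

text \<open>The metric is parallel, so the soliton equation turns derivatives of the Ricci tensor
  into minus second covariant derivatives of dh. Their skew part is the curvature applied to dh,
  which the three-dimensional decomposition reduces to Ricci and metric terms.\<close>

lemma soliton_cotton_eq_0:
  assumes h: "smooth_on U h"
    and soliton: "\<And>y i j. y \<in> U \<Longrightarrow> ricci G i j y + hessian G h i j y = \<rho> * G y $ i $ j"
    and div: "\<And>i. div_bach G i x = 0" and x: "x \<in> U"
  shows "cotton G i j k x = 0"
proof -
  interpret curvature_components "\<lambda>i j. G x $ i $ j" "\<lambda>i j. inverse_metric G i j x" "\<lambda>l k i j. riem l k i j x"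
    by (rule curvature[OF x])
  interpret P: pos_inner_product_components "\<lambda>i j. G x $ i $ j" "\<lambda>i j. inverse_metric G i j x"
    by (rule pos_inner_product[OF x])
  define w where "w i = partial i h" for i
  have sw: "smooth_on U (w i)" for i unfolding w_def by (rule smooth_on_partial[OF h])
  have hes: "hessian G h i j y = nabla1 G w i j y" for i j y
    unfolding hessian_def w_def ..
  have nr: "nabla2 G (ricci G) i j k x = - nabla2 G (nabla1 G w) i j k x" for i j k
  proof -
    have "nabla2 G (ricci G) i j k x = nabla2 G (\<lambda>j k y. \<rho> * G y $ j $ k - nabla1 G w j k y) i j k x"
      using soliton hes by (intro nabla2_cong[OF x]) (metis add_diff_cancel_right')
    also have "\<dots> = \<rho> * nabla2 G (\<lambda>i j y. G y $ i $ j) i j k x - nabla2 G (nabla1 G w) i j k x"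
      unfolding nabla2_def by (simp only: pd_diff[OF x] pd_mult[OF x] smooth_rules smooth_nabla1[OF sw] partial_const sum_3)
        (simp add: algebra_simps)
    finally show ?thesis unfolding nabla2_metric[OF x] by simp
  qed
  \<comment> \<open>\<open>v\<close> is the Schouten tensor applied to dh. \<open>z\<close> gathers
    all coefficients of the metric: \<open>v\<close>, the difference between \<open>schouten\<close>
    and \<open>ricci\<close>, and the scalar curvature term of the Cotton tensor.\<close>
  define v where "v i = trc x (\<lambda>p a. schouten a i x * w p x)" for i
  define z where "z i = v i - scalar_curvature G x / 4 * w i x - partial i (scalar_curvature G) x / 4" for i
  have Rw: "trc x (\<lambda>p a. riem a k i j x * w p x) = schouten k j x * w i x + G x $ k $ j * v i
      - schouten k i x * w j x - G x $ k $ i * v j" for i j k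
  proof -
    have "riem a k i j x * w p x = schouten k j x * (G x $ a $ i * w p x) + G x $ k $ j * (schouten a i x * w p x)
      - schouten k i x * (G x $ a $ j * w p x) - G x $ k $ i * (schouten a j x * w p x)" for a p
      by (subst riem_decomposition[OF x]) (simp add: algebra_simps)
    then show ?thesis unfolding v_def by (simp only: tr_add tr_diff tr_scale tr_g)
  qed
  have C: "cotton G i j k x = w i x * ricci G j k x - w j x * ricci G i k x + G x $ j $ k * z i - G x $ i $ k * z j" for i j k
  proof -
    have "nabla2 G (ricci G) i j k x - nabla2 G (ricci G) j i k x = trc x (\<lambda>p a. riem a k i j x * w p x)"
      using ricci_identity1[OF x, of w i j k, OF sw] unfolding nr riemann_contract[OF x] by linarith
    then have "cotton G i j k x = schouten k j x * w i x + G x $ k $ j * v i - schouten k i x * w j x - G x $ k $ i * v j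
       - 1 / 4 * (G x $ j $ k * partial i (scalar_curvature G) x - G x $ i $ k * partial j (scalar_curvature G) x)"
      unfolding cotton_def Rw by simp
    then show ?thesis
      unfolding schouten_sym[OF x, of k] G_sym[OF x, of k] unfolding schouten_def z_def by (simp add: algebra_simps)
  qed
  have 0: "trc x (\<lambda>j b. trc x (\<lambda>k c. ricci G b c x * cotton G i j k x)) = 0" for i
    using div_bach_eq[OF x, of i] div[of i] by simp
  have "trc x (\<lambda>i a. trc x (\<lambda>j b. trc x (\<lambda>k c. cotton G i j k x * cotton G a b c x))) = 0"
    by (rule norm_C_eq_zero[where C = "\<lambda>i j k. cotton G i j k x" and f = "\<lambda>i. w i x" and z = z,
          OF cotton_anti[of _ _ _ x] trc_cotton[OF x] C[unfolded ricci_Ric[OF x]] 0[unfolded ricci_Ric[OF x]]])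
  then show ?thesis by (rule P.tensor_norm_zero)
qed

end

section \<open>Local conformal flatness\<close>

lemma sum_UNIV_option:
  "(\<Sum>c\<in>(UNIV :: 'b::finite option set). F c) = F None + (\<Sum>k\<in>UNIV. F (Some k))"
  unfolding UNIV_option_conv by (subst sum.insert) (auto simp: sum.reindex)

lemma sum_UNIV_option_option:
  "(\<Sum>c\<in>(UNIV :: 'b::finite option option set). F c) = F None + F (Some None) + (\<Sum>k\<in>UNIV. F (Some (Some k)))"
  unfolding sum_UNIV_option by (simp add: add.assoc)

context metric_chart
begin

section \<open>The tractor connection and its parallel sections\<close>

definition schouten_raise where "schouten_raise i m x = (\<Sum>p\<in>UNIV. inverse_metric G m p x * schouten i p x)"

lemma smooth_schouten_raise: "smooth_on U (schouten_raise i j)"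
proof -
  have "smooth_on U (\<lambda>x. schouten_raise i j x)"
    unfolding schouten_raise_def by (intro smooth_rules smooth_schouten)
  then show ?thesis by simp
qed

lemma riemann_decomposition:
  assumes x: "x \<in> U"
  shows "riemann G l k i j x = (if l = i then 1 else 0) * schouten j k x - (if l = j then 1 else 0) * schouten i k x
    + G x $ j $ k * schouten_raise i l x - G x $ i $ k * schouten_raise j l x"
proof -
  interpret pos_inner_product_components "\<lambda>i j. G x $ i $ j" "\<lambda>i j. inverse_metric G i j x"
    by (rule pos_inner_product[OF x])
  have "inverse_metric G l p x * riem p k i j x = inverse_metric G l p x * G x $ p $ i * schouten j k x
     - inverse_metric G l p x * G x $ p $ j * schouten i k x
     + G x $ j $ k * (inverse_metric G l p x * schouten i p x) - G x $ i $ k * (inverse_metric G l p x * schouten j p x)" for p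
    unfolding riem_decomposition[OF x, of p k i j] schouten_sym[OF x, of p] schouten_sym[OF x, of k] G_sym[OF x, of k]
    by (simp add: algebra_simps)
  then have "riemann G l k i j x = (\<Sum>p\<in>UNIV. inverse_metric G l p x * G x $ p $ i) * schouten j k x
     - (\<Sum>p\<in>UNIV. inverse_metric G l p x * G x $ p $ j) * schouten i k x
     + G x $ j $ k * schouten_raise i l x - G x $ i $ k * schouten_raise j l x"
    unfolding riemann_raise[OF x] schouten_raise_def
    by (simp only: sum.distrib sum_subtractf sum_distrib_left sum_distrib_right)
  then show ?thesis unfolding H_g .
qed

text \<open>
  The connection of tractor calculus: in the trivialization \<open>(\<rho>, \<sigma>, \<mu>)\<close> with \<open>\<rho>\<close> at \<open>None\<close>,
  \<open>\<sigma>\<close> at \<open>Some None\<close> and \<open>\<mu>\<^sub>k\<close> at \<open>Some (Some k)\<close>, its parallel sections are the solutions of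
  \<open>\<partial>\<^sub>i \<sigma> = \<mu>\<^sub>i\<close>, \<open>\<nabla>\<^sub>i \<mu>\<^sub>j = - S\<^sub>i\<^sub>j \<sigma> - g\<^sub>i\<^sub>j \<rho>\<close>, \<open>\<partial>\<^sub>i \<rho> = S\<^sub>i\<^sup>m \<mu>\<^sub>m\<close>.
\<close>

definition tractor_connection :: "3 \<Rightarrow> 3 option option \<Rightarrow> 3 option option \<Rightarrow> real^3 \<Rightarrow> real" where
  "tractor_connection i a b = (case a of
     None \<Rightarrow> (case b of Some (Some m) \<Rightarrow> schouten_raise i m | _ \<Rightarrow> (\<lambda>x. 0))
   | Some None \<Rightarrow> (case b of Some (Some m) \<Rightarrow> (\<lambda>x. if i = m then 1 else 0) | _ \<Rightarrow> (\<lambda>x. 0))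
   | Some (Some j) \<Rightarrow> (case b of None \<Rightarrow> (\<lambda>x. - G x $ i $ j)
       | Some None \<Rightarrow> (\<lambda>x. - schouten i j x) | Some (Some m) \<Rightarrow> christoffel G m i j))"

lemma tractor_connection_simps:
  "tractor_connection i None None = (\<lambda>x. 0)"
  "tractor_connection i None (Some None) = (\<lambda>x. 0)"
  "tractor_connection i None (Some (Some m)) = schouten_raise i m"
  "tractor_connection i (Some None) None = (\<lambda>x. 0)"
  "tractor_connection i (Some None) (Some None) = (\<lambda>x. 0)"
  "tractor_connection i (Some None) (Some (Some m)) = (\<lambda>x. if i = m then 1 else 0)"
  "tractor_connection i (Some (Some j)) None = (\<lambda>x. - G x $ i $ j)"
  "tractor_connection i (Some (Some j)) (Some None) = (\<lambda>x. - schouten i j x)"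
  "tractor_connection i (Some (Some j)) (Some (Some m)) = christoffel G m i j"
  by (simp_all add: tractor_connection_def)

lemma smooth_tractor_connection: "smooth_on U (tractor_connection i a b)"
  by (cases a; cases "the a"; cases b; cases "the b")
    (auto simp: tractor_connection_simps
      intro!: smooth_schouten_raise smooth_christoffel smooth_on_minus[OF U] G_smooth smooth_schouten)

text \<open>The curvature is computed block by block. The block from \<mu> to \<mu> is the vanishing
  of the Weyl tensor, those from \<mu> to \<rho> and from \<sigma> to \<mu> are the Cotton tensor,
  and the others follow from metric compatibility and the symmetry of the metric, the Schouten
  tensor and the Christoffel symbols.\<close>

lemma tractor_connection_flat:
  assumes x: "x \<in> U" and C: "\<And>i j k. cotton G i j k x = 0"
  shows "partial i (tractor_connection j a b) x + (\<Sum>c\<in>UNIV. tractor_connection j a c x * tractor_connection i c b x)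
    = partial j (tractor_connection i a b) x + (\<Sum>c\<in>UNIV. tractor_connection i a c x * tractor_connection j c b x)"
proof -
  interpret pos_inner_product_components "\<lambda>i j. G x $ i $ j" "\<lambda>i j. inverse_metric G i j x"
    by (rule pos_inner_product[OF x])
  note sums = sum_UNIV_option_option tractor_connection_simps
  have s: "christoffel G m j i x = christoffel G m i j x" for m by (rule christoffel_sym[OF x])
  \<comment> \<open>The vanishing Cotton tensor, solved for one derivative of the Schouten tensor so
    as to serve as a rewrite rule.\<close>
  have dS: "partial i (schouten j q) x = partial j (schouten i q) x
     + (\<Sum>m\<in>UNIV. christoffel G m i q x * schouten j m x) - (\<Sum>m\<in>UNIV. christoffel G m j q x * schouten i m x)" for q
    using C[of i j q] unfolding cotton_schouten[OF x] nabla2_def s by linarith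
  have d1: "(\<Sum>k\<in>UNIV. (if a = k then 1 else 0) * X k) = X a" for a :: 3 and X :: "3 \<Rightarrow> real"
    by (rule sum_delta_mult)
  consider (r) "a = None" | (s) "a = Some None" | (m) k where "a = Some (Some k)" by (metis option.exhaust)
  then show ?thesis
  proof cases
    case r
    consider "b = None" | "b = Some None" | m where "b = Some (Some m)" by (metis option.exhaust)
    then show ?thesis
    proof cases
      case 1
      have "(\<Sum>m\<in>UNIV. schouten_raise j m x * - G x $ i $ m) = - schouten j i x" for i j
      proof -
        have "(\<Sum>m\<in>UNIV. schouten_raise j m x * - G x $ i $ m)
          = - (\<Sum>m\<in>UNIV. G x $ i $ m * (\<Sum>p\<in>UNIV. inverse_metric G m p x * schouten j p x))"
          unfolding schouten_raise_def by (simp add: sum_negf mult.commute)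
        then show ?thesis unfolding lower_raise .
      qed
      then show ?thesis unfolding r 1 sums by (simp add: schouten_sym[OF x, of j i])
    next
      case 2
      have "(\<Sum>m\<in>UNIV. schouten_raise j m x * - schouten i m x) = (\<Sum>m\<in>UNIV. schouten_raise i m x * - schouten j m x)"
        unfolding schouten_raise_def sum_3
        by (simp add: algebra_simps H_sym[of 2 1] H_sym[of 3 1] H_sym[of 3 2])
      then show ?thesis unfolding r 2 sums by simp
    next
      case (3 m)
      have p: "partial i (schouten_raise j m) x = (\<Sum>p\<in>UNIV. partial i (inverse_metric G m p) x * schouten j p x
        + inverse_metric G m p x * partial i (schouten j p) x)" for i j
      proof -
        have "schouten_raise j m = (\<lambda>y. \<Sum>p\<in>UNIV. inverse_metric G m p y * schouten j p y)"
          by (rule ext) (rule schouten_raise_def)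
        then show ?thesis by (simp only: pd_sum[OF x] pd_mult[OF x] smooth_rules smooth_schouten)
      qed
      show ?thesis
        unfolding r 3 sums p inverse_metric_derivative[OF x] dS unfolding schouten_raise_def sum_3
        by (simp add: algebra_simps)
    qed
  next
    case s
    consider "b = None" | "b = Some None" | m where "b = Some (Some m)" by (metis option.exhaust)
    then show ?thesis
    proof cases
      case 1
      show ?thesis unfolding s 1 sums d1 by (simp add: G_sym[OF x, of j i])
    next
      case 2
      show ?thesis unfolding s 2 sums d1 by (simp add: schouten_sym[OF x, of j i])
    next
      case (3 m)
      show ?thesis unfolding s 3 sums d1 by (simp add: christoffel_sym[OF x, of m j i])
    qed
  next
    case (m k)
    consider "b = None" | "b = Some None" | n where "b = Some (Some n)" by (metis option.exhaust)
    then show ?thesis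
    proof cases
      case 1
      show ?thesis
        unfolding m 1 sums pd_minus[OF x G_smooth] metric_derivative[OF x] s by (simp add: sum_negf mult.commute)
    next
      case 2
      show ?thesis
        unfolding m 2 sums pd_minus[OF x smooth_schouten] dS by (simp add: sum_negf)
    next
      case (3 n)
      have "(\<Sum>p\<in>UNIV. christoffel G n i p x * christoffel G p j k x - christoffel G n j p x * christoffel G p i k x)
        = (\<Sum>p\<in>UNIV. christoffel G p j k x * christoffel G n i p x) - (\<Sum>p\<in>UNIV. christoffel G p i k x * christoffel G n j p x)"
        by (simp add: sum_subtractf mult.commute)
      then show ?thesis
        using riemann_decomposition[OF x, of n k i j]
        unfolding riemann_def m 3 sums by (auto simp: algebra_simps)
    qed
  qed
qed

end

lemma metric_chart_subset: "metric_chart U G \<Longrightarrow> V \<subseteq> U \<Longrightarrow> open V \<Longrightarrow> metric_chart V G"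
  unfolding metric_chart_def using smooth_on_subset by blast

context metric_chart
begin

lemma tractor_solution:
  assumes C: "\<And>x i j k. x \<in> U \<Longrightarrow> cotton G i j k x = 0" and x0: "x0 \<in> U"
  obtains V \<sigma> \<rho> where "open V" "x0 \<in> V" "V \<subseteq> U" "smooth_on V \<sigma>" "\<And>x. x \<in> V \<Longrightarrow> \<sigma> x > 0"
    "\<And>x i j. x \<in> V \<Longrightarrow> partial i (partial j \<sigma>) x
       = (\<Sum>m\<in>UNIV. christoffel G m i j x * partial m \<sigma> x) - schouten i j x * \<sigma> x - G x $ i $ j * \<rho> x"
    "\<And>x. x \<in> V \<Longrightarrow> 2 * \<sigma> x * \<rho> x + trc x (\<lambda>a b. partial a \<sigma> x * partial b \<sigma> x) = 0"
proof -
  \<comment> \<open>The initial data \<sigma> = 1, \<mu> = 0, \<rho> = 0 form a null vector of the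
    tractor metric with \<sigma> positive.\<close>
  define y0 where "y0 a = (if a = Some None then 1 else 0 :: real)" for a :: "3 option option"
  obtain r y where r: "r > 0" "ball x0 r \<subseteq> U" and y: "\<And>a. smooth_on (ball x0 r) (y a)" "\<And>a. y a x0 = y0 a"
    and dy: "\<And>a i x. x \<in> ball x0 r \<Longrightarrow> partial i (y a) x = (\<Sum>b\<in>UNIV. tractor_connection i a b x * y b x)"
    using linear_frobenius[OF U x0, of tractor_connection y0, OF smooth_tractor_connection tractor_connection_flat[OF _ C]]
    by blast
  define \<sigma> where "\<sigma> = y (Some None)"
  define \<rho> where "\<rho> = y None"
  define \<mu> where "\<mu> k = y (Some (Some k))" for k
  interpret B: metric_chart "ball x0 r" G
    by (rule metric_chart_subset[OF metric_chart_axioms r(2) open_ball])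
  note folds = sum_UNIV_option_option tractor_connection_simps \<sigma>_def[symmetric] \<rho>_def[symmetric] \<mu>_def[symmetric]
  have s: "smooth_on (ball x0 r) \<sigma>" "smooth_on (ball x0 r) \<rho>" "smooth_on (ball x0 r) (\<mu> k)" for k
    unfolding \<sigma>_def \<rho>_def \<mu>_def by (rule y)+
  have d\<sigma>: "partial i \<sigma> x = \<mu> i x" if x: "x \<in> ball x0 r" for i x
  proof -
    have "(\<Sum>k\<in>UNIV. (if i = k then 1 else 0) * \<mu> k x) = \<mu> i x"
      by (rule inner_product_components.sum_delta_mult[OF pos_inner_product_components.axioms(1)[OF B.pos_inner_product[OF x]]])
    then show ?thesis using dy[OF x, of i "Some None"] unfolding folds by simp
  qed
  have d\<rho>: "partial i \<rho> x = (\<Sum>m\<in>UNIV. schouten_raise i m x * \<mu> m x)" if x: "x \<in> ball x0 r" for i x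
    using dy[OF x, of i None] unfolding folds by simp
  have d\<mu>: "partial i (\<mu> j) x = (\<Sum>m\<in>UNIV. christoffel G m i j x * \<mu> m x) - schouten i j x * \<sigma> x - G x $ i $ j * \<rho> x"
    if x: "x \<in> ball x0 r" for i j x
    using dy[OF x, of i "Some (Some j)"] unfolding folds by simp
  \<comment> \<open>The tractor metric evaluated on the solution. The connection preserves it, so
    \<open>q\<close> keeps its initial value zero on the ball.\<close>
  define q where "q x = 2 * (\<sigma> x * \<rho> x) + trc x (\<lambda>a b. \<mu> a x * \<mu> b x)" for x
  have q0: "q x0 = 0"
  proof -
    have "\<sigma> x0 = 1" "\<rho> x0 = 0" "\<mu> k x0 = 0" for k
      using y(2) by (simp_all add: \<sigma>_def \<rho>_def \<mu>_def y0_def)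
    then show ?thesis using inner_product_components.tr_zero[OF pos_inner_product_components.axioms(1)[OF pos_inner_product[OF x0]]]
      by (simp add: q_def)
  qed
  have sq: "smooth_on (ball x0 r) q"
  proof -
    have "smooth_on (ball x0 r) (\<lambda>x. 2 * (\<sigma> x * \<rho> x) + trc x (\<lambda>a b. \<mu> a x * \<mu> b x))"
      by (intro B.smooth_intros B.smooth_trc s)
    then show ?thesis unfolding q_def[abs_def] .
  qed
  have dq: "partial i q x = 0" if x: "x \<in> ball x0 r" for i x
  proof -
    interpret I: pos_inner_product_components "\<lambda>i j. G x $ i $ j" "\<lambda>i j. inverse_metric G i j x"
      by (rule B.pos_inner_product[OF x])
    have sm: "smooth_on (ball x0 r) (\<lambda>x. \<mu> a x * \<mu> b x)" for a b by (intro B.smooth_intros s)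
    have n: "nabla2 G (\<lambda>a b x. \<mu> a x * \<mu> b x) i a b x = (- schouten i a x * \<sigma> x) * \<mu> b x - \<rho> x * (G x $ i $ a * \<mu> b x)
       + \<mu> a x * (- schouten i b x * \<sigma> x) - \<rho> x * (G x $ i $ b * \<mu> a x)" for a b
      unfolding nabla2_def B.pd_mult[OF x s(3) s(3)] d\<mu>[OF x] sum_3 by (simp add: algebra_simps)
    have "q = (\<lambda>x. 2 * (\<sigma> x * \<rho> x) + trc x (\<lambda>a b. \<mu> a x * \<mu> b x))" by (rule ext) (rule q_def)
    then have "partial i q x = 2 * (partial i \<sigma> x * \<rho> x + \<sigma> x * partial i \<rho> x)
       + trc x (\<lambda>a b. nabla2 G (\<lambda>a b x. \<mu> a x * \<mu> b x) i a b x)"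
      by (simp only: B.pd_add[OF x] B.pd_mult[OF x] B.smooth_intros B.smooth_trc sm s partial_const B.trc_derivative[OF x sm] mult_zero_left add_0_left)
    then have e: "partial i q x = 2 * (\<mu> i x * \<rho> x + \<sigma> x * (\<Sum>m\<in>UNIV. schouten_raise i m x * \<mu> m x))
      + (trc x (\<lambda>a b. (- schouten i a x * \<sigma> x) * \<mu> b x) - \<rho> x * \<mu> i x + trc x (\<lambda>a b. \<mu> a x * (- schouten i b x * \<sigma> x)) - \<rho> x * \<mu> i x)"
      unfolding d\<sigma>[OF x] d\<rho>[OF x] n by (simp only: I.tr_add I.tr_diff I.tr_scale I.tr_g)
    have "trc x (\<lambda>a b. \<mu> a x * (- schouten i b x * \<sigma> x)) = - \<sigma> x * (\<Sum>m\<in>UNIV. schouten_raise i m x * \<mu> m x)"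
      unfolding B.trc_def[OF x] schouten_raise_def sum_3 by (simp add: algebra_simps)
    moreover have "trc x (\<lambda>a b. (- schouten i a x * \<sigma> x) * \<mu> b x) = trc x (\<lambda>a b. \<mu> a x * (- schouten i b x * \<sigma> x))"
      using I.tr_flip[of "\<lambda>a b. \<mu> a x * (- schouten i b x * \<sigma> x)"] by (simp add: mult.commute)
    ultimately show ?thesis unfolding e by (simp add: algebra_simps)
  qed
  have q: "q x = 0" if x: "x \<in> ball x0 r" for x
  proof -
    have "(q has_derivative (\<lambda>v. 0)) (at z within ball x0 r)" if z: "z \<in> ball x0 r" for z
      using has_derivative_at_withinI[OF has_derivative_partial[OF B.smooth_diff_at[OF sq z]]] unfolding dq[OF z] by simp
    then obtain c where "\<And>z. z \<in> ball x0 r \<Longrightarrow> q z = c"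
      using has_derivative_zero_constant[OF convex_ball] by blast
    then show ?thesis using q0 x r(1) by (metis centre_in_ball)
  qed
  \<comment> \<open>The ball is cut down to where \<sigma> is positive, since the conformal factor
    will be the exponential of -2 ln \<sigma>.\<close>
  define V where "V = ball x0 r \<inter> \<sigma> -` {0<..}"
  have V: "open V" unfolding V_def
    by (rule continuous_open_preimage[OF smooth_on_continuous[OF s(1)] open_ball open_greaterThan])
  have VB: "x \<in> ball x0 r" if "x \<in> V" for x using that unfolding V_def by blast
  have p2: "partial i (partial j \<sigma>) x = partial i (\<mu> j) x" if "x \<in> ball x0 r" for i j x
    by (rule partial_cong[OF open_ball that d\<sigma>])
  show thesis
  proof (rule that[of V \<sigma> \<rho>])
    show "x0 \<in> V" unfolding V_def using r(1) y(2) by (simp add: \<sigma>_def y0_def)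
    show "V \<subseteq> U" unfolding V_def using r(2) by blast
    show "smooth_on V \<sigma>" by (rule smooth_on_subset[OF s(1)]) (simp add: V_def)
    show "\<sigma> x > 0" if "x \<in> V" for x using that by (simp add: V_def)
    fix x assume "x \<in> V"
    then have x: "x \<in> ball x0 r" by (rule VB)
    show "partial i (partial j \<sigma>) x
       = (\<Sum>m\<in>UNIV. christoffel G m i j x * partial m \<sigma> x) - schouten i j x * \<sigma> x - G x $ i $ j * \<rho> x" for i j
      unfolding p2[OF x] d\<mu>[OF x] d\<sigma>[OF x] ..
    show "2 * \<sigma> x * \<rho> x + trc x (\<lambda>a b. partial a \<sigma> x * partial b \<sigma> x) = 0"
      using q[OF x] unfolding q_def d\<sigma>[OF x] by (simp add: mult.assoc)
  qed (rule V)
qed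


section \<open>Conformal change of the metric\<close>

lemma conformal_metric_chart:
  assumes u: "smooth_on U u"
  shows "metric_chart U (\<lambda>y. exp (2 * u y) *\<^sub>R G y)"
proof
  show "open U" by (rule U)
  show "smooth_on U (\<lambda>x. (exp (2 * u x) *\<^sub>R G x) $ i $ j)" for i j
    unfolding vector_scaleR_component real_scaleR_def by (intro smooth_intros smooth_on_exp[OF U] u)
  fix x assume x: "x \<in> U"
  show "(exp (2 * u x) *\<^sub>R G x) $ i $ j = (exp (2 * u x) *\<^sub>R G x) $ j $ i" for i j
    by (simp add: G_sym[OF x, of i j])
  show "v \<bullet> (exp (2 * u x) *\<^sub>R G x *v v) > 0" if "v \<noteq> 0" for v
    using G_pos[OF x that] by (simp add: scaleR_matrix_vector_assoc[symmetric])
qed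

context
  fixes u :: "real^3 \<Rightarrow> real"
  assumes u: "smooth_on U u"
begin

definition du_raise where "du_raise l x = (\<Sum>p\<in>UNIV. inverse_metric G l p x * partial p u x)"

text \<open>The difference tensor between the Levi-Civita connections of e^(2u) g and g.\<close>

definition conformal_shift :: "3 \<Rightarrow> 3 \<Rightarrow> 3 \<Rightarrow> real^3 \<Rightarrow> real" where
  "conformal_shift l i j x = (if l = i then 1 else 0) * partial j u x + (if l = j then 1 else 0) * partial i u x
     - G x $ i $ j * du_raise l x"

lemma smooth_du_raise: "smooth_on U (du_raise l)"
proof -
  have "smooth_on U (\<lambda>x. du_raise l x)"
    unfolding du_raise_def by (intro smooth_rules u)
  then show ?thesis by simp
qed

lemma smooth_conformal_shift: "smooth_on U (conformal_shift l i j)"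
proof -
  have "smooth_on U (\<lambda>x. conformal_shift l i j x)"
    unfolding conformal_shift_def by (intro smooth_intros u smooth_du_raise)
  then show ?thesis by simp
qed

text \<open>Both sides are compared after lowering the index with the rescaled metric, where the
  Christoffel symbols are explicit derivatives of e^(2u) G.\<close>

lemma conformal_christoffel:
  assumes x: "x \<in> U"
  shows "christoffel (\<lambda>y. exp (2 * u y) *\<^sub>R G y) k i j x = christoffel G k i j x + conformal_shift k i j x"
proof -
  define G' where "G' y = exp (2 * u y) *\<^sub>R G y" for y
  interpret Q: metric_chart U G' unfolding G'_def by (rule conformal_metric_chart[OF u])
  interpret pos_inner_product_components "\<lambda>i j. G x $ i $ j" "\<lambda>i j. inverse_metric G i j x"
    by (rule pos_inner_product[OF x])
  interpret QI: pos_inner_product_components "\<lambda>i j. G' x $ i $ j" "\<lambda>i j. inverse_metric G' i j x"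
    by (rule Q.pos_inner_product[OF x])
  have G': "G' y $ i $ j = exp (2 * u y) * G y $ i $ j" for i j y
    by (simp add: G'_def)
  have "((\<lambda>t. exp (2 * t)) has_real_derivative 2 * exp (2 * u x)) (at (u x))"
    by (auto intro!: derivative_eq_intros)
  from partial_DERIV_compose(1)[OF smooth_diff_at[OF u x] this]
  have de: "partial i (\<lambda>y. exp (2 * u y)) x = 2 * exp (2 * u x) * partial i u x" for i .
  have se: "smooth_on U (\<lambda>y. exp (2 * u y))" by (intro smooth_intros smooth_on_exp[OF U] u)
  have dG': "partial i (\<lambda>y. G' y $ j $ l) x = exp (2 * u x) * (2 * partial i u x * G x $ j $ l + partial i (\<lambda>y. G y $ j $ l) x)" for i j l
    unfolding G' pd_mult[OF x se G_smooth] de by (simp add: algebra_simps)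
  have "christoffel G' k i j x = christoffel G k i j x + conformal_shift k i j x"
  proof (rule QI.raise_inject[of "\<lambda>k. christoffel G' k i j x" "\<lambda>k. christoffel G k i j x + conformal_shift k i j x" k])
    fix l
    have 1: "(\<Sum>m\<in>UNIV. G x $ l $ m * conformal_shift m i j x)
      = G x $ l $ i * partial j u x + G x $ l $ j * partial i u x - G x $ i $ j * partial l u x"
    proof -
      have "(\<Sum>m\<in>UNIV. G x $ l $ m * conformal_shift m i j x)
        = (\<Sum>m\<in>UNIV. G x $ l $ m * (if m = i then 1 else 0)) * partial j u x
         + (\<Sum>m\<in>UNIV. G x $ l $ m * (if m = j then 1 else 0)) * partial i u x
         - G x $ i $ j * (\<Sum>m\<in>UNIV. G x $ l $ m * du_raise m x)"
        unfolding conformal_shift_def sum_3 by (simp only: algebra_simps)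
      then show ?thesis unfolding sum_delta_mult du_raise_def lower_raise .
    qed
    have "(\<Sum>m\<in>UNIV. G' x $ l $ m * (christoffel G m i j x + conformal_shift m i j x))
      = exp (2 * u x) * ((\<Sum>m\<in>UNIV. G x $ l $ m * christoffel G m i j x) + (\<Sum>m\<in>UNIV. G x $ l $ m * conformal_shift m i j x))"
      unfolding G' sum_3 by (simp only: algebra_simps)
    also have "\<dots> = (\<Sum>m\<in>UNIV. G' x $ l $ m * christoffel G' m i j x)"
      unfolding Q.christoffel_lower[OF x] christoffel_lower[OF x] dG' 1 G_sym[OF x, of l i] G_sym[OF x, of l j] by (simp add: field_simps)
    finally show "(\<Sum>m\<in>UNIV. G' x $ l $ m * christoffel G' m i j x)
      = (\<Sum>m\<in>UNIV. G' x $ l $ m * (christoffel G m i j x + conformal_shift m i j x))" by (rule sym)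
  qed
  then show ?thesis unfolding G'_def[abs_def] .
qed

text \<open>The hypothesis says that the Schouten tensor of e^(2u) g vanishes: under the rescaling,
  S becomes S - Hess u + du du - |du|^2 g / 2. In dimension three this tensor determines the
  curvature.\<close>

lemma conformal_flat:
  assumes du: "\<And>x i j. x \<in> U \<Longrightarrow> partial i (partial j u) x = (\<Sum>m\<in>UNIV. christoffel G m i j x * partial m u x)
     + schouten i j x + partial i u x * partial j u x - (\<Sum>m\<in>UNIV. du_raise m x * partial m u x) / 2 * G x $ i $ j"
  shows "flat_on U (\<lambda>y. exp (2 * u y) *\<^sub>R G y)"
  unfolding flat_on_def
proof (intro ballI allI)
  fix x l k i j
  assume x: "x \<in> U"
  interpret pos_inner_product_components "\<lambda>i j. G x $ i $ j" "\<lambda>i j. inverse_metric G i j x"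
    by (rule pos_inner_product[OF x])
  \<comment> \<open>Every contraction gets a name, so that the final cancellation is a polynomial
    identity in these letters instead of one in expanded sums over components.\<close>
  define \<delta> :: "3 \<Rightarrow> 3 \<Rightarrow> real" where "\<delta> l i = (if l = i then 1 else 0)" for l i
  define w where "w i = partial i u x" for i
  define wu where "wu i = du_raise i x" for i
  define w2 where "w2 = (\<Sum>m\<in>UNIV. wu m * w m)"
  define g where "g i j = G x $ i $ j" for i j
  define c where "c k i j = christoffel G k i j x" for k i j
  define T where "T k i j = conformal_shift k i j x" for k i j
  define \<gamma> where "\<gamma> i j = (\<Sum>m\<in>UNIV. c m i j * w m)" for i j
  define \<zeta> where "\<zeta> l i = (\<Sum>m\<in>UNIV. c l i m * wu m)" for l i
  define cl where "cl l i j = (\<Sum>m\<in>UNIV. g l m * c m i j)" for l i j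
  have csym: "c k i j = c k j i" for k i j unfolding c_def by (rule christoffel_sym[OF x])
  have gsym: "g i j = g j i" for i j unfolding g_def by (rule G_sym[OF x])
  have \<gamma>sym: "\<gamma> i j = \<gamma> j i" for i j unfolding \<gamma>_def csym[of _ i j] ..
  have clsym: "cl l i j = cl l j i" for l i j unfolding cl_def csym[of _ i j] ..
  have T: "T l i j = \<delta> l i * w j + \<delta> l j * w i - g i j * wu l" for l i j
    unfolding T_def conformal_shift_def \<delta>_def w_def g_def wu_def ..
  have dw: "partial i (partial j u) x = \<gamma> i j + schouten i j x + w i * w j - w2 / 2 * g i j" for i j
    unfolding du[OF x] \<gamma>_def c_def w_def w2_def wu_def g_def ..
  have gwu: "(\<Sum>m\<in>UNIV. g l m * wu m) = w l" for l
    unfolding g_def wu_def du_raise_def w_def by (rule lower_raise)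
  have dG: "partial i (\<lambda>y. G y $ j $ k) x = cl k i j + cl j i k" for i j k
    unfolding metric_derivative[OF x] cl_def g_def c_def
    using G_sym[OF x] by (simp add: mult.commute)
  have dwu: "partial i (du_raise l) x = - \<zeta> l i + schouten_raise i l x + w i * wu l - w2 / 2 * \<delta> l i" for i l
  proof -
    have "du_raise l = (\<lambda>y. \<Sum>p\<in>UNIV. inverse_metric G l p y * partial p u y)"
      by (rule ext) (rule du_raise_def)
    then have "partial i (du_raise l) x = (\<Sum>p\<in>UNIV. partial i (inverse_metric G l p) x * w p
      + inverse_metric G l p x * partial i (partial p u) x)"
      unfolding w_def by (simp only: pd_sum[OF x] pd_mult[OF x] smooth_rules u)
    also have "\<dots> = - \<zeta> l i + schouten_raise i l x + w i * wu l
      - w2 / 2 * (\<Sum>p\<in>UNIV. inverse_metric G l p x * G x $ p $ i)"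
      unfolding dw inverse_metric_derivative[OF x] \<zeta>_def \<gamma>_def wu_def du_raise_def schouten_raise_def
        w_def[symmetric] c_def[symmetric] gsym[of i] unfolding g_def sum_3 by (simp add: algebra_simps)
    finally show ?thesis unfolding H_g \<delta>_def .
  qed
  have pT: "partial i (conformal_shift l j k) x = \<delta> l j * partial i (partial k u) x + \<delta> l k * partial i (partial j u) x
     - (partial i (\<lambda>y. G y $ j $ k) x * wu l + g j k * partial i (du_raise l) x)" for i l j k
  proof -
    have "conformal_shift l j k = (\<lambda>y. \<delta> l j * partial k u y + \<delta> l k * partial j u y - G y $ j $ k * du_raise l y)"
      unfolding \<delta>_def by (rule ext) (rule conformal_shift_def)
    then show ?thesis unfolding wu_def g_def
      by (simp only: pd_add[OF x] pd_diff[OF x] pd_mult[OF x] smooth_intros u smooth_du_raise partial_const mult_zero_left add_0_left)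
  qed
  have p: "partial i (christoffel (\<lambda>y. exp (2 * u y) *\<^sub>R G y) l j k) x
    = partial i (christoffel G l j k) x + partial i (conformal_shift l j k) x" for i l j k
  proof -
    have "partial i (christoffel (\<lambda>y. exp (2 * u y) *\<^sub>R G y) l j k) x
      = partial i (\<lambda>y. christoffel G l j k y + conformal_shift l j k y) x"
      by (rule partial_cong[OF U x]) (rule conformal_christoffel)
    then show ?thesis by (simp only: pd_add[OF x] smooth_christoffel smooth_conformal_shift)
  qed
  have TX: "(\<Sum>m\<in>UNIV. T l i m * X m) = \<delta> l i * (\<Sum>m\<in>UNIV. w m * X m) + w i * X l - wu l * (\<Sum>m\<in>UNIV. g i m * X m)" for l i X
  proof -
    have "(\<Sum>m\<in>UNIV. T l i m * X m) = \<delta> l i * (\<Sum>m\<in>UNIV. w m * X m) + w i * (\<Sum>m\<in>UNIV. \<delta> l m * X m) - wu l * (\<Sum>m\<in>UNIV. g i m * X m)"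
      unfolding T sum_3 by (simp only: algebra_simps)
    then show ?thesis unfolding \<delta>_def sum_delta_mult .
  qed
  have XT: "(\<Sum>m\<in>UNIV. X m * T m j k) = X j * w k + X k * w j - g j k * (\<Sum>m\<in>UNIV. X m * wu m)" for j k X
  proof -
    have "(\<Sum>m\<in>UNIV. X m * T m j k) = (\<Sum>m\<in>UNIV. X m * \<delta> m j) * w k + (\<Sum>m\<in>UNIV. X m * \<delta> m k) * w j - g j k * (\<Sum>m\<in>UNIV. X m * wu m)"
      unfolding T sum_3 by (simp only: algebra_simps)
    then show ?thesis unfolding \<delta>_def sum_delta_mult .
  qed
  have wc: "(\<Sum>m\<in>UNIV. w m * c m j k) = \<gamma> j k" for j k unfolding \<gamma>_def by (simp add: mult.commute)
  have w2: "(\<Sum>m\<in>UNIV. w m * wu m) = w2" unfolding w2_def by (simp add: mult.commute)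
  have "riemann (\<lambda>y. exp (2 * u y) *\<^sub>R G y) l k i j x
    = riemann G l k i j x + partial i (conformal_shift l j k) x - partial j (conformal_shift l i k) x
      + ((\<Sum>m\<in>UNIV. c l i m * T m j k) + (\<Sum>m\<in>UNIV. T l i m * c m j k) + (\<Sum>m\<in>UNIV. T l i m * T m j k))
      - ((\<Sum>m\<in>UNIV. c l j m * T m i k) + (\<Sum>m\<in>UNIV. T l j m * c m i k) + (\<Sum>m\<in>UNIV. T l j m * T m i k))"
    unfolding riemann_def conformal_christoffel[OF x] p T_def[symmetric] c_def[symmetric] sum_3 by (simp add: algebra_simps)
  also have "\<dots> = 0"
    unfolding riemann_decomposition[OF x, folded \<delta>_def] g_def[symmetric] pT dG dwu dw TX XT wc w2 gwu
      \<zeta>_def[symmetric] cl_def[symmetric]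
    unfolding T
      csym[of _ j i] \<gamma>sym[of j i] clsym[of _ j i] gsym[of j i] schouten_sym[OF x, of j i]
    by (simp add: field_simps)
  finally show "riemann (\<lambda>y. exp (2 * u y) *\<^sub>R G y) l k i j x = 0" .
qed

end

text \<open>For u = - ln \<sigma> the factor e^(2u) is \<sigma>^(-2), and the second-order equation
  for \<sigma>, divided by -\<sigma>, becomes the hypothesis of
  \<open>conformal_flat\<close>.\<close>

lemma locally_conformally_flat_at:
  assumes C: "\<And>x i j k. x \<in> U \<Longrightarrow> cotton G i j k x = 0" and x0: "x0 \<in> U"
  shows "\<exists>V u. open V \<and> x0 \<in> V \<and> V \<subseteq> U \<and> smooth_on V u \<and> flat_on V (\<lambda>y. exp (2 * u y) *\<^sub>R G y)"
proof -
  obtain V \<sigma> \<rho> where V: "open V" "x0 \<in> V" "V \<subseteq> U" and s: "smooth_on V \<sigma>" and pos: "\<And>x. x \<in> V \<Longrightarrow> \<sigma> x > 0"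
    and d2: "\<And>x i j. x \<in> V \<Longrightarrow> partial i (partial j \<sigma>) x
       = (\<Sum>m\<in>UNIV. christoffel G m i j x * partial m \<sigma> x) - schouten i j x * \<sigma> x - G x $ i $ j * \<rho> x"
    and null: "\<And>x. x \<in> V \<Longrightarrow> 2 * \<sigma> x * \<rho> x + trc x (\<lambda>a b. partial a \<sigma> x * partial b \<sigma> x) = 0"
    by (rule tractor_solution[OF C x0]) (assumption | rule that; assumption)+
  interpret V: metric_chart V G
    by (rule metric_chart_subset[OF metric_chart_axioms V(3,1)])
  define u where "u x = - ln (\<sigma> x)" for x
  have su: "smooth_on V u"
    unfolding u_def[abs_def] by (intro smooth_on_minus smooth_on_ln V s pos)
  have du: "partial i u x = - (inverse (\<sigma> x) * partial i \<sigma> x)" if x: "x \<in> V" for i x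
  proof -
    have "((\<lambda>t. - ln t) has_real_derivative - inverse (\<sigma> x)) (at (\<sigma> x))"
      using pos[OF x] by (auto intro!: derivative_eq_intros simp: divide_inverse)
    from partial_DERIV_compose(1)[OF V.smooth_diff_at[OF s x] this] show ?thesis
      unfolding u_def[abs_def] by simp
  qed
  have "flat_on V (\<lambda>y. exp (2 * u y) *\<^sub>R G y)"
  proof (rule V.conformal_flat[OF su])
    fix x i j assume x: "x \<in> V"
    have s0: "\<sigma> x \<noteq> 0" using pos[OF x] by simp
    have si: "smooth_on V (\<lambda>x. inverse (\<sigma> x))"
      by (rule smooth_on_inverse[OF V(1) s]) (use pos in force)
    have "((\<lambda>t. inverse t) has_real_derivative - (inverse (\<sigma> x) * inverse (\<sigma> x))) (at (\<sigma> x))"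
      using s0 by (auto intro!: derivative_eq_intros)
    from partial_DERIV_compose(1)[OF V.smooth_diff_at[OF s x] this]
    have dinv: "partial i (\<lambda>x. inverse (\<sigma> x)) x = - (inverse (\<sigma> x) * inverse (\<sigma> x)) * partial i \<sigma> x" .
    have "partial i (partial j u) x = partial i (\<lambda>x. - (inverse (\<sigma> x) * partial j \<sigma> x)) x"
      by (rule partial_cong[OF V(1) x du])
    also have "\<dots> = - (- (inverse (\<sigma> x) * inverse (\<sigma> x)) * partial i \<sigma> x * partial j \<sigma> x
        + inverse (\<sigma> x) * partial i (partial j \<sigma>) x)"
      by (simp only: V.pd_minus[OF x] V.pd_mult[OF x] V.smooth_intros si s dinv)
    finally have p: "partial i (partial j u) x = partial i u x * partial j u x - inverse (\<sigma> x) * partial i (partial j \<sigma>) x"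
      unfolding du[OF x] by (simp add: algebra_simps)
    define t where "t = trc x (\<lambda>a b. partial a \<sigma> x * partial b \<sigma> x)"
    have w2: "(\<Sum>m\<in>UNIV. V.du_raise u m x * partial m u x) = inverse (\<sigma> x) * inverse (\<sigma> x) * t"
      unfolding t_def V.du_raise_def[OF su] du[OF x] V.trc_def[OF x] sum_3 by (simp add: algebra_simps)
    have c: "(\<Sum>m\<in>UNIV. christoffel G m i j x * partial m u x) = - (inverse (\<sigma> x) * (\<Sum>m\<in>UNIV. christoffel G m i j x * partial m \<sigma> x))"
      unfolding du[OF x] sum_3 by (simp add: algebra_simps)
    \<comment> \<open>The null condition eliminates \<rho>: the term \<rho> / \<sigma> becomes -
      |du|^2 / 2, the coefficient of the metric that flatness requires.\<close>
    have r: "\<rho> x = - t / (2 * \<sigma> x)" using null[OF x] s0 unfolding t_def by (simp add: field_simps)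
    show "partial i (partial j u) x = (\<Sum>m\<in>UNIV. christoffel G m i j x * partial m u x)
     + schouten i j x + partial i u x * partial j u x - (\<Sum>m\<in>UNIV. V.du_raise u m x * partial m u x) / 2 * G x $ i $ j"
      unfolding w2 p d2[OF x] c r using s0 by (simp add: field_simps)
  qed
  then show ?thesis using V su by blast
qed

end

section \<open>From charts to the manifold\<close>

lemma riemannian_metric_chart:
  assumes "smooth_manifold X A" "riemannian_metric A g" "c \<in> A"
  shows "metric_chart (chart_image c) (g c)"
proof
  show "open (chart_image c)" using assms unfolding smooth_manifold_def is_chart_def by blast
  show "smooth_on (chart_image c) (\<lambda>x. g c x $ i $ j)" for i j
    using assms unfolding riemannian_metric_def by blast
  fix x assume x: "x \<in> chart_image c"
  have "transpose (g c x) = g c x" using assms x unfolding riemannian_metric_def by blast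
  from arg_cong[OF this, of "\<lambda>A. A $ i $ j" for i j]
  show "g c x $ i $ j = g c x $ j $ i" for i j by (simp add: transpose_def)
  show "v \<bullet> (g c x *v v) > 0" if "v \<noteq> 0" for v
    using assms x that unfolding riemannian_metric_def by blast
qed

theorem theorem1p2:
  fixes X :: "'a topology"
    and A :: "('a, 3) chart set"
    and g :: "('a, 3) chart \<Rightarrow> 3 metric_components"
    and f :: "'a \<Rightarrow> real"
  assumes "complete_gradient_ricci_soliton X A g f"
    and "divergence_free_bach A g"
  shows "einstein A g \<or> locally_conformally_flat A g"
proof -
  have manifold: "smooth_manifold X A" "riemannian_metric A g" and f: "smooth_function A f"
    using assms(1) unfolding complete_gradient_ricci_soliton_def riemannian_manifold_def by blast+
  obtain \<rho> where \<rho>: "\<And>c x i j. c \<in> A \<Longrightarrow> x \<in> chart_image c \<Longrightarrow>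
      ricci (g c) i j x + hessian (g c) (f \<circ> chart_inv c) i j x = \<rho> * g c x $ i $ j"
    using assms(1) unfolding complete_gradient_ricci_soliton_def by blast
  have "locally_conformally_flat A g"
    unfolding locally_conformally_flat_def
  proof (intro ballI)
    fix c x assume c: "c \<in> A" and x: "x \<in> chart_image c"
    interpret metric_chart "chart_image c" "g c"
      by (rule riemannian_metric_chart[OF manifold c])
    have h: "smooth_on (chart_image c) (f \<circ> chart_inv c)"
      using f c unfolding smooth_function_def by blast
    have "cotton (g c) i j k y = 0" if y: "y \<in> chart_image c" for i j k y
    proof (rule soliton_cotton_eq_0[OF h \<rho>[OF c] _ y])
      show "div_bach (g c) i y = 0" for i
        using assms(2) c y unfolding divergence_free_bach_def by blast
    qed
    from locally_conformally_flat_at[OF this x]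
    show "\<exists>V u. open V \<and> x \<in> V \<and> V \<subseteq> chart_image c \<and> smooth_on V u \<and>
        flat_on V (\<lambda>y. exp (2 * u y) *\<^sub>R g c y)" .
  qed
  then show ?thesis ..
qed

end
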